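(* Assume $p\ge2n$. There exist positive numerical constants $c_0,c_1,\dots,c_5$ such that the following holds for all $\gamma\le0.06$ and all $p\ge c_0$. For every integer $0\le k_0<n$ (with $k_0<p$) and every $1\le\Delta\le p-k_0$, $$\rho^{*2}_\gamma[k_0,\Delta]\ge c_1\begin{cases}\min\Big[\frac1{\sqrt n}+\frac{k_0}{n}\log\big(1+\frac{\sqrt p}{k_0}\big),\ \frac{\Delta}{n}\log\big(1+\frac{\sqrt p}{\Delta}\big)\Big] & \text{if } 0\le k_0\le\sqrt p\wedge n,\\[4pt] \frac{\Delta}{n}\,\frac{\log^2\big(1+\sqrt{k_0/\Delta}\big)}{\log p} & \text{if } \sqrt p<k_0<n.\end{cases}$$ (with the convention $\frac{k_0}{n}\log(1+\sqrt p/k_0)=0$ when $k_0=0$). Furthermore, if $p\ge c_2n^2$ and $k_0\ge c_3 n/\log(\sqrt p/n)$ (and $k_0<n$), then for all $1\le\Delta\le p-k_0$, $$\rho^{*2}_\gamma[k_0,\Delta]\ge c_4\frac{\Delta\wedge k_0}{n}\log\Big(2\vee\frac{\sqrt p}{k_0}\Big)\exp\Big(c_5\frac{k_0}{n}\log\big(1+\tfrac{\sqrt p}{k_0}\big)\Big).$$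
   Context: Model: for integers $n,p\ge1$, an unknown $\theta^*\in\mathbb R^p$, $\sigma>0$ and a $p\times p$ covariance matrix $\Sigma$, one observes $(Y,\mathbf X)$ where the rows of $\mathbf X\in\mathbb R^{n\times p}$ are i.i.d. $\mathcal N(0,\Sigma)$, $\epsilon\sim\mathcal N(0,I_n)$ is independent of $\mathbf X$, and $Y=\mathbf X\theta^*+\sigma\epsilon$. $\mathbb P_{\theta^*,\Sigma,\sigma}$ denotes the law of $(Y,\mathbf X)$. $\|\theta\|_0$ is the number of nonzero entries of $\theta$; $\mathbb B_0[k]=\{\theta\in\mathbb R^p:\|\theta\|_0\le k\}$; $d_2(\theta,A)=\inf_{u\in A}\|\theta-u\|_2$. Independent setting: $\Sigma=I_p$ and $\sigma>0$ is fixed and known. A test is a measurable $\{0,1\}$-valued function $\phi$ of $(Y,\mathbf X)$. For $\rho>0$, $R(\phi;k_0,\Delta,\rho)=\sup_{\theta\in\mathbb B_0[k_0]}\mathbb P_{\theta,I_p,\sigma}[\phi=1]+\sup_{\theta\in\mathbb B_0[k_0+\Delta],\,d_2(\theta,\mathbb B_0[k_0])\ge\rho\sigma}\mathbb P_{\theta,I_p,\sigma}[\phi=0]$; $\rho_\gamma(\phi;k_0,\Delta)=\sup\{\rho>0:R(\phi;k_0,\Delta,\rho)>\gamma\}$; the minimax separation distance is $\rho^*_\gamma[k_0,\Delta]=\inf_\phi\rho_\gamma(\phi;k_0,\Delta)$. *)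

theory Defs
  imports "HOL-Probability.Probability"
begin

definition std_gauss :: "real measure" where
  "std_gauss = density lborel std_normal_density"

definition obs_space :: "nat \<Rightarrow> nat \<Rightarrow> ((nat \<Rightarrow> real) \<times> (nat \<times> nat \<Rightarrow> real)) measure" where
  "obs_space n p = (PiM {..<n} (\<lambda>_. borel)) \<Otimes>\<^sub>M (PiM ({..<n} \<times> {..<p}) (\<lambda>_. borel))"

text \<open>Law of (epsilon, X): all entries i.i.d. standard Gaussian (Sigma = I_p).\<close>
definition noise_law :: "nat \<Rightarrow> nat \<Rightarrow> ((nat \<Rightarrow> real) \<times> (nat \<times> nat \<Rightarrow> real)) measure" where
  "noise_law n p = (PiM {..<n} (\<lambda>_. std_gauss)) \<Otimes>\<^sub>M (PiM ({..<n} \<times> {..<p}) (\<lambda>_. std_gauss))"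

definition obs_law :: "nat \<Rightarrow> nat \<Rightarrow> (nat \<Rightarrow> real) \<Rightarrow> real \<Rightarrow> ((nat \<Rightarrow> real) \<times> (nat \<times> nat \<Rightarrow> real)) measure" where
  "obs_law n p \<theta> \<sigma> = distr (noise_law n p) (obs_space n p)
     (\<lambda>(e, x). ((\<lambda>i\<in>{..<n}. (\<Sum>j<p. x (i, j) * \<theta> j) + \<sigma> * e i), x))"

text \<open>Vectors of R^p are functions nat => real vanishing outside {..<p}.\<close>
definition l0norm :: "nat \<Rightarrow> (nat \<Rightarrow> real) \<Rightarrow> nat" where
  "l0norm p \<theta> = card {j\<in>{..<p}. \<theta> j \<noteq> 0}"

definition B0 :: "nat \<Rightarrow> nat \<Rightarrow> (nat \<Rightarrow> real) set" where
  "B0 p k = {\<theta>. (\<forall>j\<ge>p. \<theta> j = 0) \<and> l0norm p \<theta> \<le> k}"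

definition d2 :: "nat \<Rightarrow> (nat \<Rightarrow> real) \<Rightarrow> (nat \<Rightarrow> real) set \<Rightarrow> real" where
  "d2 p \<theta> A = Inf ((\<lambda>u. sqrt (\<Sum>j<p. (\<theta> j - u j)\<^sup>2)) ` A)"

text \<open>Tests: measurable {0,1}-valued maps; True encodes phi = 1.\<close>
definition tests :: "nat \<Rightarrow> nat \<Rightarrow> ((nat \<Rightarrow> real) \<times> (nat \<times> nat \<Rightarrow> real) \<Rightarrow> bool) set" where
  "tests n p = measurable (obs_space n p) (count_space UNIV)"

definition risk :: "nat \<Rightarrow> nat \<Rightarrow> real \<Rightarrow> nat \<Rightarrow> nat \<Rightarrow> real
    \<Rightarrow> ((nat \<Rightarrow> real) \<times> (nat \<times> nat \<Rightarrow> real) \<Rightarrow> bool) \<Rightarrow> real" where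
  "risk n p \<sigma> k0 \<Delta> \<rho> \<phi> =
     (SUP \<theta>\<in>B0 p k0. measure (obs_law n p \<theta> \<sigma>) {\<omega>\<in>space (obs_law n p \<theta> \<sigma>). \<phi> \<omega>})
   + (SUP \<theta>\<in>{\<theta>\<in>B0 p (k0 + \<Delta>). d2 p \<theta> (B0 p k0) \<ge> \<rho> * \<sigma>}.
        measure (obs_law n p \<theta> \<sigma>) {\<omega>\<in>space (obs_law n p \<theta> \<sigma>). \<not> \<phi> \<omega>})"

text \<open>rho_gamma(phi; k0, Delta) = sup {rho > 0 : R > gamma}, with sup of the empty set = 0.\<close>
definition rho_test :: "nat \<Rightarrow> nat \<Rightarrow> real \<Rightarrow> real \<Rightarrow> nat \<Rightarrow> nat
    \<Rightarrow> ((nat \<Rightarrow> real) \<times> (nat \<times> nat \<Rightarrow> real) \<Rightarrow> bool) \<Rightarrow> ereal" where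
  "rho_test n p \<sigma> \<gamma> k0 \<Delta> \<phi> =
     Sup (insert 0 (ereal ` {\<rho>. \<rho> > 0 \<and> risk n p \<sigma> k0 \<Delta> \<rho> \<phi> > \<gamma>}))"

definition minimax_sep :: "nat \<Rightarrow> nat \<Rightarrow> real \<Rightarrow> real \<Rightarrow> nat \<Rightarrow> nat \<Rightarrow> ereal" where
  "minimax_sep n p \<sigma> \<gamma> k0 \<Delta> = (INF \<phi>\<in>tests n p. rho_test n p \<sigma> \<gamma> k0 \<Delta> \<phi>)"

end

theory Submission
  imports Defs "HOL-Computational_Algebra.Polynomial"
begin

text \<open>
  Every case compares two finite priors, one carried by \<open>k\<^sub>0\<close>-sparse vectors and one by vectors far
  from them, and bounds the total variation distance of the resulting mixtures. Fixing some
  coordinates to known values uses up part of the sparsity budget and reduces \<open>k\<^sub>0\<close> at will.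

  For \<open>k\<^sub>0 \<le> \<surd>p\<close>, and in the ultra-high-dimensional regime, the priors pick one coordinate from each
  block of a partition and have a deterministic norm \<open>r\<close>. Both mixtures are then \<open>\<chi>\<^sup>2\<close>-close to the
  pure noise model of variance \<open>s\<^sup>2 = 1 + r\<^sup>2\<close>: two vectors with inner product \<open>c\<close> contribute
  \<open>(s\<^sup>2 / (s\<^sup>2 - c))\<^sup>n\<close>, which stays harmless up to \<open>n ln (1 + r\<^sup>2)\<close> of order
  \<open>k\<^sub>0 ln (1 + \<surd>p / k\<^sub>0)\<close>; this is the source of the exponential factor. Comparing \<open>\<theta> = 0\<close> with the
  same reference yields the term \<open>1 / \<surd>n\<close>.

  For \<open>k\<^sub>0 > \<surd>p\<close> and \<open>\<Delta> \<ge> p\<^bsup>1/4\<^esup>\<close> the coordinates are i.i.d. with marginals that share their first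
  \<open>2m + 1\<close> moments, \<open>m\<close> of order \<open>ln p\<close>, but put different mass on \<open>0\<close>. Exchanging the marginals one
  coordinate at a time costs less than \<open>1 / p\<close> each, since only the tail of an exponential series
  survives the moment matching.
\<close>

section \<open>Likelihoods and the chi-square bound\<close>

text \<open>The length of \<open>Y\<close> alone reveals the norm of \<theta> up to a relative error
  of order 1/sqrt n. The two block priors for composite hypotheses are therefore given exactly the
  same norm, so that only the number of nonzero entries differs; the price 1/sqrt n is paid only
  against the one-point null. Both mixtures are compared with pure noise rather than with each other
  because a product of likelihoods divided by a mixture has no closed form. Beyond sparsity sqrt p
  two random supports overlap in about k^2/p places, more than a constant, and the second moment of
  a block mixture explodes: this forces moment matching. There the number of nonzero entries is
  random, with fluctuations of the order of the square root of its mean, which must stay below the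
  gap. This caps the mean at order \<Delta>^2 and the attainable logarithm at order ln \<Delta>,
  comparable with ln p only if \<Delta> is at least a power of p; smaller gaps go back to block
  priors. Since \<gamma> \<le> 0.06, it suffices that the distance of the mixtures plus the prior
  masses off the hypotheses stays below 0.94.\<close>

lemma chi2_bound:
  fixes f :: "'i \<Rightarrow> 'a \<Rightarrow> real"
  assumes fin: "finite I"
    and [measurable]: "\<And>i. i \<in> I \<Longrightarrow> f i \<in> borel_measurable N" "q \<in> borel_measurable N" "\<psi> \<in> borel_measurable N"
    and f0: "\<And>i x. i \<in> I \<Longrightarrow> 0 \<le> f i x" and q0: "\<And>x. 0 < q x"
    and f1: "\<And>i. i \<in> I \<Longrightarrow> (\<integral>\<^sup>+x. ennreal (f i x) \<partial>N) = 1" and q1: "(\<integral>\<^sup>+x. ennreal (q x) \<partial>N) = 1"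
    and K: "\<And>i j. i \<in> I \<Longrightarrow> j \<in> I \<Longrightarrow> (\<integral>\<^sup>+x. ennreal (f i x * f j x / q x) \<partial>N) = ennreal (K i j)"
    and K0: "\<And>i j. i \<in> I \<Longrightarrow> j \<in> I \<Longrightarrow> 0 \<le> K i j"
    and \<psi>: "\<And>x. 0 \<le> \<psi> x" "\<And>x. \<psi> x \<le> 1"
  shows "\<bar>(\<Sum>i\<in>I. c i * (\<integral>x. \<psi> x * f i x \<partial>N)) - d * (\<integral>x. \<psi> x * q x \<partial>N)\<bar>
      \<le> sqrt ((\<Sum>i\<in>I. \<Sum>j\<in>I. c i * c j * K i j) - 2 * d * (\<Sum>i\<in>I. c i) + d\<^sup>2)"
proof -
  \<comment> \<open>\<open>g\<close> is the signed density to be bounded. \<open>d = 1\<close> with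
    total weight 1 compares a mixture with \<open>q\<close>; \<open>d = 0\<close> bounds a signed
    combination, with \<open>q\<close> as a mere weight in the Cauchy-Schwarz inequality.\<close>
  define g where "g x = (\<Sum>i\<in>I. c i * f i x) - d * q x" for x
  have [measurable]: "g \<in> borel_measurable N" unfolding g_def by measurable
  have If: "integrable N (f i)" if "i \<in> I" for i
    using that f1[OF that] f0 by (intro integrableI_nonneg) auto
  have Iq: "integrable N q"
    using q1 q0 by (intro integrableI_nonneg) (auto intro: less_imp_le)
  have If1: "integral\<^sup>L N (f i) = 1" if "i \<in> I" for i
    using f1[OF that] f0 that by (subst integral_eq_nn_integral) auto
  have Iq1: "integral\<^sup>L N q = 1"
    using q1 q0 by (subst integral_eq_nn_integral) (auto intro: less_imp_le)
  have IK: "integrable N (\<lambda>x. f i x * f j x / q x)" if "i \<in> I" "j \<in> I" for i j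
    using that K[OF that] f0 q0 by (intro integrableI_nonneg) (auto intro!: divide_nonneg_pos mult_nonneg_nonneg)
  have IK1: "(\<integral>x. f i x * f j x / q x \<partial>N) = K i j" if "i \<in> I" "j \<in> I" for i j
    using K[OF that] f0 q0 that K0
    by (subst integral_eq_nn_integral) (auto intro!: divide_nonneg_pos mult_nonneg_nonneg)
  have bdd: "integrable N (\<lambda>x. \<psi> x * h x)" if "integrable N h" for h :: "'a \<Rightarrow> real"
  proof (rule Bochner_Integration.integrable_bound[OF that])
    show "(\<lambda>x. \<psi> x * h x) \<in> borel_measurable N" using that by measurable
    show "AE x in N. norm (\<psi> x * h x) \<le> norm (h x)"
      using \<psi> by (auto simp: abs_mult intro!: mult_left_le_one_le)
  qed
  have eq: "(g x)\<^sup>2 / q x = (\<Sum>i\<in>I. \<Sum>j\<in>I. c i * c j * (f i x * f j x / q x)) - 2 * d * (\<Sum>i\<in>I. c i * f i x) + d\<^sup>2 * q x" for x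
  proof -
    define s where "s = (\<Sum>i\<in>I. c i * f i x)"
    have "(\<Sum>i\<in>I. \<Sum>j\<in>I. c i * c j * (f i x * f j x / q x)) = s * s / q x"
      by (simp add: s_def sum_product sum_divide_distrib algebra_simps)
    moreover have "(s - d * q x)\<^sup>2 / q x = s * s / q x - 2 * d * s + d\<^sup>2 * q x"
      using q0[of x] by (simp add: power2_eq_square field_simps)
    ultimately show ?thesis by (simp add: g_def s_def)
  qed
  have Hf: "has_bochner_integral N (f i) 1" if "i \<in> I" for i
    using If[OF that] If1[OF that] by (simp add: has_bochner_integral_iff)
  have Hq: "has_bochner_integral N q 1"
    using Iq Iq1 by (simp add: has_bochner_integral_iff)
  have HK: "has_bochner_integral N (\<lambda>x. f i x * f j x / q x) (K i j)" if "i \<in> I" "j \<in> I" for i j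
    using IK[OF that] IK1[OF that] by (simp add: has_bochner_integral_iff)
  have Ig: "integrable N g"
    unfolding g_def using If Iq by (intro Bochner_Integration.integrable_diff Bochner_Integration.integrable_sum) auto
  \<comment> \<open>\<open>C\<close> is the integral of g^2/q. Cauchy-Schwarz for |g|/sqrt q and
    sqrt q, the latter having square integral 1, bounds the integral of |g| by sqrt C.\<close>
  define C where "C = (\<Sum>i\<in>I. \<Sum>j\<in>I. c i * c j * K i j) - 2 * d * (\<Sum>i\<in>I. c i) + d\<^sup>2"
  have "has_bochner_integral N (\<lambda>x. (g x)\<^sup>2 / q x)
     ((\<Sum>i\<in>I. \<Sum>j\<in>I. c i * c j * K i j) - 2 * d * (\<Sum>i\<in>I. c i * 1) + d\<^sup>2 * 1)"
    unfolding eq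
    by (intro has_bochner_integral_add has_bochner_integral_diff has_bochner_integral_sum
        has_bochner_integral_mult_right Hf Hq HK)
  then have C: "(\<integral>x. (g x)\<^sup>2 / q x \<partial>N) = C" and Ig2: "integrable N (\<lambda>x. (g x)\<^sup>2 / q x)"
    by (simp_all add: has_bochner_integral_iff C_def)
  have "(\<integral>\<^sup>+x. ennreal \<bar>g x\<bar> \<partial>N)\<^sup>2 = (\<integral>\<^sup>+x. ennreal (\<bar>g x\<bar> / sqrt (q x)) * ennreal (sqrt (q x)) \<partial>N)\<^sup>2"
    by (intro arg_cong[where f="\<lambda>x. x\<^sup>2"] nn_integral_cong)
       (metis abs_ge_zero divide_nonneg_pos ennreal_mult' nonzero_eq_divide_eq q0 real_sqrt_gt_zero real_sqrt_ge_zero less_imp_le less_numeral_extra(3))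
  also have "\<dots> \<le> (\<integral>\<^sup>+x. (ennreal (\<bar>g x\<bar> / sqrt (q x)))\<^sup>2 \<partial>N) * (\<integral>\<^sup>+x. (ennreal (sqrt (q x)))\<^sup>2 \<partial>N)"
    by (intro Cauchy_Schwarz_nn_integral) measurable
  also have "(\<integral>\<^sup>+x. (ennreal (sqrt (q x)))\<^sup>2 \<partial>N) = 1"
    using q1 q0 by (simp add: ennreal_power less_imp_le)
  also have "(\<integral>\<^sup>+x. (ennreal (\<bar>g x\<bar> / sqrt (q x)))\<^sup>2 \<partial>N) = (\<integral>\<^sup>+x. ennreal ((g x)\<^sup>2 / q x) \<partial>N)"
    using q0 by (intro nn_integral_cong) (simp add: ennreal_power less_imp_le power_divide)
  also have "\<dots> = ennreal C"
    using C Ig2 q0 by (subst nn_integral_eq_integral) (auto simp: less_imp_le)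
  finally have *: "(\<integral>\<^sup>+x. ennreal \<bar>g x\<bar> \<partial>N)\<^sup>2 \<le> ennreal C" by simp
  have "(\<integral>\<^sup>+x. ennreal \<bar>g x\<bar> \<partial>N) = ennreal (\<integral>x. \<bar>g x\<bar> \<partial>N)"
    using Ig by (intro nn_integral_eq_integral) auto
  moreover have C0: "0 \<le> C" unfolding C[symmetric] using q0 by (intro integral_nonneg_AE) (auto simp: less_imp_le)
  ultimately have "(\<integral>x. \<bar>g x\<bar> \<partial>N)\<^sup>2 \<le> C" using * by (simp add: ennreal_power)
  then have gC: "(\<integral>x. \<bar>g x\<bar> \<partial>N) \<le> sqrt C" by (rule real_le_rsqrt)
  have "(\<Sum>i\<in>I. c i * (\<integral>x. \<psi> x * f i x \<partial>N)) - d * (\<integral>x. \<psi> x * q x \<partial>N) = (\<integral>x. \<psi> x * g x \<partial>N)"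
  proof -
    have H: "has_bochner_integral N (\<lambda>x. \<psi> x * h x) (\<integral>x. \<psi> x * h x \<partial>N)" if "integrable N h" for h
      using bdd[OF that] by (simp add: has_bochner_integral_iff)
    have "has_bochner_integral N (\<lambda>x. (\<Sum>i\<in>I. c i * (\<psi> x * f i x)) - d * (\<psi> x * q x))
      ((\<Sum>i\<in>I. c i * (\<integral>x. \<psi> x * f i x \<partial>N)) - d * (\<integral>x. \<psi> x * q x \<partial>N))"
      by (intro has_bochner_integral_diff has_bochner_integral_sum has_bochner_integral_mult_right H If Iq)
    moreover have "(\<Sum>i\<in>I. c i * (\<psi> x * f i x)) - d * (\<psi> x * q x) = \<psi> x * g x" for x
      by (auto simp: g_def algebra_simps sum_distrib_left)
    ultimately show ?thesis by (simp add: has_bochner_integral_iff)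
  qed
  also have "\<bar>\<dots>\<bar> \<le> (\<integral>x. \<bar>\<psi> x * g x\<bar> \<partial>N)" by (rule integral_abs_bound)
  also have "\<dots> \<le> (\<integral>x. \<bar>g x\<bar> \<partial>N)"
    using \<psi> Ig bdd[OF integrable_abs[OF Ig]] by (intro integral_mono) (auto simp: abs_mult intro!: mult_left_le_one_le)
  also note gC
  finally show ?thesis by (simp add: C_def)
qed


section \<open>The regression model as a dominated family\<close>

type_synonym obs = "(nat \<Rightarrow> real) \<times> (nat \<times> nat \<Rightarrow> real)"

abbreviation gauss_prod :: "'i set \<Rightarrow> ('i \<Rightarrow> real) measure" where
  "gauss_prod I \<equiv> PiM I (\<lambda>_. std_gauss)"

abbreviation lborel_prod :: "'i set \<Rightarrow> ('i \<Rightarrow> real) measure" where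
  "lborel_prod I \<equiv> PiM I (\<lambda>_. lborel)"

definition design_mult :: "nat \<Rightarrow> (nat \<Rightarrow> real) \<Rightarrow> (nat \<times> nat \<Rightarrow> real) \<Rightarrow> nat \<Rightarrow> real" where
  "design_mult p \<theta> x i = (\<Sum>j<p. x (i, j) * \<theta> j)"

text \<open>The noise level is 1 here; \<open>obs_law_prob\<close> later reduces every \<sigma> to
  this case by rescaling \<open>Y\<close>.\<close>

definition mean_test :: "nat \<Rightarrow> nat \<Rightarrow> (nat \<Rightarrow> real) \<Rightarrow> (obs \<Rightarrow> real) \<Rightarrow> real" where
  "mean_test n p \<theta> \<psi> = (\<integral>(e, x). \<psi> (\<lambda>i\<in>{..<n}. design_mult p \<theta> x i + e i, x) \<partial>noise_law n p)"

text \<open>Only the response gets Lebesgue measure; the design keeps its Gaussian law. All models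
  share the design marginal, so the likelihood is just the conditional density of \<open>Y\<close>
  given \<open>X\<close>.\<close>

definition base_measure :: "nat \<Rightarrow> nat \<Rightarrow> obs measure" where
  "base_measure n p = (lborel_prod {..<n}) \<Otimes>\<^sub>M (gauss_prod ({..<n} \<times> {..<p}))"

definition lik :: "nat \<Rightarrow> nat \<Rightarrow> (nat \<Rightarrow> real) \<Rightarrow> obs \<Rightarrow> real" where
  "lik n p \<theta> = (\<lambda>(y, x). \<Prod>i<n. normal_density (design_mult p \<theta> x i) 1 (y i))"

lemma sets_std_gauss [measurable_cong, simp]: "sets std_gauss = sets borel"
  by (simp add: std_gauss_def)

lemma space_std_gauss [simp]: "space std_gauss = UNIV"
  by (simp add: std_gauss_def)

lemma prob_space_std_gauss: "prob_space std_gauss"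
  unfolding std_gauss_def by (rule prob_space_normal_density) simp

lemma psf_std_gauss: "product_sigma_finite (\<lambda>_. std_gauss)"
  by (intro product_sigma_finite.intro prob_space_imp_sigma_finite prob_space_std_gauss)

lemma psf_lborel: "product_sigma_finite (\<lambda>_. lborel)"
  by (intro product_sigma_finite.intro) (rule sigma_finite_lborel)

lemma prob_space_PiM_std_gauss: "prob_space (gauss_prod I)"
  by (intro prob_space_PiM prob_space_std_gauss)

lemma prob_space_noise_law: "prob_space (noise_law n p)"
  unfolding noise_law_def
  by (intro prob_space_pair prob_space_PiM_std_gauss)

lemma sets_PiM_std_gauss [measurable_cong]: "sets (gauss_prod I) = sets (PiM I (\<lambda>_. borel))"
  by (intro sets_PiM_cong) auto

lemma sets_PiM_lborel [measurable_cong]: "sets (lborel_prod I) = sets (PiM I (\<lambda>_. borel))"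
  by (intro sets_PiM_cong) auto

lemma sets_noise_law [measurable_cong]: "sets (noise_law n p) = sets (obs_space n p)"
  unfolding noise_law_def obs_space_def
  by (intro sets_pair_measure_cong sets_PiM_std_gauss)

lemma sets_base_measure [measurable_cong]: "sets (base_measure n p) = sets (obs_space n p)"
  unfolding base_measure_def obs_space_def
  by (intro sets_pair_measure_cong sets_PiM_std_gauss sets_PiM_lborel)

lemma distr_std_gauss_shift: "distr std_gauss borel (\<lambda>e. v + e) = density lborel (normal_density v 1)"
proof -
  interpret prob_space std_gauss by (rule prob_space_std_gauss)
  have "distributed std_gauss lborel (\<lambda>x. x) (normal_density 0 1)"
    unfolding distributed_def by (auto simp: std_gauss_def distr_id2)
  from normal_density_affine[OF this, of 1 v]
  have "distributed std_gauss lborel (\<lambda>x. v + x) (normal_density v 1)" by simp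
  then show ?thesis
    unfolding distributed_def
    by (metis distr_cong sets_lborel)
qed

lemma density_PiM_normal:
  fixes v :: "'i \<Rightarrow> real"
  assumes "finite I"
  shows "density (lborel_prod I) (\<lambda>y. ennreal (\<Prod>i\<in>I. normal_density (v i) 1 (y i)))
    = PiM I (\<lambda>i. density lborel (normal_density (v i) 1))"
proof (rule product_sigma_finite.PiM_eqI[OF _ assms])
  show "product_sigma_finite (\<lambda>i. density lborel (normal_density (v i) 1))"
    by (intro product_sigma_finite.intro prob_space_imp_sigma_finite prob_space_normal_density) simp
  show "sets (density (lborel_prod I) (\<lambda>y. ennreal (\<Prod>i\<in>I. normal_density (v i) 1 (y i))))
    = sets (PiM I (\<lambda>i. density lborel (normal_density (v i) 1)))"
    by (simp, intro sets_PiM_cong) auto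
  fix A assume "\<And>i. i \<in> I \<Longrightarrow> A i \<in> sets (density lborel (\<lambda>x. ennreal (normal_density (v i) 1 x)))"
  then have A: "\<And>i. i \<in> I \<Longrightarrow> A i \<in> sets borel" by auto
  then have [measurable]: "Pi\<^sub>E I A \<in> sets (lborel_prod I)"
    using assms by (intro sets_PiM_I_finite) auto
  have "emeasure (density (lborel_prod I) (\<lambda>y. ennreal (\<Prod>i\<in>I. normal_density (v i) 1 (y i)))) (Pi\<^sub>E I A)
    = (\<integral>\<^sup>+y. ennreal (\<Prod>i\<in>I. normal_density (v i) 1 (y i)) * indicator (Pi\<^sub>E I A) y \<partial>lborel_prod I)"
    by (subst emeasure_density) auto
  also have "\<dots> = (\<integral>\<^sup>+y. (\<Prod>i\<in>I. ennreal (normal_density (v i) 1 (y i)) * indicator (A i) (y i)) \<partial>lborel_prod I)"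
  proof (intro nn_integral_cong)
    fix y :: "'i \<Rightarrow> real" assume "y \<in> space (lborel_prod I)"
    then have "y \<in> extensional I" by (auto simp: space_PiM PiE_def)
    then have "indicator (Pi\<^sub>E I A) y = (\<Prod>i\<in>I. indicator (A i) (y i) :: ennreal)"
      using assms by (auto simp: indicator_def PiE_iff intro!: prod.neutral[symmetric])
    then show "ennreal (\<Prod>i\<in>I. normal_density (v i) 1 (y i)) * indicator (Pi\<^sub>E I A) y =
      (\<Prod>i\<in>I. ennreal (normal_density (v i) 1 (y i)) * indicator (A i) (y i))"
      by (simp add: prod.distrib prod_ennreal)
  qed
  also have "\<dots> = (\<Prod>i\<in>I. \<integral>\<^sup>+y. ennreal (normal_density (v i) 1 y) * indicator (A i) y \<partial>lborel)"
    using A assms by (intro product_sigma_finite.product_nn_integral_prod[OF psf_lborel]) auto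
  also have "\<dots> = (\<Prod>i\<in>I. emeasure (density lborel (normal_density (v i) 1)) (A i))"
    using A by (intro prod.cong) (auto simp: emeasure_density)
  finally show "emeasure (density (lborel_prod I) (\<lambda>y. ennreal (\<Prod>i\<in>I. normal_density (v i) 1 (y i)))) (Pi\<^sub>E I A)
    = (\<Prod>i\<in>I. emeasure (density lborel (\<lambda>x. ennreal (normal_density (v i) 1 x))) (A i))" .
qed

lemma distr_PiM_std_gauss_shift:
  assumes "finite I"
  shows "distr (gauss_prod I) (PiM I (\<lambda>_. borel)) (\<lambda>e. \<lambda>i\<in>I. v i + e i)
    = PiM I (\<lambda>i. density lborel (normal_density (v i) 1))"
proof (rule product_sigma_finite.PiM_eqI[OF _ assms])
  show "product_sigma_finite (\<lambda>i. density lborel (normal_density (v i) 1))"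
    by (intro product_sigma_finite.intro prob_space_imp_sigma_finite prob_space_normal_density) simp
  show "sets (distr (gauss_prod I) (PiM I (\<lambda>_. borel)) (\<lambda>e. \<lambda>i\<in>I. v i + e i))
    = sets (PiM I (\<lambda>i. density lborel (normal_density (v i) 1)))"
    by (simp, intro sets_PiM_cong) auto
  fix A assume "\<And>i. i \<in> I \<Longrightarrow> A i \<in> sets (density lborel (\<lambda>x. ennreal (normal_density (v i) 1 x)))"
  then have A: "\<And>i. i \<in> I \<Longrightarrow> A i \<in> sets borel" by auto
  then have PA: "Pi\<^sub>E I A \<in> sets (PiM I (\<lambda>_. borel))"
    using assms by (intro sets_PiM_I_finite) auto
  have "emeasure (distr (gauss_prod I) (PiM I (\<lambda>_. borel)) (\<lambda>e. \<lambda>i\<in>I. v i + e i)) (Pi\<^sub>E I A)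
    = emeasure (gauss_prod I) (Pi\<^sub>E I (\<lambda>i. (\<lambda>e. v i + e) -` A i))"
    using PA by (subst emeasure_distr)
      (auto intro!: arg_cong[where f="emeasure (gauss_prod I)"] simp: space_PiM PiE_iff)
  also have "\<dots> = (\<Prod>i\<in>I. emeasure std_gauss ((\<lambda>e. v i + e) -` A i))"
    using A assms
    by (intro product_sigma_finite.emeasure_PiM[OF psf_std_gauss])
      (auto intro: measurable_sets_borel[of _ borel])
  also have "\<dots> = (\<Prod>i\<in>I. emeasure (density lborel (normal_density (v i) 1)) (A i))"
    using A by (intro prod.cong) (auto simp: emeasure_distr distr_std_gauss_shift[symmetric])
  finally show "emeasure (distr (gauss_prod I) (PiM I (\<lambda>_. borel)) (\<lambda>e. \<lambda>i\<in>I. v i + e i)) (Pi\<^sub>E I A)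
    = (\<Prod>i\<in>I. emeasure (density lborel (\<lambda>x. ennreal (normal_density (v i) 1 x))) (A i))" .
qed

lemma nn_integral_shift_std_gauss:
  assumes "finite I" and [measurable]: "F \<in> borel_measurable (PiM I (\<lambda>_. borel))"
  shows "(\<integral>\<^sup>+e. F (\<lambda>i\<in>I. v i + e i) \<partial>gauss_prod I)
    = (\<integral>\<^sup>+y. F y * ennreal (\<Prod>i\<in>I. normal_density (v i) 1 (y i)) \<partial>lborel_prod I)"
proof -
  have "(\<integral>\<^sup>+e. F (\<lambda>i\<in>I. v i + e i) \<partial>gauss_prod I)
    = (\<integral>\<^sup>+y. F y \<partial>distr (gauss_prod I) (PiM I (\<lambda>_. borel)) (\<lambda>e. \<lambda>i\<in>I. v i + e i))"
    by (subst nn_integral_distr) auto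
  also have "\<dots> = (\<integral>\<^sup>+y. F y \<partial>density (lborel_prod I) (\<lambda>y. ennreal (\<Prod>i\<in>I. normal_density (v i) 1 (y i))))"
    by (simp add: distr_PiM_std_gauss_shift density_PiM_normal assms(1))
  also have "\<dots> = (\<integral>\<^sup>+y. F y * ennreal (\<Prod>i\<in>I. normal_density (v i) 1 (y i)) \<partial>lborel_prod I)"
    by (subst nn_integral_density) (auto simp: mult.commute)
  finally show ?thesis .
qed

lemma measurable_design_mult [measurable]:
  "i < n \<Longrightarrow> (\<lambda>x. design_mult p \<theta> x i) \<in> borel_measurable (PiM ({..<n} \<times> {..<p}) (\<lambda>_. borel))"
  unfolding design_mult_def by measurable

lemma measurable_normal_density2 [measurable (raw)]:
  assumes [measurable]: "f \<in> borel_measurable M" "g \<in> borel_measurable M"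
  shows "(\<lambda>x. normal_density (f x) s (g x)) \<in> borel_measurable M"
  unfolding normal_density_def by measurable

lemma measurable_lik [measurable]: "lik n p \<theta> \<in> borel_measurable (obs_space n p)"
  unfolding lik_def obs_space_def by measurable

lemma measurable_shift [measurable]:
  "(\<lambda>(e, x). (\<lambda>i\<in>{..<n}. design_mult p \<theta> x i + s * e i, x)) \<in> measurable (obs_space n p) (obs_space n p)"
  unfolding obs_space_def by measurable

lemma lik_nonneg: "0 \<le> lik n p \<theta> z"
  by (auto simp: lik_def split: prod.split intro!: prod_nonneg)

lemma lik_pos: "0 < lik n p \<theta> z"
  by (auto simp: lik_def normal_density_pos split: prod.split intro!: prod_pos)

text \<open>Conditioning on the design makes the mean of \<open>Y\<close> a constant vector, so that
  the change of variables is a plain Gaussian shift for each fixed \<open>x\<close>.\<close>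

lemma nn_integral_lik:
  assumes F: "F \<in> borel_measurable (obs_space n p)"
  shows "(\<integral>\<^sup>+(e, x). F (\<lambda>i\<in>{..<n}. design_mult p \<theta> x i + e i, x) \<partial>noise_law n p)
    = (\<integral>\<^sup>+z. F z * ennreal (lik n p \<theta> z) \<partial>base_measure n p)"
proof -
  note F[unfolded obs_space_def, measurable]
  note measurable_lik[unfolded obs_space_def, measurable]
  let ?X = "gauss_prod ({..<n} \<times> {..<p})"
  interpret X: prob_space ?X by (rule prob_space_PiM_std_gauss)
  interpret E: prob_space "gauss_prod {..<n}" by (rule prob_space_PiM_std_gauss)
  interpret L: sigma_finite_measure "lborel_prod {..<n}"
    by (rule product_sigma_finite.sigma_finite[OF psf_lborel]) simp
  interpret P1: pair_sigma_finite "gauss_prod {..<n}" ?X ..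
  interpret P2: pair_sigma_finite "lborel_prod {..<n}" ?X ..
  have "(\<integral>\<^sup>+(e, x). F (\<lambda>i\<in>{..<n}. design_mult p \<theta> x i + e i, x) \<partial>noise_law n p)
    = (\<integral>\<^sup>+x. \<integral>\<^sup>+e. F (\<lambda>i\<in>{..<n}. design_mult p \<theta> x i + e i, x) \<partial>gauss_prod {..<n} \<partial>?X)"
    unfolding noise_law_def by (subst P1.nn_integral_snd[symmetric]) (auto simp: split_def)
  also have "\<dots> = (\<integral>\<^sup>+x. \<integral>\<^sup>+y. F (y, x) * ennreal (lik n p \<theta> (y, x)) \<partial>lborel_prod {..<n} \<partial>?X)"
  proof (intro nn_integral_cong)
    fix x assume x: "x \<in> space ?X"
    have [measurable]: "(\<lambda>y. F (y, x)) \<in> borel_measurable (PiM {..<n} (\<lambda>_. borel))"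
      using x by (intro measurable_compose[OF measurable_Pair2' F[unfolded obs_space_def]])
        (simp add: space_PiM)
    show "(\<integral>\<^sup>+e. F (\<lambda>i\<in>{..<n}. design_mult p \<theta> x i + e i, x) \<partial>gauss_prod {..<n})
      = (\<integral>\<^sup>+y. F (y, x) * ennreal (lik n p \<theta> (y, x)) \<partial>lborel_prod {..<n})"
      unfolding lik_def prod.case
      by (rule nn_integral_shift_std_gauss) auto
  qed
  also have "\<dots> = (\<integral>\<^sup>+z. F z * ennreal (lik n p \<theta> z) \<partial>base_measure n p)"
    unfolding base_measure_def by (subst P2.nn_integral_snd[symmetric]) auto
  finally show ?thesis .
qed

lemma nn_integral_lik_1: "(\<integral>\<^sup>+z. ennreal (lik n p \<theta> z) \<partial>base_measure n p) = 1"
proof -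
  interpret prob_space "noise_law n p" by (rule prob_space_noise_law)
  show ?thesis using nn_integral_lik[of "\<lambda>_. 1" n p \<theta>] emeasure_space_1 by (simp add: split_def)
qed

lemma mean_test_lik:
  assumes [measurable]: "\<psi> \<in> borel_measurable (obs_space n p)" and "\<And>z. 0 \<le> \<psi> z"
  shows "mean_test n p \<theta> \<psi> = (\<integral>z. \<psi> z * lik n p \<theta> z \<partial>base_measure n p)"
proof -
  have "(\<lambda>z. \<psi> (case z of (e, x) \<Rightarrow> (\<lambda>i\<in>{..<n}. design_mult p \<theta> x i + 1 * e i, x))) \<in> borel_measurable (noise_law n p)"
    using measurable_compose[OF measurable_shift assms(1)]
    unfolding measurable_cong_sets[OF sets_noise_law refl] .
  then have "mean_test n p \<theta> \<psi> = enn2real (\<integral>\<^sup>+z. ennreal (\<psi> (case z of (e, x) \<Rightarrow> (\<lambda>i\<in>{..<n}. design_mult p \<theta> x i + 1 * e i, x))) \<partial>noise_law n p)"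
    unfolding mean_test_def by (subst integral_eq_nn_integral) (auto simp: split_def assms)
  also have "\<dots> = enn2real (\<integral>\<^sup>+z. ennreal (\<psi> z) * ennreal (lik n p \<theta> z) \<partial>base_measure n p)"
    using nn_integral_lik[of "\<lambda>z. ennreal (\<psi> z)" n p \<theta>] by (simp add: split_def)
  also have "\<dots> = (\<integral>z. \<psi> z * lik n p \<theta> z \<partial>base_measure n p)"
    by (subst integral_eq_nn_integral) (auto simp: assms lik_nonneg ennreal_mult')
  finally show ?thesis .
qed

section \<open>Gaussian integrals\<close>

abbreviation gauss :: "real \<Rightarrow> real \<Rightarrow> real" where
  "gauss \<equiv> normal_density 0"

lemma nn_integral_normal_density:
  "s > 0 \<Longrightarrow> (\<integral>\<^sup>+y. ennreal (normal_density m s y) \<partial>lborel) = 1"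
  by (subst nn_integral_eq_integral) auto

lemma nn_integral_std_gauss:
  "f \<in> borel_measurable borel \<Longrightarrow> (\<integral>\<^sup>+y. f y \<partial>std_gauss) = (\<integral>\<^sup>+y. ennreal (std_normal_density y) * f y \<partial>lborel)"
  unfolding std_gauss_def by (subst nn_integral_density) auto

lemma normal_density_shift: "normal_density m s y = gauss s (y - m)"
  by (simp add: normal_density_def)

text \<open>Variances of independent centred Gaussians add. The substitution z = \<alpha> y behind
  it degenerates at \<alpha> = 0, hence the case split.\<close>

lemma normal_conv_std:
  assumes v: "v > 0"
  shows "(\<integral>\<^sup>+y. ennreal (gauss v (c - y * \<alpha>)) \<partial>std_gauss) = ennreal (gauss (sqrt (v\<^sup>2 + \<alpha>\<^sup>2)) c)"
proof (cases "\<alpha> = 0")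
  case True
  interpret prob_space std_gauss by (rule prob_space_std_gauss)
  show ?thesis using True v emeasure_space_1 by simp
next
  case False
  have "ennreal (gauss (sqrt (v\<^sup>2 + \<alpha>\<^sup>2)) c) = ennreal (gauss (sqrt (v\<^sup>2 + \<bar>\<alpha>\<bar>\<^sup>2)) c)" by simp
  also have "\<dots> = (\<integral>\<^sup>+y. ennreal (gauss v (c - y) * gauss \<bar>\<alpha>\<bar> y) \<partial>lborel)"
    using fun_cong[OF conv_normal_density_zero_mean[of v "\<bar>\<alpha>\<bar>"], of c] v False by simp
  also have "\<dots> = ennreal \<bar>\<alpha>\<bar> * (\<integral>\<^sup>+y. ennreal (gauss v (c - (0 + \<alpha> * y)) * gauss \<bar>\<alpha>\<bar> (0 + \<alpha> * y)) \<partial>lborel)"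
    using False by (intro nn_integral_real_affine) auto
  also have "\<dots> = (\<integral>\<^sup>+y. ennreal \<bar>\<alpha>\<bar> * ennreal (gauss v (c - (0 + \<alpha> * y)) * gauss \<bar>\<alpha>\<bar> (0 + \<alpha> * y)) \<partial>lborel)"
    by (subst nn_integral_cmult) auto
  also have "\<dots> = (\<integral>\<^sup>+y. ennreal (std_normal_density y) * ennreal (gauss v (c - y * \<alpha>)) \<partial>lborel)"
  proof (intro nn_integral_cong)
    fix y :: real
    have "\<bar>\<alpha>\<bar> * gauss \<bar>\<alpha>\<bar> (\<alpha> * y) = std_normal_density y"
      using False by (simp add: normal_density_def real_sqrt_mult power_mult_distrib)
    then show "ennreal \<bar>\<alpha>\<bar> * ennreal (gauss v (c - (0 + \<alpha> * y)) * gauss \<bar>\<alpha>\<bar> (0 + \<alpha> * y))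
      = ennreal (std_normal_density y) * ennreal (gauss v (c - y * \<alpha>))"
      by (simp add: ennreal_mult'[symmetric] mult_ac)
  qed
  also have "\<dots> = (\<integral>\<^sup>+y. ennreal (gauss v (c - y * \<alpha>)) \<partial>std_gauss)"
    by (subst nn_integral_std_gauss) auto
  finally show ?thesis by simp
qed

text \<open>No Gaussian coordinate enters both residuals, so they are independent and each
  coordinate adds to the variance of one factor only. The induction integrates out one coordinate at
  a time, which is why \<open>v\<close> and \<open>w\<close> are general.\<close>

lemma normal_conv_PiM2:
  assumes "finite J" "v > 0" "w > 0" "\<And>j. j \<in> J \<Longrightarrow> \<alpha> j = 0 \<or> \<beta> j = 0"
  shows "(\<integral>\<^sup>+x. ennreal (gauss v (c - (\<Sum>j\<in>J. x j * \<alpha> j)) * gauss w (d - (\<Sum>j\<in>J. x j * \<beta> j)))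
      \<partial>gauss_prod J)
    = ennreal (gauss (sqrt (v\<^sup>2 + (\<Sum>j\<in>J. (\<alpha> j)\<^sup>2))) c * gauss (sqrt (w\<^sup>2 + (\<Sum>j\<in>J. (\<beta> j)\<^sup>2))) d)"
  using assms
proof (induction J arbitrary: v w rule: finite_induct)
  case empty
  then show ?case
    by (simp add: prob_space.emeasure_space_1[OF prob_space_PiM_std_gauss])
next
  case (insert i J)
  let ?I = "\<lambda>v w J x. ennreal (gauss v (c - (\<Sum>j\<in>J. x j * \<alpha> j)) * gauss w (d - (\<Sum>j\<in>J. x j * \<beta> j)))"
  interpret S: prob_space std_gauss by (rule prob_space_std_gauss)
  let ?v = "sqrt (v\<^sup>2 + (\<alpha> i)\<^sup>2)" and ?w = "sqrt (w\<^sup>2 + (\<beta> i)\<^sup>2)"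
  have pos: "?v > 0" "?w > 0" using insert.prems by (auto intro!: add_pos_nonneg)
  have [simp]: "(\<Sum>j\<in>J. (if j = i then y else x j) * g j) = (\<Sum>j\<in>J. x j * g j)" for x y and g :: "_ \<Rightarrow> real"
    using insert.hyps by (intro sum.cong) auto
  have "(\<integral>\<^sup>+x. ?I v w (insert i J) x
      \<partial>gauss_prod (insert i J))
    = (\<integral>\<^sup>+x. \<integral>\<^sup>+y. ?I v w (insert i J) (x(i:=y))
      \<partial>std_gauss \<partial>gauss_prod J)"
    using insert.hyps by (intro product_sigma_finite.product_nn_integral_insert[OF psf_std_gauss]) auto
  also have "\<dots> = (\<integral>\<^sup>+x. ?I ?v ?w J x
      \<partial>gauss_prod J)"
  proof (intro nn_integral_cong)
    fix x :: "'a \<Rightarrow> real"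
    define A where "A = c - (\<Sum>j\<in>J. x j * \<alpha> j)"
    define B where "B = d - (\<Sum>j\<in>J. x j * \<beta> j)"
    have eq: "c - (\<Sum>j\<in>insert i J. (x(i:=y)) j * \<alpha> j) = A - y * \<alpha> i"
      "d - (\<Sum>j\<in>insert i J. (x(i:=y)) j * \<beta> j) = B - y * \<beta> i" for y
      using insert.hyps by (auto simp: A_def B_def)
    have "(\<integral>\<^sup>+y. ennreal (gauss v (A - y * \<alpha> i) * gauss w (B - y * \<beta> i)) \<partial>std_gauss)
      = ennreal (gauss ?v A * gauss ?w B)"
    proof (cases "\<alpha> i = 0")
      case True
      then show ?thesis using insert.prems normal_conv_std[of w B "\<beta> i"]
        by (simp add: ennreal_mult' nn_integral_cmult)
    next
      case False
      then have "\<beta> i = 0" using insert.prems by auto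
      then show ?thesis using insert.prems normal_conv_std[of v A "\<alpha> i"]
        by (simp add: ennreal_mult'' nn_integral_multc)
    qed
    then show "(\<integral>\<^sup>+y. ?I v w (insert i J) (x(i:=y)) \<partial>std_gauss)
      = ?I ?v ?w J x"
      unfolding eq by (simp add: A_def B_def)
  qed
  also have "\<dots> = ennreal (gauss (sqrt (?v\<^sup>2 + (\<Sum>j\<in>J. (\<alpha> j)\<^sup>2))) c * gauss (sqrt (?w\<^sup>2 + (\<Sum>j\<in>J. (\<beta> j)\<^sup>2))) d)"
    using insert.prems pos by (intro insert.IH) auto
  finally show ?case
    using insert.hyps by (simp add: add.assoc)
qed

lemma normal_conv_PiM:
  assumes "finite J" "v > 0"
  shows "(\<integral>\<^sup>+x. ennreal (gauss v (c - (\<Sum>j\<in>J. x j * \<alpha> j))) \<partial>gauss_prod J)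
    = ennreal (gauss (sqrt (v\<^sup>2 + (\<Sum>j\<in>J. (\<alpha> j)\<^sup>2))) c)"
proof -
  \<comment> \<open>With \<beta> = 0 the second factor is this positive constant, which can be
    cancelled.\<close>
  define k where "k = gauss 1 0"
  have k: "k > 0" unfolding k_def by (rule normal_density_pos) simp
  have "(\<integral>\<^sup>+x. ennreal (gauss v (c - (\<Sum>j\<in>J. x j * \<alpha> j))) \<partial>gauss_prod J) * ennreal k
    = ennreal (gauss (sqrt (v\<^sup>2 + (\<Sum>j\<in>J. (\<alpha> j)\<^sup>2))) c) * ennreal k"
    using normal_conv_PiM2[OF assms, of 1 \<alpha> "\<lambda>_. 0" c 0] assms(1)
    by (subst nn_integral_multc[symmetric]) (auto simp: k_def ennreal_mult'')
  then show ?thesis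
    using k by (simp add: mult.commute[of _ "ennreal k"] ennreal_mult_cancel_left)
qed

lemma normal_density_sq:
  "\<tau> > 0 \<Longrightarrow> gauss \<tau> z * gauss \<tau> z = gauss (\<tau> / sqrt 2) z / (2 * \<tau> * sqrt pi)"
  by (simp add: normal_density_def real_sqrt_mult real_sqrt_divide power_divide mult_exp_exp field_simps)

text \<open>The quotient has a Gaussian shape of precision 1/w^2 - 1/s^2, positive because w < s;
  \<open>v\<close> is the corresponding standard deviation.\<close>

lemma normal_density_ratio:
  assumes "0 < w" "w < s"
  shows "(\<integral>\<^sup>+y. ennreal (gauss w y / gauss s y) \<partial>lborel)
    = ennreal (sqrt (2 * pi) * s\<^sup>2 / sqrt (s\<^sup>2 - w\<^sup>2))"
proof -
  define v where "v = w * s / sqrt (s\<^sup>2 - w\<^sup>2)"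
  have sw: "s\<^sup>2 - w\<^sup>2 > 0" using assms by (simp add: power_strict_mono)
  have v: "v > 0" using assms sw by (simp add: v_def)
  have v2: "1 / v\<^sup>2 = 1 / w\<^sup>2 - 1 / s\<^sup>2"
    using assms sw by (simp add: v_def power_mult_distrib power_divide field_simps)
  have "gauss w y / gauss s y = sqrt (2 * pi) * s\<^sup>2 / sqrt (s\<^sup>2 - w\<^sup>2) * gauss v y" for y
  proof -
    have e: "- y\<^sup>2 / (2 * w\<^sup>2) - (- y\<^sup>2 / (2 * s\<^sup>2)) = - y\<^sup>2 / (2 * v\<^sup>2)"
      using arg_cong[OF v2, of "\<lambda>z. - y\<^sup>2 / 2 * z"] by (simp add: algebra_simps)
    have "gauss w y / gauss s y = s / w * exp (- y\<^sup>2 / (2 * w\<^sup>2) - (- y\<^sup>2 / (2 * s\<^sup>2)))"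
      unfolding exp_diff using assms by (simp add: normal_density_def real_sqrt_mult)
    also have "s / w = sqrt (2 * pi) * s\<^sup>2 / sqrt (s\<^sup>2 - w\<^sup>2) * (1 / sqrt (2 * pi * v\<^sup>2))"
    proof -
      have "sqrt (2 * pi * v\<^sup>2) = sqrt (2 * pi) * v" using v by (simp add: real_sqrt_mult)
      then show ?thesis using assms sw by (simp add: v_def power2_eq_square)
    qed
    finally show ?thesis unfolding e by (simp add: normal_density_def)
  qed
  then have "(\<integral>\<^sup>+y. ennreal (gauss w y / gauss s y) \<partial>lborel)
    = (\<integral>\<^sup>+y. ennreal (sqrt (2 * pi) * s\<^sup>2 / sqrt (s\<^sup>2 - w\<^sup>2)) * ennreal (gauss v y) \<partial>lborel)"
    using sw by (intro nn_integral_cong) (simp add: ennreal_mult'[symmetric])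
  also have "\<dots> = ennreal (sqrt (2 * pi) * s\<^sup>2 / sqrt (s\<^sup>2 - w\<^sup>2))"
    using v by (subst nn_integral_cmult) (auto simp: nn_integral_normal_density)
  finally show ?thesis .
qed

text \<open>The kernel of two vectors for one row of the design. Given the coordinates in
  \<open>C\<close>, where the vectors agree, the two residuals use disjoint coordinates of
  \<open>D\<close> and are independent with common variance 1 + r2 - c. Their densities at the same
  point multiply to a Gaussian shape of half that variance, and integrating out \<open>C\<close>
  adds c.\<close>

lemma row_kernel:
  fixes \<alpha> \<beta> :: "'j \<Rightarrow> real"
  assumes fin: "finite J" and ov: "\<And>j. j \<in> J \<Longrightarrow> \<alpha> j = 0 \<or> \<beta> j = 0 \<or> \<alpha> j = \<beta> j"
    and r: "(\<Sum>j\<in>J. (\<alpha> j)\<^sup>2) = r2" "(\<Sum>j\<in>J. (\<beta> j)\<^sup>2) = r2" and c: "(\<Sum>j\<in>J. \<alpha> j * \<beta> j) = c"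
  shows "(\<integral>\<^sup>+x. ennreal (gauss 1 (y - (\<Sum>j\<in>J. x j * \<alpha> j)) * gauss 1 (y - (\<Sum>j\<in>J. x j * \<beta> j)))
      \<partial>gauss_prod J)
    = ennreal (gauss (sqrt ((1 + r2 - c) / 2 + c)) y / (2 * sqrt (1 + r2 - c) * sqrt pi))"
    and "c \<le> r2" "0 \<le> c"
proof -
  let ?I = "\<lambda>x. ennreal (gauss 1 (y - (\<Sum>j\<in>J. x j * \<alpha> j)) * gauss 1 (y - (\<Sum>j\<in>J. x j * \<beta> j)))"
  define C where "C = {j \<in> J. \<alpha> j = \<beta> j}"
  define D where "D = {j \<in> J. \<alpha> j \<noteq> \<beta> j}"
  have CD: "C \<inter> D = {}" "finite C" "finite D" "J = C \<union> D"
    using fin by (auto simp: C_def D_def)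
  have ovD: "\<alpha> j = 0 \<or> \<beta> j = 0" if "j \<in> D" for j using that ov by (auto simp: D_def)
  have eqC: "\<beta> j = \<alpha> j" if "j \<in> C" for j using that by (auto simp: C_def)
  have "(\<Sum>j\<in>J. \<alpha> j * \<beta> j) = (\<Sum>j\<in>C. \<alpha> j * \<beta> j) + (\<Sum>j\<in>D. \<alpha> j * \<beta> j)"
    unfolding CD(4) using CD by (intro sum.union_disjoint) auto
  moreover have "(\<Sum>j\<in>D. \<alpha> j * \<beta> j) = 0" using ovD by (intro sum.neutral) auto
  ultimately have cC: "(\<Sum>j\<in>C. (\<alpha> j)\<^sup>2) = c"
    using c eqC by (simp add: power2_eq_square)
  then show c0: "0 \<le> c" by (metis sum_nonneg zero_le_power2)
  have "(\<Sum>j\<in>J. (\<alpha> j)\<^sup>2) = (\<Sum>j\<in>C. (\<alpha> j)\<^sup>2) + (\<Sum>j\<in>D. (\<alpha> j)\<^sup>2)"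
    "(\<Sum>j\<in>J. (\<beta> j)\<^sup>2) = (\<Sum>j\<in>C. (\<beta> j)\<^sup>2) + (\<Sum>j\<in>D. (\<beta> j)\<^sup>2)"
    unfolding CD(4) using CD by (auto intro: sum.union_disjoint)
  then have D2: "(\<Sum>j\<in>D. (\<alpha> j)\<^sup>2) = r2 - c" "(\<Sum>j\<in>D. (\<beta> j)\<^sup>2) = r2 - c"
    using r cC eqC by auto
  then show cr: "c \<le> r2" by (metis diff_ge_0_iff_ge sum_nonneg zero_le_power2)
  define \<tau> where "\<tau> = sqrt (1 + r2 - c)"
  have \<tau>: "\<tau> > 0" "\<tau>\<^sup>2 = 1 + r2 - c" using cr by (auto simp: \<tau>_def)
  have "(\<integral>\<^sup>+x. ?I x
      \<partial>gauss_prod J)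
    = (\<integral>\<^sup>+x. \<integral>\<^sup>+z. ?I (merge C D (x, z))
      \<partial>gauss_prod D \<partial>gauss_prod C)"
    unfolding CD(4) using CD by (intro product_sigma_finite.product_nn_integral_fold[OF psf_std_gauss]) auto
  also have "\<dots> = (\<integral>\<^sup>+x. ennreal (gauss (\<tau> / sqrt 2) (y - (\<Sum>j\<in>C. x j * \<alpha> j)) / (2 * \<tau> * sqrt pi)) \<partial>gauss_prod C)"
  proof (intro nn_integral_cong)
    fix x :: "'j \<Rightarrow> real"
    define A where "A = y - (\<Sum>j\<in>C. x j * \<alpha> j)"
    have split: "(\<Sum>j\<in>J. merge C D (x, z) j * g j) = (\<Sum>j\<in>C. x j * g j) + (\<Sum>j\<in>D. z j * g j)" for z and g :: "'j \<Rightarrow> real"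
      unfolding CD(4) using CD by (subst sum.union_disjoint) (auto intro!: sum.cong arg_cong2[where f="(+)"])
    have eq: "y - (\<Sum>j\<in>J. merge C D (x, z) j * \<alpha> j) = A - (\<Sum>j\<in>D. z j * \<alpha> j)"
      "y - (\<Sum>j\<in>J. merge C D (x, z) j * \<beta> j) = A - (\<Sum>j\<in>D. z j * \<beta> j)" for z
      unfolding split A_def using eqC by auto
    have "(\<integral>\<^sup>+z. ennreal (gauss 1 (A - (\<Sum>j\<in>D. z j * \<alpha> j)) * gauss 1 (A - (\<Sum>j\<in>D. z j * \<beta> j)))
      \<partial>gauss_prod D) = ennreal (gauss \<tau> A * gauss \<tau> A)"
      using normal_conv_PiM2[OF CD(3), of 1 1 \<alpha> \<beta> A A] ovD by (simp add: D2 \<tau>_def algebra_simps)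
    then show "(\<integral>\<^sup>+z. ?I (merge C D (x, z))
      \<partial>gauss_prod D) = ennreal (gauss (\<tau> / sqrt 2) (y - (\<Sum>j\<in>C. x j * \<alpha> j)) / (2 * \<tau> * sqrt pi))"
      unfolding eq using \<tau> by (simp add: normal_density_sq A_def)
  qed
  also have "\<dots> = (\<integral>\<^sup>+x. ennreal (gauss (\<tau> / sqrt 2) (y - (\<Sum>j\<in>C. x j * \<alpha> j))) / ennreal (2 * \<tau> * sqrt pi) \<partial>gauss_prod C)"
    using \<tau> by (simp add: divide_ennreal)
  also have "\<dots> = ennreal (gauss (sqrt ((\<tau> / sqrt 2)\<^sup>2 + c)) y) / ennreal (2 * \<tau> * sqrt pi)"
    using \<tau> CD by (subst nn_integral_divide) (auto simp: normal_conv_PiM cC)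
  also have "\<dots> = ennreal (gauss (sqrt ((\<tau> / sqrt 2)\<^sup>2 + c)) y / (2 * \<tau> * sqrt pi))"
    using \<tau> by (simp add: divide_ennreal)
  finally show "(\<integral>\<^sup>+x. ?I x
      \<partial>gauss_prod J)
    = ennreal (gauss (sqrt ((1 + r2 - c) / 2 + c)) y / (2 * sqrt (1 + r2 - c) * sqrt pi))"
    using \<tau> by (simp add: power_divide \<tau>_def)
qed

text \<open>Independence of the rows of the design, which reduces every kernel to a single
  row.\<close>

lemma nn_integral_PiM_rows:
  fixes g :: "'i \<Rightarrow> ('j \<Rightarrow> real) \<Rightarrow> ennreal"
  assumes I: "finite I" and J: "finite J" and g: "\<And>i. i \<in> I \<Longrightarrow> g i \<in> borel_measurable (PiM J (\<lambda>_. borel))"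
  shows "(\<integral>\<^sup>+x. (\<Prod>i\<in>I. g i (\<lambda>j\<in>J. x (i, j))) \<partial>gauss_prod (I \<times> J))
    = (\<Prod>i\<in>I. \<integral>\<^sup>+x. g i x \<partial>gauss_prod J)"
  using I g
proof (induction I rule: finite_induct)
  case empty
  interpret prob_space "PiM {} (\<lambda>_::'i \<times> 'j. std_gauss)" by (rule prob_space_PiM_std_gauss)
  show ?case using emeasure_space_1 by simp
next
  case (insert i I)
  note insert.prems[measurable]
  have m[measurable]: "(\<lambda>x. g k (\<lambda>j\<in>J. x (k, j))) \<in> borel_measurable (PiM K (\<lambda>_. borel))"
    if "{k} \<times> J \<subseteq> K" "k \<in> insert i I" for k K
    by (rule measurable_compose[OF _ insert.prems[OF that(2)]], intro measurable_restrict measurable_component_singleton)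
      (use that in auto)
  have dis: "({i} \<times> J) \<inter> (I \<times> J) = {}" using insert.hyps by auto
  have un: "insert i I \<times> J = ({i} \<times> J) \<union> (I \<times> J)" by auto
  let ?P = "\<lambda>K. gauss_prod K"
  have "(\<integral>\<^sup>+x. (\<Prod>k\<in>insert i I. g k (\<lambda>j\<in>J. x (k, j))) \<partial>?P (insert i I \<times> J))
    = (\<integral>\<^sup>+x. \<integral>\<^sup>+y. (\<Prod>k\<in>insert i I. g k (\<lambda>j\<in>J. merge ({i} \<times> J) (I \<times> J) (x, y) (k, j))) \<partial>?P (I \<times> J) \<partial>?P ({i} \<times> J))"
    unfolding un using insert.hyps J dis
    by (intro product_sigma_finite.product_nn_integral_fold[OF psf_std_gauss]) auto
  also have "\<dots> = (\<integral>\<^sup>+x. \<integral>\<^sup>+y. g i (\<lambda>j\<in>J. x (i, j)) * (\<Prod>k\<in>I. g k (\<lambda>j\<in>J. y (k, j))) \<partial>?P (I \<times> J) \<partial>?P ({i} \<times> J))"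
  proof (intro nn_integral_cong)
    fix x y :: "'i \<times> 'j \<Rightarrow> real"
    have "(\<lambda>j\<in>J. merge ({i} \<times> J) (I \<times> J) (x, y) (i, j)) = (\<lambda>j\<in>J. x (i, j))"
      by (auto simp: merge_def fun_eq_iff)
    moreover have "(\<lambda>j\<in>J. merge ({i} \<times> J) (I \<times> J) (x, y) (k, j)) = (\<lambda>j\<in>J. y (k, j))" if "k \<in> I" for k
      using that insert.hyps by (auto simp: merge_def fun_eq_iff)
    ultimately show "(\<Prod>k\<in>insert i I. g k (\<lambda>j\<in>J. merge ({i} \<times> J) (I \<times> J) (x, y) (k, j)))
      = g i (\<lambda>j\<in>J. x (i, j)) * (\<Prod>k\<in>I. g k (\<lambda>j\<in>J. y (k, j)))"
      using insert.hyps by (simp cong: prod.cong)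
  qed
  also have "\<dots> = (\<integral>\<^sup>+x. g i (\<lambda>j\<in>J. x (i, j)) \<partial>?P ({i} \<times> J)) * (\<integral>\<^sup>+y. (\<Prod>k\<in>I. g k (\<lambda>j\<in>J. y (k, j))) \<partial>?P (I \<times> J))"
  proof -
    have m1: "(\<lambda>x. g i (\<lambda>j\<in>J. x (i, j))) \<in> borel_measurable (?P ({i} \<times> J))"
      unfolding measurable_cong_sets[OF sets_PiM_std_gauss refl] by (rule m) auto
    have m2: "(\<lambda>y. \<Prod>k\<in>I. g k (\<lambda>j\<in>J. y (k, j))) \<in> borel_measurable (?P (I \<times> J))"
      unfolding measurable_cong_sets[OF sets_PiM_std_gauss refl]
      by (intro borel_measurable_prod_ennreal m) auto
    show ?thesis by (simp only: nn_integral_cmult[OF m2] nn_integral_multc[OF m1])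
  qed
  also have "(\<integral>\<^sup>+y. (\<Prod>k\<in>I. g k (\<lambda>j\<in>J. y (k, j))) \<partial>?P (I \<times> J)) = (\<Prod>i\<in>I. \<integral>\<^sup>+x. g i x \<partial>?P J)"
    by (intro insert.IH insert.prems) auto
  also have "(\<integral>\<^sup>+x. g i (\<lambda>j\<in>J. x (i, j)) \<partial>?P ({i} \<times> J)) = (\<integral>\<^sup>+x. g i x \<partial>?P J)"
  proof -
    have "?P J = distr (?P ({i} \<times> J)) (?P J) (\<lambda>\<omega>. \<lambda>n\<in>J. \<omega> (i, n))"
      by (rule distr_PiM_reindex[symmetric, of "{i} \<times> J" "\<lambda>_. std_gauss" "Pair i" J])
         (auto simp: prob_space_std_gauss inj_on_def)
    then have "(\<integral>\<^sup>+x. g i x \<partial>?P J) = (\<integral>\<^sup>+x. g i x \<partial>distr (?P ({i} \<times> J)) (?P J) (\<lambda>\<omega>. \<lambda>n\<in>J. \<omega> (i, n)))" by simp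
    also have "\<dots> = (\<integral>\<^sup>+x. g i (\<lambda>j\<in>J. x (i, j)) \<partial>?P ({i} \<times> J))"
      by (subst nn_integral_distr) (auto intro!: measurable_restrict measurable_component_singleton simp del: restrict_apply)
    finally show ?thesis by simp
  qed
  finally show ?case using insert.hyps by simp
qed

section \<open>Chi-square kernels against pure noise\<close>

definition ref_density :: "nat \<Rightarrow> real \<Rightarrow> obs \<Rightarrow> real" where
  "ref_density n s = (\<lambda>(y, x). \<Prod>i<n. gauss s (y i))"

lemma measurable_ref_density [measurable]: "ref_density n s \<in> borel_measurable (obs_space n p)"
  unfolding ref_density_def obs_space_def by measurable

lemma ref_density_pos: "s > 0 \<Longrightarrow> 0 < ref_density n s \<omega>"
  by (auto simp: ref_density_def normal_density_pos split: prod.split intro!: prod_pos)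

lemma nn_integral_base_measure:
  assumes "f \<in> borel_measurable (obs_space n p)"
  shows "(\<integral>\<^sup>+\<omega>. f \<omega> \<partial>base_measure n p)
    = (\<integral>\<^sup>+y. \<integral>\<^sup>+x. f (y, x) \<partial>gauss_prod ({..<n} \<times> {..<p}) \<partial>lborel_prod {..<n})"
proof -
  interpret X: prob_space "gauss_prod ({..<n} \<times> {..<p})" by (rule prob_space_PiM_std_gauss)
  show ?thesis
    unfolding base_measure_def
    by (rule X.nn_integral_fst[symmetric])
      (use assms in \<open>simp add: base_measure_def[symmetric] measurable_cong_sets[OF sets_base_measure refl]\<close>)
qed

lemma nn_integral_ref_density:
  assumes "s > 0"
  shows "(\<integral>\<^sup>+\<omega>. ennreal (ref_density n s \<omega>) \<partial>base_measure n p) = 1"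
proof -
  interpret X: prob_space "gauss_prod ({..<n} \<times> {..<p})" by (rule prob_space_PiM_std_gauss)
  have m: "(\<lambda>\<omega>. ennreal (ref_density n s \<omega>)) \<in> borel_measurable (obs_space n p)" by measurable
  have "(\<integral>\<^sup>+\<omega>. ennreal (ref_density n s \<omega>) \<partial>base_measure n p)
    = (\<integral>\<^sup>+y. (\<Prod>i<n. ennreal (gauss s (y i))) \<partial>lborel_prod {..<n})"
    using X.emeasure_space_1
    unfolding nn_integral_base_measure[OF m] by (auto simp: ref_density_def prod_ennreal)
  also have "\<dots> = 1"
    using assms by (subst product_sigma_finite.product_nn_integral_prod[OF psf_lborel])
      (auto simp: nn_integral_normal_density)
  finally show ?thesis .
qed

text \<open>Integrating over the design first leaves a product of one-dimensional ratios of the same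
  form. The hypothesis \<open>less\<close> says that \<open>w\<close>, the deviation left by
  \<open>row_kernel\<close>, is below \<open>s\<close>. For s^2 = 1 + r2 the two roots coincide and
  the base of the power is s^2/(s^2 - c); for r2 = c = 0 it is the kernel of the zero
  vector.\<close>

lemma lik_kernel_ref:
  assumes s: "s > 0" and ov: "\<And>j. j < p \<Longrightarrow> \<theta> j = 0 \<or> \<theta>' j = 0 \<or> \<theta> j = \<theta>' j"
    and r: "(\<Sum>j<p. (\<theta> j)\<^sup>2) = r2" "(\<Sum>j<p. (\<theta>' j)\<^sup>2) = r2" and c: "(\<Sum>j<p. \<theta> j * \<theta>' j) = c"
    and less: "1 + r2 + c < 2 * s\<^sup>2"
  shows "(\<integral>\<^sup>+\<omega>. ennreal (lik n p \<theta> \<omega> * lik n p \<theta>' \<omega> / ref_density n s \<omega>) \<partial>base_measure n p)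
    = ennreal ((s\<^sup>2 / (sqrt (1 + r2 - c) * sqrt (2 * s\<^sup>2 - 1 - r2 - c))) ^ n)"
proof -
  define \<tau> where "\<tau> = sqrt (1 + r2 - c)"
  define w where "w = sqrt ((1 + r2 - c) / 2 + c)"
  note row = row_kernel[of "{..<p}" \<theta> \<theta>' r2 c, OF _ _ r c, folded \<tau>_def w_def]
  have row1: "(\<integral>\<^sup>+x. ennreal (gauss 1 (y - (\<Sum>j<p. x j * \<theta> j)) * gauss 1 (y - (\<Sum>j<p. x j * \<theta>' j)))
      \<partial>gauss_prod {..<p}) = ennreal (gauss w y / (2 * \<tau> * sqrt pi))" for y
    using ov by (intro row) auto
  have cr: "c \<le> r2" "0 \<le> c" using row(2,3) ov by auto
  have \<tau>: "\<tau> > 0" using cr by (simp add: \<tau>_def)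
  have w: "w > 0" using cr by (simp add: w_def add_pos_nonneg)
  have "(1 + r2 - c) / 2 + c < s\<^sup>2" using less by (simp add: field_simps)
  then have ws: "w < s" unfolding w_def using s by (intro real_less_lsqrt) auto
  have w2: "w\<^sup>2 = (1 + r2 - c) / 2 + c" using cr by (simp add: w_def)
  let ?F = "\<lambda>y x. ennreal (lik n p \<theta> (y, x) * lik n p \<theta>' (y, x) / ref_density n s (y, x))"
  let ?G = "\<lambda>z. ennreal (gauss w z / (2 * \<tau> * sqrt pi) / gauss s z)"
  let ?X = "gauss_prod ({..<n} \<times> {..<p})"
  have "(\<integral>\<^sup>+\<omega>. ennreal (lik n p \<theta> \<omega> * lik n p \<theta>' \<omega> / ref_density n s \<omega>) \<partial>base_measure n p)
    = (\<integral>\<^sup>+y. \<integral>\<^sup>+x. ?F y x \<partial>?X \<partial>lborel_prod {..<n})"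
    by (rule nn_integral_base_measure) measurable
  also have "\<dots> = (\<integral>\<^sup>+y. (\<Prod>i<n. ?G (y i)) \<partial>lborel_prod {..<n})"
  proof (intro nn_integral_cong)
    fix y :: "nat \<Rightarrow> real"
    define g where "g i x = ennreal (gauss 1 (y i - (\<Sum>j<p. x j * \<theta> j)) * gauss 1 (y i - (\<Sum>j<p. x j * \<theta>' j)))"
      for i and x :: "nat \<Rightarrow> real"
    have q: "0 < (\<Prod>i<n. gauss s (y i))" using s by (intro prod_pos) (auto simp: normal_density_pos)
    have "(\<integral>\<^sup>+x. ?F y x \<partial>?X)
      = (\<integral>\<^sup>+x. (\<Prod>i<n. g i (\<lambda>j\<in>{..<p}. x (i, j))) / ennreal (\<Prod>i<n. gauss s (y i)) \<partial>?X)"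
    proof (intro nn_integral_cong)
      fix x :: "nat \<times> nat \<Rightarrow> real"
      have "lik n p \<theta> (y, x) * lik n p \<theta>' (y, x) = (\<Prod>i<n. gauss 1 (y i - (\<Sum>j<p. x (i, j) * \<theta> j)) * gauss 1 (y i - (\<Sum>j<p. x (i, j) * \<theta>' j)))"
        by (simp add: lik_def design_mult_def prod.distrib normal_density_shift[of "\<Sum>j<p. _ j"])
      moreover have "(\<Prod>i<n. g i (\<lambda>j\<in>{..<p}. x (i, j))) = ennreal \<dots>"
        by (simp add: g_def prod_ennreal)
      ultimately show "?F y x
        = (\<Prod>i<n. g i (\<lambda>j\<in>{..<p}. x (i, j))) / ennreal (\<Prod>i<n. gauss s (y i))"
        using q by (simp add: ref_density_def divide_ennreal prod_nonneg)
    qed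
    also have "\<dots> = (\<integral>\<^sup>+x. (\<Prod>i<n. g i (\<lambda>j\<in>{..<p}. x (i, j))) \<partial>?X) / ennreal (\<Prod>i<n. gauss s (y i))"
    proof (rule nn_integral_divide)
      have "(\<lambda>x. g i (\<lambda>j\<in>{..<p}. x (i, j))) \<in> borel_measurable ?X" if "i < n" for i
      proof -
        have "(\<lambda>x. ennreal (gauss 1 (y i - design_mult p \<theta> x i) * gauss 1 (y i - design_mult p \<theta>' x i)))
          \<in> borel_measurable ?X"
          using that by measurable
        then show ?thesis by (simp add: g_def design_mult_def)
      qed
      then show "(\<lambda>x. \<Prod>i<n. g i (\<lambda>j\<in>{..<p}. x (i, j))) \<in> borel_measurable ?X"
        by (intro borel_measurable_prod_ennreal) auto
    qed
    also have "(\<integral>\<^sup>+x. (\<Prod>i<n. g i (\<lambda>j\<in>{..<p}. x (i, j))) \<partial>?X) = (\<Prod>i<n. ennreal (gauss w (y i) / (2 * \<tau> * sqrt pi)))"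
    proof -
      have "(\<integral>\<^sup>+x. (\<Prod>i<n. g i (\<lambda>j\<in>{..<p}. x (i, j))) \<partial>?X) = (\<Prod>i<n. \<integral>\<^sup>+x. g i x \<partial>gauss_prod {..<p})"
        by (intro nn_integral_PiM_rows) (auto simp: g_def)
      then show ?thesis by (simp add: g_def row1)
    qed
    also have "\<dots> / ennreal (\<Prod>i<n. gauss s (y i))
      = (\<Prod>i<n. ?G (y i))"
    proof -
      define a where "a i = gauss w (y i) / (2 * \<tau> * sqrt pi)" for i
      define b where "b i = gauss s (y i)" for i
      have ab: "a i \<ge> 0" "b i > 0" for i using \<tau> s by (auto simp: a_def b_def normal_density_pos)
      have "(\<Prod>i<n. ennreal (a i)) / ennreal (\<Prod>i<n. b i) = (\<Prod>i<n. ennreal (a i / b i))"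
        using ab by (simp add: prod_ennreal divide_ennreal prod_nonneg prod_pos less_imp_le prod_dividef)
      then show ?thesis by (simp add: a_def b_def)
    qed
    finally show "(\<integral>\<^sup>+x. ?F y x \<partial>?X)
      = (\<Prod>i<n. ?G (y i))" .
  qed
  also have "\<dots> = (\<integral>\<^sup>+y. ennreal (gauss w y / (2 * \<tau> * sqrt pi) / gauss s y) \<partial>lborel) ^ n"
    by (subst product_sigma_finite.product_nn_integral_prod[OF psf_lborel]) auto
  also have "(\<integral>\<^sup>+y. ennreal (gauss w y / (2 * \<tau> * sqrt pi) / gauss s y) \<partial>lborel)
    = (\<integral>\<^sup>+y. ennreal (1 / (2 * \<tau> * sqrt pi)) * ennreal (gauss w y / gauss s y) \<partial>lborel)"
    using \<tau> by (intro nn_integral_cong) (simp add: ennreal_mult'[symmetric])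
  also have "\<dots> = ennreal (1 / (2 * \<tau> * sqrt pi)) * ennreal (sqrt (2 * pi) * s\<^sup>2 / sqrt (s\<^sup>2 - w\<^sup>2))"
    using normal_density_ratio[OF w ws] by (subst nn_integral_cmult) auto
  also have "\<dots> = ennreal (s\<^sup>2 / (\<tau> * sqrt (2 * s\<^sup>2 - 1 - r2 - c)))"
  proof -
    have "s\<^sup>2 - w\<^sup>2 = (2 * s\<^sup>2 - 1 - r2 - c) / 2" unfolding w2 by (simp add: field_simps)
    then have "sqrt (s\<^sup>2 - w\<^sup>2) = sqrt (2 * s\<^sup>2 - 1 - r2 - c) / sqrt 2" by (simp only: real_sqrt_divide)
    moreover have e: "sqrt 2 * (s\<^sup>2 * sqrt 2) = 2 * s\<^sup>2"
      by (simp only: mult.left_commute[of "sqrt 2"]) simp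
    ultimately show ?thesis using \<tau> less
      by (simp add: ennreal_mult'[symmetric] real_sqrt_mult e)
  qed
  finally show ?thesis using \<tau> less by (simp add: ennreal_power \<tau>_def)
qed

section \<open>Block priors\<close>

lemma measurable_obs_base:
  "f \<in> borel_measurable (obs_space n p) \<Longrightarrow> f \<in> borel_measurable (base_measure n p)"
  by (simp add: measurable_cong_sets[OF sets_base_measure refl])

abbreviation ref_mean :: "nat \<Rightarrow> nat \<Rightarrow> real \<Rightarrow> (obs \<Rightarrow> real) \<Rightarrow> real" where
  "ref_mean n p s \<psi> \<equiv> \<integral>z. \<psi> z * ref_density n s z \<partial>base_measure n p"

text \<open>\<open>ov\<close> is what \<open>row_kernel\<close> needs to separate common from
  disjoint coordinates. \<open>less\<close> is stated with 2 * r2 because every inner product is at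
  most r2.\<close>

lemma mixture_vs_ref:
  fixes \<theta> :: "'i \<Rightarrow> nat \<Rightarrow> real"
  assumes fin: "finite I" and w: "(\<Sum>i\<in>I. w i) = 1" and s: "s > 0"
    and ov: "\<And>i i' j. i \<in> I \<Longrightarrow> i' \<in> I \<Longrightarrow> j < p \<Longrightarrow> \<theta> i j = 0 \<or> \<theta> i' j = 0 \<or> \<theta> i j = \<theta> i' j"
    and r: "\<And>i. i \<in> I \<Longrightarrow> (\<Sum>j<p. (\<theta> i j)\<^sup>2) = r2"
    and less: "1 + 2 * r2 < 2 * s\<^sup>2"
    and K: "\<And>i i'. i \<in> I \<Longrightarrow> i' \<in> I \<Longrightarrow>
      K i i' = (s\<^sup>2 / (sqrt (1 + r2 - (\<Sum>j<p. \<theta> i j * \<theta> i' j)) * sqrt (2 * s\<^sup>2 - 1 - r2 - (\<Sum>j<p. \<theta> i j * \<theta> i' j)))) ^ n"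
    and \<psi>[measurable]: "\<psi> \<in> borel_measurable (obs_space n p)" and \<psi>01: "\<And>z. 0 \<le> \<psi> z" "\<And>z. \<psi> z \<le> 1"
  shows "\<bar>(\<Sum>i\<in>I. w i * mean_test n p (\<theta> i) \<psi>) - ref_mean n p s \<psi>\<bar>
    \<le> sqrt ((\<Sum>i\<in>I. \<Sum>i'\<in>I. w i * w i' * K i i') - 1)"
proof -
  have cr: "(\<Sum>j<p. \<theta> i j * \<theta> i' j) \<le> r2" if "i \<in> I" "i' \<in> I" for i i'
    using row_kernel(2)[of "{..<p}" "\<theta> i" "\<theta> i'" r2, OF _ _ r[OF that(1)] r[OF that(2)] refl] ov[OF that] by auto
  have "\<bar>(\<Sum>i\<in>I. w i * (\<integral>z. \<psi> z * lik n p (\<theta> i) z \<partial>base_measure n p)) - 1 * ref_mean n p s \<psi>\<bar>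
    \<le> sqrt ((\<Sum>i\<in>I. \<Sum>j\<in>I. w i * w j * K i j) - 2 * 1 * (\<Sum>i\<in>I. w i) + 1\<^sup>2)"
  proof (rule chi2_bound[OF fin])
    fix i j assume ij: "i \<in> I" "j \<in> I"
    show "(\<integral>\<^sup>+z. ennreal (lik n p (\<theta> i) z * lik n p (\<theta> j) z / ref_density n s z) \<partial>base_measure n p) = ennreal (K i j)"
      unfolding K[OF ij]
      by (rule lik_kernel_ref[OF s _ r[OF ij(1)] r[OF ij(2)] refl]) (use ov[OF ij] cr[OF ij] less in auto)
    show "0 \<le> K i j"
      unfolding K[OF ij] using cr[OF ij] less s by (intro zero_le_power divide_nonneg_nonneg mult_nonneg_nonneg) auto
  qed (use s \<psi>01 in \<open>auto simp: lik_nonneg ref_density_pos nn_integral_lik_1 nn_integral_ref_density intro!: measurable_obs_base\<close>)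
  then show ?thesis using w by (simp add: mean_test_lik[OF \<psi> \<psi>01(1)])
qed

text \<open>The chord of exp over the segment from 0 to y, derived from the tangent at x * y
  evaluated at both ends, with weights 1 - x and x.\<close>

lemma exp_le_convex_comb:
  fixes x y :: real
  assumes "0 \<le> x" "x \<le> 1"
  shows "exp (x * y) \<le> 1 - x + x * exp y"
proof -
  let ?t = "x * y"
  have "exp ?t * (1 + (y - ?t)) \<le> exp ?t * exp (y - ?t)"
    by (intro mult_left_mono exp_ge_add_one_self) auto
  then have 1: "exp ?t * (1 + (y - ?t)) \<le> exp y" by (simp add: exp_add[symmetric])
  have "exp ?t * (1 + (- ?t)) \<le> exp ?t * exp (- ?t)"
    by (intro mult_left_mono exp_ge_add_one_self) auto
  then have 2: "exp ?t * (1 - ?t) \<le> 1" by (simp add: exp_minus)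
  have "exp ?t = x * (exp ?t * (1 + (y - ?t))) + (1 - x) * (exp ?t * (1 - ?t))" by algebra
  also have "\<dots> \<le> x * exp y + (1 - x) * 1"
    using assms 1 2 by (intro add_mono mult_left_mono) auto
  finally show ?thesis by simp
qed

text \<open>Makes the kernel exponential in the overlap fraction x, so that averaging it yields a
  moment generating function. Equality holds at x = 0 and x = 1; only ln (1 + r2), not r2, has to be
  controlled, and this is what permits very large norms.\<close>

lemma overlap_ratio_le:
  fixes r2 x :: real
  assumes "r2 \<ge> 0" "0 \<le> x" "x \<le> 1"
  shows "(1 + r2) / (1 + r2 - r2 * x) \<le> exp (x * ln (1 + r2))"
proof -
  have "exp (x * - ln (1 + r2)) \<le> 1 - x + x * exp (- ln (1 + r2))"
    using assms by (intro exp_le_convex_comb)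
  also have "\<dots> = (1 + r2 - r2 * x) / (1 + r2)"
    using assms by (simp add: exp_minus field_simps)
  finally have "inverse ((1 + r2 - r2 * x) / (1 + r2)) \<le> inverse (exp (x * - ln (1 + r2)))"
    by (intro le_imp_inverse_le) auto
  then show ?thesis by (simp add: exp_minus)
qed

abbreviation block_choices :: "nat \<Rightarrow> nat \<Rightarrow> (nat \<Rightarrow> nat) set" where
  "block_choices k B \<equiv> PiE {..<k} (\<lambda>_. {..<B})"

text \<open>Coordinate \<open>j\<close> is position \<open>j mod B\<close> of block
  \<open>j div B\<close>. One choice per block, rather than a uniform support of size k, makes
  agreements in different blocks independent.\<close>

definition block_vec :: "nat \<Rightarrow> nat \<Rightarrow> real \<Rightarrow> (nat \<Rightarrow> nat) \<Rightarrow> nat \<Rightarrow> real" where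
  "block_vec k B a I j = (if j < k * B \<and> I (j div B) = j mod B then a else 0)"

lemma sum_blocks:
  fixes g :: "nat \<Rightarrow> nat \<Rightarrow> 'a :: comm_monoid_add"
  assumes "B > 0"
  shows "(\<Sum>j<k*B. g (j div B) (j mod B)) = (\<Sum>b<k. \<Sum>i<B. g b i)"
proof -
  have "(\<Sum>j<k*B. g (j div B) (j mod B)) = (\<Sum>b<k. \<Sum>j\<in>{b*B..<b*B+B}. g (j div B) (j mod B))"
    by (rule sum.nat_group[symmetric])
  also have "\<dots> = (\<Sum>b<k. \<Sum>i<B. g b i)"
  proof (rule sum.cong[OF refl])
    fix b
    have "(\<Sum>j\<in>{b*B..<b*B+B}. g (j div B) (j mod B)) = (\<Sum>i\<in>{..<B}. g ((i + b*B) div B) ((i + b*B) mod B))"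
      using sum.shift_bounds_nat_ivl[of "\<lambda>j. g (j div B) (j mod B)" 0 "b*B" B]
      by (simp add: atLeast0LessThan add.commute)
    also have "\<dots> = (\<Sum>i<B. g b i)" by (intro sum.cong) auto
    finally show "(\<Sum>j\<in>{b*B..<b*B+B}. g (j div B) (j mod B)) = (\<Sum>i<B. g b i)" .
  qed
  finally show ?thesis .
qed

lemma block_vec_inner:
  assumes "B > 0" "k * B \<le> p" "I \<in> block_choices k B"
  shows "(\<Sum>j<p. block_vec k B a I j * block_vec k B a I' j) = a\<^sup>2 * card {b\<in>{..<k}. I b = I' b}"
proof -
  have "(\<Sum>j<p. block_vec k B a I j * block_vec k B a I' j) = (\<Sum>j<k*B. block_vec k B a I j * block_vec k B a I' j)"
    using assms(2) by (intro sum.mono_neutral_right) (auto simp: block_vec_def)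
  also have "\<dots> = (\<Sum>j<k*B. (if I (j div B) = j mod B \<and> I' (j div B) = j mod B then a\<^sup>2 else 0))"
    by (intro sum.cong) (auto simp: block_vec_def power2_eq_square)
  also have "\<dots> = (\<Sum>b<k. \<Sum>i<B. if I b = i \<and> I' b = i then a\<^sup>2 else 0)"
    using sum_blocks[OF assms(1), of "\<lambda>b i. if I b = i \<and> I' b = i then a\<^sup>2 else 0"] .
  also have "\<dots> = (\<Sum>b<k. if I b = I' b then a\<^sup>2 else 0)"
  proof (intro sum.cong refl)
    fix b assume "b \<in> {..<k}"
    then have "I b < B" using assms(3) by (auto simp: PiE_iff)
    have "(\<Sum>i<B. if I b = i \<and> I' b = i then a\<^sup>2 else 0) = (\<Sum>i<B. if I b = i then (if I' b = I b then a\<^sup>2 else 0) else 0)"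
      by (intro sum.cong) auto
    also have "\<dots> = (if I b = I' b then a\<^sup>2 else 0)" using \<open>I b < B\<close> by auto
    finally show "(\<Sum>i<B. if I b = i \<and> I' b = i then a\<^sup>2 else 0) = (if I b = I' b then a\<^sup>2 else 0)" .
  qed
  also have "\<dots> = a\<^sup>2 * card {b\<in>{..<k}. I b = I' b}"
    by (subst sum.inter_filter[symmetric]) auto
  finally show ?thesis .
qed

text \<open>Two independent uniform choices agree in each block with probability 1/B, so the number
  of agreements is Binomial(k, 1/B).\<close>

lemma block_overlap_mgf:
  fixes k B :: nat and l :: real
  assumes "B > 0"
  shows "(\<Sum>I\<in>block_choices k B. \<Sum>I'\<in>block_choices k B.
      (1 / real B ^ k) * (1 / real B ^ k) * exp (l * card {b\<in>{..<k}. I b = I' b}))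
    = (1 + (exp l - 1) / B) ^ k"
proof -
  let ?S = "block_choices k B"
  have "(\<Sum>I'\<in>?S. exp (l * card {b\<in>{..<k}. I b = I' b})) = (real B - 1 + exp l) ^ k" if "I \<in> ?S" for I
  proof -
    have "(\<Sum>I'\<in>?S. exp (l * card {b\<in>{..<k}. I b = I' b})) = (\<Sum>I'\<in>?S. \<Prod>b<k. if I b = I' b then exp l else 1)"
    proof (intro sum.cong refl)
      fix I'
      have "(\<Prod>b<k. if I b = I' b then exp l else 1) = (\<Prod>b\<in>{b\<in>{..<k}. I b = I' b}. exp l)"
        by (subst prod.inter_filter) auto
      then show "exp (l * card {b\<in>{..<k}. I b = I' b}) = (\<Prod>b<k. if I b = I' b then exp l else 1)"
        by (simp add: exp_of_nat_mult[symmetric] mult.commute)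
    qed
    also have "\<dots> = (\<Prod>b<k. \<Sum>i<B. if I b = i then exp l else 1)"
      by (subst prod_sum_PiE) auto
    also have "\<dots> = (\<Prod>b<k. real B - 1 + exp l)"
    proof (intro prod.cong refl)
      fix b assume "b \<in> {..<k}"
      then have "I b < B" using that by (auto simp: PiE_iff)
      have "(\<Sum>i<B. if I b = i then exp l else 1) = (\<Sum>i<B. 1 + (if I b = i then exp l - 1 else 0))"
        by (intro sum.cong) auto
      also have "\<dots> = real B + (exp l - 1)" using \<open>I b < B\<close> by (simp add: sum.distrib)
      finally show "(\<Sum>i<B. if I b = i then exp l else 1) = real B - 1 + exp l" by simp
    qed
    finally show ?thesis by simp
  qed
  note h = this
  have "(\<Sum>I\<in>?S. \<Sum>I'\<in>?S. (1 / real B ^ k) * (1 / real B ^ k) * exp (l * card {b\<in>{..<k}. I b = I' b}))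
    = (\<Sum>I\<in>?S. (1 / real B ^ k) * (1 / real B ^ k) * (real B - 1 + exp l) ^ k)"
    by (intro sum.cong refl) (simp only: sum_distrib_left[symmetric] h)
  also have "\<dots> = real B ^ k * ((1 / real B ^ k) * (1 / real B ^ k) * (real B - 1 + exp l) ^ k)"
    by (simp add: card_PiE)
  also have "\<dots> = ((real B - 1 + exp l) / B) ^ k"
    using assms by (simp add: power_divide)
  also have "(real B - 1 + exp l) / B = 1 + (exp l - 1) / B"
    using assms by (simp add: field_simps)
  finally show ?thesis .
qed

lemma block_prior_vs_ref:
  fixes k B n p :: nat
  assumes k: "k > 0" and B: "B > 0" and kB: "k * B \<le> p" and r2: "r2 > 0" and a: "a = sqrt (r2 / k)"
    and \<psi>[measurable]: "\<psi> \<in> borel_measurable (obs_space n p)" and \<psi>01: "\<And>z. 0 \<le> \<psi> z" "\<And>z. \<psi> z \<le> 1"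
  shows "\<bar>(\<Sum>I\<in>block_choices k B. (1 / real B ^ k) * mean_test n p (block_vec k B a I) \<psi>)
      - ref_mean n p (sqrt (1 + r2)) \<psi>\<bar>
    \<le> sqrt (exp (k * (exp (n * ln (1 + r2) / k) - 1) / B) - 1)"
proof -
  let ?S = "block_choices k B"
  define s where "s = sqrt (1 + r2)"
  have s: "s > 0" "s\<^sup>2 = 1 + r2" using r2 by (auto simp: s_def)
  have a2: "a\<^sup>2 = r2 / k" using a r2 by simp
  have inner: "(\<Sum>j<p. block_vec k B a I j * block_vec k B a I' j) = r2 * (card {b\<in>{..<k}. I b = I' b} / k)"
    if "I \<in> ?S" for I I'
    using block_vec_inner[OF B kB that, of a I'] a2 by simp
  define K where "K I I' = (s\<^sup>2 / (sqrt (1 + r2 - (\<Sum>j<p. block_vec k B a I j * block_vec k B a I' j))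
    * sqrt (2 * s\<^sup>2 - 1 - r2 - (\<Sum>j<p. block_vec k B a I j * block_vec k B a I' j)))) ^ n" for I I'
  have "\<bar>(\<Sum>I\<in>?S. (1 / real B ^ k) * mean_test n p (block_vec k B a I) \<psi>)
      - ref_mean n p s \<psi>\<bar>
    \<le> sqrt ((\<Sum>I\<in>?S. \<Sum>I'\<in>?S. (1 / real B ^ k) * (1 / real B ^ k) * K I I') - 1)"
  proof (rule mixture_vs_ref[where ?r2.0=r2 and \<theta>="block_vec k B a" and K=K and p=p])
    show "finite ?S" by (intro finite_PiE) auto
    show "(\<Sum>I\<in>?S. 1 / real B ^ k) = 1" using B by (simp add: card_PiE)
    show "(\<Sum>j<p. (block_vec k B a I j)\<^sup>2) = r2" if "I \<in> ?S" for I
      using inner[OF that, of I] k by (simp add: power2_eq_square)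
    show "1 + 2 * r2 < 2 * s\<^sup>2" using s by simp
    show "block_vec k B a I j = 0 \<or> block_vec k B a I' j = 0 \<or> block_vec k B a I j = block_vec k B a I' j" for I I' j
      by (simp add: block_vec_def)
  qed (use s \<psi>01 in \<open>simp_all only: K_def \<psi>\<close>)
  also have "\<dots> \<le> sqrt (exp (k * (exp (n * ln (1 + r2) / k) - 1) / B) - 1)"
  proof -
    have K: "K I I' \<le> exp (n * ln (1 + r2) / k * card {b\<in>{..<k}. I b = I' b})" if "I \<in> ?S" for I I'
    proof -
      define x where "x = card {b\<in>{..<k}. I b = I' b} / real k"
      have "card {b\<in>{..<k}. I b = I' b} \<le> card {..<k}" by (intro card_mono) auto
      then have x: "0 \<le> x" "x \<le> 1" using k by (auto simp: x_def)
      have "r2 * x \<le> r2 * 1" using r2 x by (intro mult_left_mono) auto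
      then have pos: "1 + r2 - r2 * x > 0" by simp
      \<comment> \<open>\<open>x\<close> is the fraction of agreeing blocks and r2 * x the inner
        product; as s^2 = 1 + r2, both square roots have the same argument.\<close>
      have "K I I' = ((1 + r2) / (1 + r2 - r2 * x)) ^ n"
      proof -
        have "2 * s\<^sup>2 - 1 - r2 - r2 * x = 1 + r2 - r2 * x" using s by simp
        moreover have "sqrt (1 + r2 - r2 * x) * sqrt (1 + r2 - r2 * x) = 1 + r2 - r2 * x" using pos by simp
        ultimately show ?thesis
          unfolding K_def inner[OF that] x_def[symmetric] by (simp only: s(2))
      qed
      also have "\<dots> \<le> exp (x * ln (1 + r2)) ^ n"
        using pos r2 x by (intro power_mono overlap_ratio_le) auto
      also have "\<dots> = exp (n * ln (1 + r2) / k * card {b\<in>{..<k}. I b = I' b})"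
        by (simp add: exp_of_nat_mult[symmetric] x_def mult_ac)
      finally show ?thesis .
    qed
    have "(\<Sum>I\<in>?S. \<Sum>I'\<in>?S. (1 / real B ^ k) * (1 / real B ^ k) * K I I')
      \<le> (\<Sum>I\<in>?S. \<Sum>I'\<in>?S. (1 / real B ^ k) * (1 / real B ^ k) * exp (n * ln (1 + r2) / k * card {b\<in>{..<k}. I b = I' b}))"
      by (intro sum_mono mult_left_mono K) auto
    also have "\<dots> = (1 + (exp (n * ln (1 + r2) / k) - 1) / B) ^ k"
      by (rule block_overlap_mgf[OF B])
    also have "\<dots> \<le> exp ((exp (n * ln (1 + r2) / k) - 1) / B) ^ k"
      using r2 B by (intro power_mono exp_ge_add_one_self) (auto intro!: add_nonneg_nonneg divide_nonneg_nonneg)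
    also have "\<dots> = exp (k * (exp (n * ln (1 + r2) / k) - 1) / B)"
      by (simp add: exp_of_nat_mult[symmetric])
    finally show ?thesis by simp
  qed
  finally show ?thesis by (simp add: s_def)
qed

text \<open>The square of the kernel of one row is (1 + r2)^2 / (1 + 2 r2) = 1 + r2^2 / (1 + 2 r2).
  The first-order term in r2 cancels, so the change of variance stays invisible as long as n r2^2 is
  small.\<close>

lemma zero_vs_ref:
  assumes r2: "r2 > 0"
    and \<psi>[measurable]: "\<psi> \<in> borel_measurable (obs_space n p)" and \<psi>01: "\<And>z. 0 \<le> \<psi> z" "\<And>z. \<psi> z \<le> 1"
  shows "\<bar>mean_test n p (\<lambda>_. 0) \<psi> - ref_mean n p (sqrt (1 + r2)) \<psi>\<bar>
    \<le> sqrt (exp (n * r2\<^sup>2 / 2) - 1)"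
proof -
  define s where "s = sqrt (1 + r2)"
  have s: "s > 0" "s\<^sup>2 = 1 + r2" using r2 by (auto simp: s_def)
  have "\<bar>(\<Sum>i\<in>{()}. 1 * mean_test n p (\<lambda>_. 0) \<psi>) - ref_mean n p s \<psi>\<bar>
    \<le> sqrt ((\<Sum>i\<in>{()}. \<Sum>i'\<in>{()}. 1 * 1 * ((1 + r2) / sqrt (2 * (1 + r2) - 1)) ^ n) - 1)"
    by (rule mixture_vs_ref[where ?r2.0=0]) (use s r2 \<psi>01 in auto)
  also have "\<dots> \<le> sqrt (exp (n * r2\<^sup>2 / 2) - 1)"
  proof -
    have "(1 + r2)\<^sup>2 / (1 + 2 * r2) = 1 + r2\<^sup>2 / (1 + 2 * r2)"
      using r2 by (simp add: field_simps power2_eq_square)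
    also have "\<dots> \<le> 1 + r2\<^sup>2 / 1" using r2 by (intro add_left_mono divide_left_mono) auto
    also have "\<dots> \<le> exp (r2\<^sup>2)" using exp_ge_add_one_self[of "r2\<^sup>2"] by simp
    finally have "sqrt ((1 + r2)\<^sup>2 / (1 + 2 * r2)) \<le> sqrt (exp (r2\<^sup>2))" by simp
    also have "sqrt (exp (r2\<^sup>2)) = exp (r2\<^sup>2 / 2)"
      by (intro real_sqrt_unique) (auto simp: exp_double[symmetric])
    also have "sqrt ((1 + r2)\<^sup>2 / (1 + 2 * r2)) = (1 + r2) / sqrt (2 * (1 + r2) - 1)"
      using r2 by (simp add: real_sqrt_divide)
    finally have "((1 + r2) / sqrt (2 * (1 + r2) - 1)) ^ n \<le> exp (r2\<^sup>2 / 2) ^ n"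
      using r2 by (intro power_mono) auto
    then show ?thesis by (simp add: exp_of_nat_mult[symmetric])
  qed
  finally show ?thesis by (simp add: s_def)
qed

section \<open>From priors to the separation distance\<close>

lemma prob_space_obs_law: "prob_space (obs_law n p \<theta> \<sigma>)"
proof -
  interpret prob_space "noise_law n p" by (rule prob_space_noise_law)
  have "(\<lambda>(e, x). ((\<lambda>i\<in>{..<n}. (\<Sum>j<p. x (i, j) * \<theta> j) + \<sigma> * e i), x)) \<in> measurable (noise_law n p) (obs_space n p)"
    using measurable_shift[where n=n and p=p and \<theta>=\<theta> and s=\<sigma>]
    unfolding design_mult_def measurable_cong_sets[OF sets_noise_law refl] .
  then show ?thesis unfolding obs_law_def by (rule prob_space_distr)
qed

lemma measurable_scale_obs [measurable]:
  "(\<lambda>(y, x). (\<lambda>i\<in>{..<n}. \<sigma> * y i, x)) \<in> measurable (obs_space n p) (obs_space n p)"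
  unfolding obs_space_def by measurable

lemma measurable_scaled_test:
  assumes "\<phi> \<in> tests n p"
  shows "(\<lambda>(y, x). of_bool (\<phi> (\<lambda>i\<in>{..<n}. \<sigma> * y i, x)) :: real) \<in> borel_measurable (obs_space n p)"
proof -
  have "(\<lambda>z. of_bool (\<phi> ((\<lambda>(y, x). (\<lambda>i\<in>{..<n}. \<sigma> * y i, x)) z)) :: real) \<in> borel_measurable (obs_space n p)"
    by (rule measurable_compose[OF measurable_scale_obs measurable_compose[OF assms[unfolded tests_def]]]) simp
  then show ?thesis by (simp add: split_def)
qed

text \<open>At parameter \<sigma> \<theta> and noise \<sigma> the response is \<sigma> times the
  response at parameter \<theta> and unit noise, so the test absorbs \<sigma>.\<close>

lemma obs_law_prob:
  assumes \<phi>: "\<phi> \<in> tests n p"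
  shows "measure (obs_law n p (\<lambda>j. \<sigma> * \<theta> j) \<sigma>) {z\<in>space (obs_law n p (\<lambda>j. \<sigma> * \<theta> j) \<sigma>). \<phi> z}
    = mean_test n p \<theta> (\<lambda>(y, x). of_bool (\<phi> (\<lambda>i\<in>{..<n}. \<sigma> * y i, x)))"
proof -
  let ?P = "obs_law n p (\<lambda>j. \<sigma> * \<theta> j) \<sigma>"
  let ?A = "{z\<in>space (obs_space n p). \<phi> z}"
  let ?T = "\<lambda>(e, x). ((\<lambda>i\<in>{..<n}. (\<Sum>j<p. x (i, j) * (\<sigma> * \<theta> j)) + \<sigma> * e i), x)"
  have T: "?T \<in> measurable (noise_law n p) (obs_space n p)"
    using measurable_shift[where n=n and p=p and \<theta>="\<lambda>j. \<sigma> * \<theta> j" and s=\<sigma>]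
    unfolding design_mult_def measurable_cong_sets[OF sets_noise_law refl] .
  have A: "?A \<in> sets (obs_space n p)"
    using measurable_sets[OF \<phi>[unfolded tests_def], of "{True}"] by (simp add: vimage_def Int_def conj_commute)
  have B: "?T -` ?A \<inter> space (noise_law n p) \<in> sets (noise_law n p)"
    using measurable_sets[OF T A] .
  have "measure ?P {z\<in>space ?P. \<phi> z}
    = measure (noise_law n p) (?T -` ?A \<inter> space (noise_law n p))"
    unfolding obs_law_def using measure_distr[OF T A] by simp
  also have "\<dots> = (\<integral>z. indicator (?T -` ?A \<inter> space (noise_law n p)) z \<partial>noise_law n p)"
    using B by simp
  also have "\<dots> = mean_test n p \<theta> (\<lambda>(y, x). of_bool (\<phi> (\<lambda>i\<in>{..<n}. \<sigma> * y i, x)))"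
    unfolding mean_test_def
  proof (intro Bochner_Integration.integral_cong refl)
    fix z assume w: "z \<in> space (noise_law n p)"
    have eq: "(\<lambda>i\<in>{..<n}. \<sigma> * (\<lambda>i\<in>{..<n}. design_mult p \<theta> x i + e i) i) = (\<lambda>i\<in>{..<n}. (\<Sum>j<p. x (i, j) * (\<sigma> * \<theta> j)) + \<sigma> * e i)" for x e
      by (auto simp: fun_eq_iff design_mult_def sum_distrib_left algebra_simps)
    show "indicator (?T -` ?A \<inter> space (noise_law n p)) z
      = (case z of (e, x) \<Rightarrow> (\<lambda>(y, x). of_bool (\<phi> (\<lambda>i\<in>{..<n}. \<sigma> * y i, x)) :: real) (\<lambda>i\<in>{..<n}. design_mult p \<theta> x i + e i, x))"
      using w measurable_space[OF T w] by (auto simp: indicator_def split_def simp flip: eq)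
  qed
  finally show ?thesis .
qed

text \<open>Adding a known \<open>t\<close> to the parameter translates \<open>Y\<close> by X t,
  which can be moved into the test. A bound valid for all tests therefore survives the
  shift.\<close>

lemma mean_test_shift:
  "mean_test n p (\<lambda>j. \<theta> j + t j) \<psi>
    = mean_test n p \<theta> (\<lambda>(y, x). \<psi> (\<lambda>i\<in>{..<n}. design_mult p t x i + 1 * y i, x))"
proof -
  have "(\<lambda>i\<in>{..<n}. design_mult p (\<lambda>j. \<theta> j + t j) x i + e i)
    = (\<lambda>i\<in>{..<n}. design_mult p t x i + 1 * (\<lambda>i\<in>{..<n}. design_mult p \<theta> x i + e i) i)" for x e
    by (auto simp: fun_eq_iff design_mult_def algebra_simps sum.distrib)
  then show ?thesis unfolding mean_test_def by simp
qed

text \<open>\<open>u\<close> is nonzero in at most k0 places, so it vanishes on at least D of the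
  coordinates where \<theta> has size at least \<open>a\<close>, and each of these costs
  a^2.\<close>

lemma dist_sparse_ge:
  fixes \<theta> u :: "nat \<Rightarrow> real"
  assumes u: "u \<in> B0 p k0" and a: "a > 0" and card: "real (card {j\<in>{..<p}. a \<le> \<bar>\<theta> j\<bar>}) \<ge> k0 + D"
  shows "D * a\<^sup>2 \<le> (\<Sum>j<p. (\<theta> j - u j)\<^sup>2)"
proof -
  let ?L = "{j\<in>{..<p}. a \<le> \<bar>\<theta> j\<bar>}" and ?U = "{j\<in>{..<p}. u j \<noteq> 0}"
  have "card ?U \<le> k0" using u by (simp add: B0_def l0norm_def)
  moreover have "card ?L \<le> card (?L - ?U) + card ?U"
    by (metis (no_types, lifting) card_Un_le card_mono finite_Un finite_lessThan finite_subset Un_Diff_cancel2 Un_upper1 le_trans mem_Collect_eq subsetI finite_Diff)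
  ultimately have D: "D \<le> card (?L - ?U)" using card by linarith
  have "D * a\<^sup>2 \<le> card (?L - ?U) * a\<^sup>2" using D by (intro mult_right_mono) auto
  also have "\<dots> = (\<Sum>j\<in>?L - ?U. a\<^sup>2)" by simp
  also have "\<dots> \<le> (\<Sum>j\<in>?L - ?U. (\<theta> j - u j)\<^sup>2)"
  proof (intro sum_mono)
    fix j assume "j \<in> ?L - ?U"
    then have "a \<le> \<bar>\<theta> j\<bar>" "u j = 0" by auto
    then show "a\<^sup>2 \<le> (\<theta> j - u j)\<^sup>2" using a by (simp add: abs_le_square_iff[symmetric])
  qed
  also have "\<dots> \<le> (\<Sum>j<p. (\<theta> j - u j)\<^sup>2)" by (intro sum_mono2) auto
  finally show ?thesis .
qed

lemma B0_scale: "\<sigma> \<noteq> 0 \<Longrightarrow> (\<lambda>j. \<sigma> * \<theta> j) \<in> B0 p k \<longleftrightarrow> \<theta> \<in> B0 p k"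
  by (simp add: B0_def l0norm_def)

lemma zero_in_B0: "(\<lambda>_. 0) \<in> B0 p k"
  by (simp add: B0_def l0norm_def)

lemma d2_scaled_ge:
  assumes \<sigma>: "\<sigma> > 0" and a: "a > 0" and D: "D \<ge> 0"
    and card: "real (card {j\<in>{..<p}. a \<le> \<bar>\<theta> j\<bar>}) \<ge> k0 + D"
  shows "d2 p (\<lambda>j. \<sigma> * \<theta> j) (B0 p k0) \<ge> sqrt (D * a\<^sup>2) * \<sigma>"
  unfolding d2_def
proof (rule cINF_greatest)
  show "B0 p k0 \<noteq> {}" using zero_in_B0 by auto
  fix u assume u: "u \<in> B0 p k0"
  have "\<sigma> * a \<le> \<bar>\<sigma> * \<theta> j\<bar> \<longleftrightarrow> a \<le> \<bar>\<theta> j\<bar>" for j using \<sigma> by (simp add: abs_mult)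
  then have "D * (\<sigma> * a)\<^sup>2 \<le> (\<Sum>j<p. (\<sigma> * \<theta> j - u j)\<^sup>2)"
    using dist_sparse_ge[OF u, where a="\<sigma> * a" and \<theta>="\<lambda>j. \<sigma> * \<theta> j" and D=D] \<sigma> a card by simp
  then have "sqrt (D * (\<sigma> * a)\<^sup>2) \<le> sqrt (\<Sum>j<p. (\<sigma> * \<theta> j - u j)\<^sup>2)" by simp
  also have "sqrt (D * (\<sigma> * a)\<^sup>2) = sqrt (D * a\<^sup>2) * \<sigma>"
    using \<sigma> by (simp add: real_sqrt_mult power_mult_distrib)
  finally show "sqrt (D * a\<^sup>2) * \<sigma> \<le> sqrt (\<Sum>j<p. (\<sigma> * \<theta> j - u j)\<^sup>2)" .
qed

text \<open>Meant for priors that lie in a hypothesis only up to mass \<epsilon>: on the exceptional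
  indices the probability is bounded by 1.\<close>

lemma weighted_prob_le:
  fixes u P :: "'i \<Rightarrow> real"
  assumes "finite I" "\<And>i. i \<in> I \<Longrightarrow> 0 \<le> u i" "(\<Sum>i\<in>I. u i) = 1" "(\<Sum>i\<in>I - G. u i) \<le> \<epsilon>"
    and "\<And>i. i \<in> I \<Longrightarrow> P i \<le> 1" "\<And>i. i \<in> I \<inter> G \<Longrightarrow> P i \<le> S" "0 \<le> S"
  shows "(\<Sum>i\<in>I. u i * P i) \<le> S + \<epsilon>"
proof -
  have split: "(\<Sum>i\<in>I. f i) = (\<Sum>i\<in>I \<inter> G. f i) + (\<Sum>i\<in>I - G. f i)" for f :: "'i \<Rightarrow> real"
    using assms(1) by (metis sum.Int_Diff)
  have "(\<Sum>i\<in>I \<inter> G. u i * P i) \<le> (\<Sum>i\<in>I \<inter> G. u i * S)"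
    using assms by (intro sum_mono mult_left_mono) auto
  also have "\<dots> = (\<Sum>i\<in>I \<inter> G. u i) * S" by (simp add: sum_distrib_right)
  also have "\<dots> \<le> 1 * S"
  proof (rule mult_right_mono)
    show "(\<Sum>i\<in>I \<inter> G. u i) \<le> 1" unfolding assms(3)[symmetric]
      using assms(1,2) by (intro sum_mono2) auto
  qed fact
  finally have 1: "(\<Sum>i\<in>I \<inter> G. u i * P i) \<le> S" by simp
  have "(\<Sum>i\<in>I - G. u i * P i) \<le> (\<Sum>i\<in>I - G. u i * 1)"
    using assms by (intro sum_mono mult_left_mono) auto
  then show ?thesis using 1 assms(4) split[of "\<lambda>i. u i * P i"] by simp
qed

text \<open>Le Cam's argument: suprema over the hypotheses dominate averages over the priors. The
  priors may leave their hypotheses with masses \<delta> and \<epsilon>, each of which is paid for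
  once.\<close>

lemma risk_ge:
  fixes u :: "'i \<Rightarrow> real" and w :: "'j \<Rightarrow> real"
  assumes \<sigma>: "\<sigma> > 0" and \<phi>: "\<phi> \<in> tests n p"
    and I: "finite I" "\<And>i. i \<in> I \<Longrightarrow> 0 \<le> u i" "(\<Sum>i\<in>I. u i) = 1" "(\<Sum>i\<in>I - G. u i) \<le> \<delta>"
    and J: "finite J" "\<And>i. i \<in> J \<Longrightarrow> 0 \<le> w i" "(\<Sum>i\<in>J. w i) = 1" "(\<Sum>i\<in>J - H. w i) \<le> \<epsilon>" "\<epsilon> < 1"
    and G: "\<And>i. i \<in> I \<inter> G \<Longrightarrow> \<mu> i \<in> B0 p k0"
    and H: "\<And>i. i \<in> J \<inter> H \<Longrightarrow> \<nu> i \<in> B0 p (k0 + \<Delta>) \<and> d2 p (\<lambda>j. \<sigma> * \<nu> i j) (B0 p k0) \<ge> \<rho> * \<sigma>"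
    and ind: "\<And>\<psi>. \<psi> \<in> borel_measurable (obs_space n p) \<Longrightarrow> (\<And>z. 0 \<le> \<psi> z) \<Longrightarrow> (\<And>z. \<psi> z \<le> 1) \<Longrightarrow>
      \<bar>(\<Sum>i\<in>I. u i * mean_test n p (\<mu> i) \<psi>) - (\<Sum>i\<in>J. w i * mean_test n p (\<nu> i) \<psi>)\<bar> \<le> \<eta>"
  shows "risk n p \<sigma> k0 \<Delta> \<rho> \<phi> \<ge> 1 - \<eta> - \<delta> - \<epsilon>"
proof -
  define P where "P \<theta> = measure (obs_law n p \<theta> \<sigma>) {z\<in>space (obs_law n p \<theta> \<sigma>). \<phi> z}" for \<theta>
  define Q where "Q \<theta> = measure (obs_law n p \<theta> \<sigma>) {z\<in>space (obs_law n p \<theta> \<sigma>). \<not> \<phi> z}" for \<theta>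
  define S0 where "S0 = (SUP \<theta>\<in>B0 p k0. P \<theta>)"
  define S1 where "S1 = (SUP \<theta>\<in>{\<theta>\<in>B0 p (k0 + \<Delta>). d2 p \<theta> (B0 p k0) \<ge> \<rho> * \<sigma>}. Q \<theta>)"
  define \<psi> where "\<psi> = (\<lambda>(y, x). of_bool (\<phi> (\<lambda>i\<in>{..<n}. \<sigma> * y i, x)) :: real)"
  have risk: "risk n p \<sigma> k0 \<Delta> \<rho> \<phi> = S0 + S1"
    by (simp add: risk_def S0_def S1_def P_def Q_def)
  have P01: "0 \<le> P \<theta>" "P \<theta> \<le> 1" "0 \<le> Q \<theta>" "Q \<theta> \<le> 1" "Q \<theta> = 1 - P \<theta>" for \<theta>
  proof -
    interpret prob_space "obs_law n p \<theta> \<sigma>" by (rule prob_space_obs_law)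
    have "{z\<in>space (obs_space n p). \<phi> z} \<in> sets (obs_space n p)"
      using measurable_sets[OF \<phi>[unfolded tests_def], of "{True}"] by (simp add: vimage_def Int_def conj_commute)
    then have "{z\<in>space (obs_law n p \<theta> \<sigma>). \<phi> z} \<in> events" by (simp add: obs_law_def)
    from prob_compl[OF this] show "Q \<theta> = 1 - P \<theta>"
      unfolding P_def Q_def by (simp add: set_diff_eq conj_commute cong: conj_cong)
    show "0 \<le> P \<theta>" "P \<theta> \<le> 1" "0 \<le> Q \<theta>" "Q \<theta> \<le> 1" by (simp_all add: P_def Q_def)
  qed
  have bdd: "bdd_above (P ` A)" "bdd_above (Q ` A)" for A
    using P01 by (auto intro!: bdd_aboveI2[where M=1])
  have S0: "P \<theta> \<le> S0" if "\<theta> \<in> B0 p k0" for \<theta>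
    unfolding S0_def using that by (intro cSUP_upper bdd)
  have S1: "Q \<theta> \<le> S1" if "\<theta> \<in> B0 p (k0 + \<Delta>)" "d2 p \<theta> (B0 p k0) \<ge> \<rho> * \<sigma>" for \<theta>
    unfolding S1_def using that by (intro cSUP_upper bdd) auto
  have m: "P (\<lambda>j. \<sigma> * \<theta> j) = mean_test n p \<theta> \<psi>" for \<theta>
    unfolding P_def \<psi>_def by (rule obs_law_prob[OF \<phi>])
  have "0 \<le> S0" using S0[OF zero_in_B0] P01(1) by (rule order_trans[rotated])
  \<comment> \<open>Because \<epsilon> < 1 some alternative exists. The real supremum
    \<open>S1\<close> then runs over a non-empty set; over the empty one nothing could be said about
    its sign.\<close>
  have "J \<inter> H \<noteq> {}"
  proof
    assume "J \<inter> H = {}"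
    then have "J - H = J" by auto
    then show False using J by simp
  qed
  then obtain i where i: "i \<in> J \<inter> H" by auto
  have "0 \<le> S1"
    by (rule order_trans[OF P01(3) S1[of "\<lambda>j. \<sigma> * \<nu> i j"]]) (use H[OF i] \<sigma> in \<open>auto simp: B0_scale\<close>)
  have 1: "(\<Sum>i\<in>I. u i * P (\<lambda>j. \<sigma> * \<mu> i j)) \<le> S0 + \<delta>"
    by (rule weighted_prob_le[OF I]) (use P01 G S0 \<sigma> \<open>0 \<le> S0\<close> in \<open>auto simp: B0_scale\<close>)
  have 2: "(\<Sum>i\<in>J. w i * Q (\<lambda>j. \<sigma> * \<nu> i j)) \<le> S1 + \<epsilon>"
    by (rule weighted_prob_le[OF J(1-4)]) (use P01 H S1 \<sigma> \<open>0 \<le> S1\<close> in \<open>auto simp: B0_scale\<close>)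
  have "(\<Sum>i\<in>J. w i * Q (\<lambda>j. \<sigma> * \<nu> i j)) = 1 - (\<Sum>i\<in>J. w i * mean_test n p (\<nu> i) \<psi>)"
    using J(3) by (simp add: P01(5) m algebra_simps sum_subtractf)
  moreover have "\<bar>(\<Sum>i\<in>I. u i * mean_test n p (\<mu> i) \<psi>) - (\<Sum>i\<in>J. w i * mean_test n p (\<nu> i) \<psi>)\<bar> \<le> \<eta>"
    by (rule ind) (use measurable_scaled_test[OF \<phi>, of \<sigma>] in \<open>auto simp: \<psi>_def\<close>)
  ultimately show ?thesis using 1 2 unfolding risk m by linarith
qed

lemma minimax_sep_ge:
  assumes \<rho>: "\<rho> > 0" and risk: "\<And>\<phi>. \<phi> \<in> tests n p \<Longrightarrow> risk n p \<sigma> k0 \<Delta> \<rho> \<phi> > \<gamma>"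
  shows "(minimax_sep n p \<sigma> \<gamma> k0 \<Delta>)\<^sup>2 \<ge> ereal (\<rho>\<^sup>2)"
proof -
  have "ereal \<rho> \<le> minimax_sep n p \<sigma> \<gamma> k0 \<Delta>"
    unfolding minimax_sep_def
  proof (rule INF_greatest)
    fix \<phi> assume "\<phi> \<in> tests n p"
    then show "ereal \<rho> \<le> rho_test n p \<sigma> \<gamma> k0 \<Delta> \<phi>"
      unfolding rho_test_def using \<rho> risk by (intro Sup_upper) auto
  qed
  then have "ereal \<rho> * ereal \<rho> \<le> minimax_sep n p \<sigma> \<gamma> k0 \<Delta> * minimax_sep n p \<sigma> \<gamma> k0 \<Delta>"
    using \<rho> by (intro ereal_mult_mono) (auto intro: order_trans[rotated])
  then show ?thesis by (simp add: power2_eq_square)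
qed

text \<open>Known spikes of size \<open>a\<close> in the last \<open>q\<close> coordinates use up part of the sparsity budget.\<close>

lemma minimax_sep_ge_priors:
  fixes u :: "'i \<Rightarrow> real" and w :: "'j \<Rightarrow> real" and D a :: real
  assumes \<sigma>: "\<sigma> > 0" and \<gamma>: "\<gamma> \<le> 0.06" and a: "a > 0" and D: "D > 0" and q: "q \<le> k0" "q \<le> p"
    and I: "finite I" "\<And>i. i \<in> I \<Longrightarrow> 0 \<le> u i" "(\<Sum>i\<in>I. u i) = 1" "(\<Sum>i\<in>I - G. u i) \<le> \<delta>"
    and J: "finite J" "\<And>i. i \<in> J \<Longrightarrow> 0 \<le> w i" "(\<Sum>i\<in>J. w i) = 1" "(\<Sum>i\<in>J - H. w i) \<le> \<epsilon>" "\<epsilon> < 1"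
    and supp0: "\<And>i j. i \<in> I \<Longrightarrow> j \<ge> p - q \<Longrightarrow> \<mu> i j = 0"
    and supp1: "\<And>i j. i \<in> J \<Longrightarrow> j \<ge> p - q \<Longrightarrow> \<nu> i j = 0"
    and G: "\<And>i. i \<in> I \<inter> G \<Longrightarrow> l0norm p (\<mu> i) + q \<le> k0"
    and H: "\<And>i. i \<in> J \<inter> H \<Longrightarrow> l0norm p (\<nu> i) + q \<le> k0 + \<Delta>"
      "\<And>i. i \<in> J \<inter> H \<Longrightarrow> real (card {j\<in>{..<p}. a \<le> \<bar>\<nu> i j\<bar>}) + q \<ge> k0 + D"
    and ind: "\<And>\<psi>. \<psi> \<in> borel_measurable (obs_space n p) \<Longrightarrow> (\<And>z. 0 \<le> \<psi> z) \<Longrightarrow> (\<And>z. \<psi> z \<le> 1) \<Longrightarrow>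
      \<bar>(\<Sum>i\<in>I. u i * mean_test n p (\<mu> i) \<psi>) - (\<Sum>i\<in>J. w i * mean_test n p (\<nu> i) \<psi>)\<bar> \<le> \<eta>"
    and small: "\<eta> + \<delta> + \<epsilon> < 0.94"
  shows "(minimax_sep n p \<sigma> \<gamma> k0 \<Delta>)\<^sup>2 \<ge> ereal (D * a\<^sup>2)"
proof -
  define t where "t j = (if p - q \<le> j \<and> j < p then a else 0)" for j
  \<comment> \<open>\<open>R\<close> will be "nonzero" and "of size at least \<open>a\<close>".
    Spikes of height exactly \<open>a\<close> count for both, so they raise the sparsity and the
    number of large coordinates by the same q.\<close>
  have card_shift: "card {j\<in>{..<p}. R (\<theta> j + t j)} = card {j\<in>{..<p}. R (\<theta> j)} + q"
    if supp: "\<And>j. j \<ge> p - q \<Longrightarrow> \<theta> j = 0" and R: "\<not> R 0" "R a" for \<theta> :: "nat \<Rightarrow> real" and R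
  proof -
    have "{j\<in>{..<p}. R (\<theta> j + t j)} = {j\<in>{..<p}. R (\<theta> j)} \<union> {p - q..<p}"
      using supp R by (auto simp: t_def)
    moreover have "{j\<in>{..<p}. R (\<theta> j)} \<inter> {p - q..<p} = {}" using supp R by auto
    ultimately have "card {j\<in>{..<p}. R (\<theta> j + t j)} = card {j\<in>{..<p}. R (\<theta> j)} + card {p - q..<p}"
      by (simp add: card_Un_disjoint)
    then show ?thesis using q by simp
  qed
  have ind': "\<bar>(\<Sum>i\<in>I. u i * mean_test n p (\<lambda>j. \<mu> i j + t j) \<psi>) - (\<Sum>i\<in>J. w i * mean_test n p (\<lambda>j. \<nu> i j + t j) \<psi>)\<bar> \<le> \<eta>"
    if \<psi>: "\<psi> \<in> borel_measurable (obs_space n p)" "\<And>z. 0 \<le> \<psi> z" "\<And>z. \<psi> z \<le> 1" for \<psi>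
  proof -
    have "(\<lambda>(y, x). \<psi> (\<lambda>i\<in>{..<n}. design_mult p t x i + 1 * y i, x)) \<in> borel_measurable (obs_space n p)"
      using measurable_compose[OF measurable_shift[where n=n and p=p and \<theta>=t and s=1] \<psi>(1)] by (simp add: split_def)
    then show ?thesis unfolding mean_test_shift by (intro ind) (auto simp: \<psi> split: prod.split)
  qed
  show ?thesis
  proof -
    define \<rho> where "\<rho> = sqrt (D * a\<^sup>2)"
    have \<rho>: "\<rho> > 0" "\<rho>\<^sup>2 = D * a\<^sup>2" using D a by (auto simp: \<rho>_def)
    have "ereal (\<rho>\<^sup>2) \<le> (minimax_sep n p \<sigma> \<gamma> k0 \<Delta>)\<^sup>2"
    proof (rule minimax_sep_ge[OF \<rho>(1)])
      fix \<phi> assume \<phi>: "\<phi> \<in> tests n p"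
      have "risk n p \<sigma> k0 \<Delta> \<rho> \<phi> \<ge> 1 - \<eta> - \<delta> - \<epsilon>"
      proof (rule risk_ge[OF \<sigma> \<phi> I J])
        fix i assume i: "i \<in> I \<inter> G"
        then show "(\<lambda>j. \<mu> i j + t j) \<in> B0 p k0"
          using G[OF i] card_shift[of "\<mu> i" "\<lambda>z. z \<noteq> 0"] supp0[of i] a
          by (auto simp: B0_def l0norm_def t_def)
      next
        fix i assume i: "i \<in> J \<inter> H"
        have "(\<lambda>j. \<nu> i j + t j) \<in> B0 p (k0 + \<Delta>)"
          using i H(1)[OF i] card_shift[of "\<nu> i" "\<lambda>z. z \<noteq> 0"] supp1[of i] a
          by (auto simp: B0_def l0norm_def t_def)
        moreover have "sqrt (D * a\<^sup>2) * \<sigma> \<le> d2 p (\<lambda>j. \<sigma> * (\<nu> i j + t j)) (B0 p k0)"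
          by (rule d2_scaled_ge) (use \<sigma> a D H(2)[OF i] i card_shift[of "\<nu> i" "\<lambda>z. a \<le> \<bar>z\<bar>"] supp1[of i] in auto)
        ultimately show "(\<lambda>j. \<nu> i j + t j) \<in> B0 p (k0 + \<Delta>) \<and>
            \<rho> * \<sigma> \<le> d2 p (\<lambda>j. \<sigma> * (\<nu> i j + t j)) (B0 p k0)"
          by (simp add: \<rho>_def)
      qed (blast intro: ind')+
      then show "risk n p \<sigma> k0 \<Delta> \<rho> \<phi> > \<gamma>" using \<gamma> small by auto
    qed
    then show ?thesis by (simp add: \<rho>)
  qed
qed

section \<open>Separation bounds from block priors\<close>

definition sparse_rate :: "nat \<Rightarrow> nat \<Rightarrow> real" where
  "sparse_rate p q = q * ln (1 + sqrt p / q)"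

lemma sparse_rate_pos: "q \<ge> 1 \<Longrightarrow> p > 0 \<Longrightarrow> sparse_rate p q > 0"
  unfolding sparse_rate_def by (intro mult_pos_pos ln_gt_zero) auto

text \<open>The target is 0.3 because two comparisons with the reference then cost 0.6, below the
  admissible 0.94.\<close>

lemma exp_minus_one_sqrt_le:
  fixes x :: real
  assumes "0 \<le> x" "x \<le> 1 / 25"
  shows "sqrt (exp x - 1) \<le> 0.3"
proof -
  have "exp x \<le> 1 + x + x\<^sup>2" using assms by (intro exp_bound) auto
  moreover have "x\<^sup>2 \<le> (1/25)\<^sup>2" using assms by (intro power_mono) auto
  ultimately have "exp x - 1 \<le> 0.3\<^sup>2" using assms by (simp add: power2_eq_square)
  then show ?thesis by (intro real_le_lsqrt) auto
qed

lemma two_close: "\<bar>x - z\<bar> \<le> 0.3 \<Longrightarrow> \<bar>y - z\<bar> \<le> 0.3 \<Longrightarrow> \<bar>x - y\<bar> \<le> 0.6" for x y z :: real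
  by linarith

text \<open>\<open>P\<close> counts the coordinates not occupied by known spikes, at least half of
  all; k ranges from q to 2 q so that one statement serves null and alternative. Then B is at least
  p/(8 q), and with w = sqrt p / q the exponent k (exp l - 1)/B is at most 2 q * w/400 * 8 q/p =
  q/(25 sqrt p). This is the origin of 400 = 16 * 25.\<close>

lemma block_close:
  fixes p q k n P :: nat and r2 :: real
  assumes p: "p \<ge> 64" and q: "1 \<le> q" "real q \<le> sqrt p" and k: "q \<le> k" "k \<le> 2 * q"
    and P: "p \<le> 2 * P" "P \<le> p" and r2: "r2 > 0" "n * ln (1 + r2) \<le> sparse_rate p q / 400"
    and \<psi>: "\<psi> \<in> borel_measurable (obs_space n p)" "\<And>z. 0 \<le> \<psi> z" "\<And>z. \<psi> z \<le> 1"
  shows "P div k > 0"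
    and "\<bar>(\<Sum>I\<in>block_choices k (P div k). (1 / real (P div k) ^ k) * mean_test n p (block_vec k (P div k) (sqrt (r2 / k)) I) \<psi>)
      - ref_mean n p (sqrt (1 + r2)) \<psi>\<bar> \<le> 0.3"
proof -
  define B where "B = P div k"
  have k0: "k > 0" using q k by simp
  have sp: "sqrt p \<ge> 8" using p by (intro real_le_rsqrt) auto
  have "real p / (4 * q) \<le> real P / k"
  proof -
    have "real p * k \<le> (2 * real P) * (2 * real q)" using P k by (intro mult_mono) auto
    then show ?thesis using k0 q by (simp add: field_simps)
  qed
  moreover have "real P / k - 1 \<le> B"
  proof -
    have "P < (B + 1) * k" unfolding B_def using k0 by (metis dividend_less_div_times add.commute mult.commute mult_Suc_right Suc_eq_plus1)
    then have "real P < (real B + 1) * k" by (metis of_nat_less_iff of_nat_mult of_nat_add of_nat_1)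
    then show ?thesis using k0 by (simp add: field_simps)
  qed
  \<comment> \<open>Rounding in \<open>P div k\<close> loses at most 1, which must not exceed half
    of p/(4 q). This is where sqrt p \<ge> 8, that is p \<ge> 64, enters.\<close>
  moreover have "1 \<le> real p / (8 * q)"
  proof -
    have "8 * real q \<le> sqrt p * sqrt p" using q sp by (intro mult_mono) auto
    then show ?thesis using q by (simp add: field_simps)
  qed
  ultimately have Bp: "real p / (8 * q) \<le> B" by (simp add: field_simps)
  then have B0: "B > 0" using \<open>1 \<le> real p / (8 * q)\<close> by (metis less_le_trans of_nat_0_less_iff zero_less_one order_trans)
  then show "P div k > 0" by (simp add: B_def)
  have kB: "k * B \<le> p" using P(2) unfolding B_def by (metis le_trans times_div_less_eq_dividend)
  define w where "w = sqrt p / q"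
  have w: "w > 0" using q p by (simp add: w_def)
  define l where "l = n * ln (1 + r2) / k"
  have "l \<le> sparse_rate p q / 400 / k" unfolding l_def using r2(2) k0 by (intro divide_right_mono) auto
  also have "\<dots> \<le> sparse_rate p q / 400 / q"
    using k q sparse_rate_pos[of q p] p by (intro divide_left_mono) auto
  also have "\<dots> = 1 / 400 * ln (1 + w)" using q by (simp add: sparse_rate_def w_def)
  finally have "exp l \<le> exp (1 / 400 * ln (1 + w))" by simp
  \<comment> \<open>Convexity replaces the small power of 1 + w by the linear bound 1 +
    w/400.\<close>
  also have "\<dots> \<le> 1 - 1 / 400 + 1 / 400 * exp (ln (1 + w))" by (intro exp_le_convex_comb) auto
  also have "\<dots> = 1 + w / 400" using w by (simp add: field_simps)
  finally have el: "exp l - 1 \<le> w / 400" by simp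
  have l0: "l \<ge> 0" unfolding l_def using r2(1) by auto
  have "k * (exp l - 1) / B \<le> (2 * q) * (w / 400) / B"
    using k el l0 B0 w by (intro divide_right_mono mult_mono) auto
  also have "\<dots> \<le> (2 * q) * (w / 400) / (real p / (8 * q))"
    using Bp w q p B0 by (intro divide_left_mono) auto
  also have "\<dots> = real q / 25 * (sqrt p / p)"
    using q p by (simp add: w_def field_simps)
  also have "\<dots> = real q / 25 / sqrt p"
    using p by (simp add: real_div_sqrt field_simps)
  also have "\<dots> \<le> 1 / 25"
  proof -
    have "real q / sqrt p \<le> 1" using q sp p by (subst divide_le_eq_1_pos) auto
    then have "real q / sqrt p / 25 \<le> 1 / 25" by (rule divide_right_mono) simp
    then show ?thesis by simp
  qed
  finally have small: "k * (exp l - 1) / B \<le> 1 / 25" .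
  have "\<bar>(\<Sum>I\<in>block_choices k B. (1 / real B ^ k) * mean_test n p (block_vec k B (sqrt (r2 / k)) I) \<psi>)
      - ref_mean n p (sqrt (1 + r2)) \<psi>\<bar>
    \<le> sqrt (exp (k * (exp l - 1) / B) - 1)"
    unfolding l_def by (rule block_prior_vs_ref[OF k0 B0 kB r2(1) refl \<psi>])
  also have "\<dots> \<le> 0.3"
    using small l0 by (intro exp_minus_one_sqrt_le) auto
  finally show "\<bar>(\<Sum>I\<in>block_choices k (P div k). (1 / real (P div k) ^ k) * mean_test n p (block_vec k (P div k) (sqrt (r2 / k)) I) \<psi>)
      - ref_mean n p (sqrt (1 + r2)) \<psi>\<bar> \<le> 0.3"
    by (simp add: B_def)
qed

lemma block_vec_card:
  assumes "B > 0" "k * B \<le> p" "I \<in> block_choices k B" "a > 0"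
  shows "l0norm p (block_vec k B a I) = k" "card {j\<in>{..<p}. a \<le> \<bar>block_vec k B a I j\<bar>} = k"
proof -
  have "(\<Sum>j<p. block_vec k B a I j * block_vec k B a I j) = (\<Sum>j<p. if block_vec k B a I j \<noteq> 0 then a\<^sup>2 else 0)"
    by (intro sum.cong) (auto simp: block_vec_def power2_eq_square)
  also have "\<dots> = a\<^sup>2 * card {j\<in>{..<p}. block_vec k B a I j \<noteq> 0}"
    by (subst sum.inter_filter[symmetric]) auto
  finally show l0: "l0norm p (block_vec k B a I) = k"
    using block_vec_inner[OF assms(1-3), of a I] assms(4) by (simp add: l0norm_def)
  have "{j\<in>{..<p}. a \<le> \<bar>block_vec k B a I j\<bar>} = {j\<in>{..<p}. block_vec k B a I j \<noteq> 0}"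
    using assms(4) by (auto simp: block_vec_def)
  then show "card {j\<in>{..<p}. a \<le> \<bar>block_vec k B a I j\<bar>} = k" using l0 by (simp add: l0norm_def)
qed

lemma block_vec_supp: "k * B \<le> m \<Longrightarrow> j \<ge> m \<Longrightarrow> block_vec k B a I j = 0"
  by (simp add: block_vec_def)

text \<open>All k0 units of sparsity go into known spikes, so that the null prior is the zero vector
  up to a shift. The first term in r2 hides the change of variance, the second hides the support of
  the alternative.\<close>

lemma minimax_sep_ge_zero_null:
  fixes n p k0 \<Delta> q :: nat
  assumes p: "p \<ge> 64" and q: "1 \<le> q" "real q \<le> sqrt p" "q \<le> \<Delta>" and k0: "2 * k0 \<le> p" and n: "n \<ge> 1"
    and \<sigma>: "\<sigma> > 0" and \<gamma>: "\<gamma> \<le> 0.06"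
  shows "(minimax_sep n p \<sigma> \<gamma> k0 \<Delta>)\<^sup>2 \<ge> ereal (min (1 / sqrt n) (sparse_rate p q / n) / 400)"
proof -
  define r2 where "r2 = min (1 / sqrt n) (sparse_rate p q / n) / 400"
  have r2: "r2 > 0" using sparse_rate_pos[of q p] q n p by (simp add: r2_def)
  have "n * ln (1 + r2) \<le> n * r2" using r2 by (intro mult_left_mono ln_add_one_self_le_self) auto
  also have "\<dots> \<le> n * (sparse_rate p q / n / 400)" unfolding r2_def by (intro mult_left_mono divide_right_mono) auto
  finally have nr: "n * ln (1 + r2) \<le> sparse_rate p q / 400" using n by simp
  have "r2\<^sup>2 \<le> (1 / sqrt n / 400)\<^sup>2"
    using r2 unfolding r2_def by (intro power_mono divide_right_mono) auto
  then have "n * r2\<^sup>2 \<le> 1 / 400\<^sup>2"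
    using n by (simp add: power_divide field_simps)
  then have nr2: "n * r2\<^sup>2 / 2 \<le> 1 / 25" by simp
  define P where "P = p - k0"
  have P: "p \<le> 2 * P" "P \<le> p" using k0 by (auto simp: P_def)
  define B where "B = P div q"
  define a where "a = sqrt (r2 / q)"
  have a: "a > 0" "a\<^sup>2 = r2 / q" using r2 q by (auto simp: a_def)
  have close: "\<bar>(\<Sum>I\<in>block_choices q B. (1 / real B ^ q) * mean_test n p (block_vec q B a I) \<psi>)
      - ref_mean n p (sqrt (1 + r2)) \<psi>\<bar> \<le> 0.3"
    if "\<psi> \<in> borel_measurable (obs_space n p)" "\<And>z. 0 \<le> \<psi> z" "\<And>z. \<psi> z \<le> 1" for \<psi>
    unfolding B_def a_def
    by (rule block_close[OF p q(1,2) _ _ P r2 nr that]) (use q in auto)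
  \<comment> \<open>The zero test only discharges the premises on \<psi> that both conclusions of
    \<open>block_close\<close> share.\<close>
  have B: "B > 0" unfolding B_def
    by (rule block_close(1)[OF p q(1,2) _ _ P r2 nr, of _ "\<lambda>_. 0"]) (use q in auto)
  have qB: "q * B \<le> p - k0" by (simp add: B_def P_def)
  have "(minimax_sep n p \<sigma> \<gamma> k0 \<Delta>)\<^sup>2 \<ge> ereal (q * a\<^sup>2)"
  proof (rule minimax_sep_ge_priors[where q=k0 and I="{()}" and u="\<lambda>_. 1" and G="{()}" and \<mu>="\<lambda>_ _. 0" and \<delta>=0 and \<epsilon>=0
        and J="block_choices q B" and w="\<lambda>_. 1 / real B ^ q" and H=UNIV and \<nu>="block_vec q B a" and \<eta>="0.6"])
    show "finite (block_choices q B)" by (intro finite_PiE) auto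
    show "(\<Sum>i\<in>block_choices q B. 1 / real B ^ q) = 1" using B by (simp add: card_PiE)
    show "block_vec q B a i j = 0" if "p - k0 \<le> j" for i j using block_vec_supp[OF qB that] .
    fix i assume "i \<in> block_choices q B \<inter> UNIV"
    then have c: "l0norm p (block_vec q B a i) = q" "card {j\<in>{..<p}. a \<le> \<bar>block_vec q B a i j\<bar>} = q"
      using block_vec_card[OF B _ _ a(1)] qB by auto
    show "l0norm p (block_vec q B a i) + k0 \<le> k0 + \<Delta>" using c q by simp
    show "real k0 + real q \<le> real (card {j\<in>{..<p}. a \<le> \<bar>block_vec q B a i j\<bar>}) + real k0" using c by simp
  next
    fix \<psi> :: "obs \<Rightarrow> real"
    assume \<psi>: "\<psi> \<in> borel_measurable (obs_space n p)" "\<And>z. 0 \<le> \<psi> z" "\<And>z. \<psi> z \<le> 1"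
    have "\<bar>mean_test n p (\<lambda>_. 0) \<psi> - ref_mean n p (sqrt (1 + r2)) \<psi>\<bar> \<le> 0.3"
      using zero_vs_ref[OF r2 \<psi>] exp_minus_one_sqrt_le[OF _ nr2] by simp
    then show "\<bar>(\<Sum>i\<in>{()}. 1 * mean_test n p (\<lambda>_. 0) \<psi>) - (\<Sum>i\<in>block_choices q B. 1 / real B ^ q * mean_test n p (block_vec q B a i) \<psi>)\<bar> \<le> 0.6"
      using two_close[OF _ close[OF \<psi>]] by simp
  qed (use assms a in \<open>auto simp: l0norm_def\<close>)
  then show ?thesis using a q by (simp add: r2_def)
qed

text \<open>Known spikes reduce k0 to q. The null has q entries of size sqrt (r2/q), the alternative
  q + d entries of size sqrt (r2/(q + d)). With equal norms the variance of \<open>Y\<close> gives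
  nothing away, while every null vector misses at least d entries of the alternative. No bound of
  order 1/sqrt n limits r2, which may be exponentially large.\<close>

lemma minimax_sep_ge_equal_norm:
  fixes n p k0 \<Delta> q d :: nat
  assumes p: "p \<ge> 64" and q: "1 \<le> q" "real q \<le> sqrt p" "q \<le> k0" and d: "1 \<le> d" "d \<le> q" "d \<le> \<Delta>"
    and k0: "2 * (k0 - q) \<le> p" and n: "n \<ge> 1"
    and \<sigma>: "\<sigma> > 0" and \<gamma>: "\<gamma> \<le> 0.06"
  shows "(minimax_sep n p \<sigma> \<gamma> k0 \<Delta>)\<^sup>2 \<ge> ereal (d * (exp (sparse_rate p q / (400 * n)) - 1) / (q + d))"
proof -
  \<comment> \<open>The largest r2 that \<open>block_close\<close> admits: n ln (1 + r2) equals
    \<open>sparse_rate p q / 400\<close>.\<close>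
  define r2 where "r2 = exp (sparse_rate p q / (400 * n)) - 1"
  have r2: "r2 > 0" using sparse_rate_pos[of q p] q n p by (simp add: r2_def)
  have nr: "n * ln (1 + r2) \<le> sparse_rate p q / 400" using n by (simp add: r2_def)
  define P where "P = p - (k0 - q)"
  have P: "p \<le> 2 * P" "P \<le> p" using k0 by (auto simp: P_def)
  define k where "k = q + d"
  have k: "q \<le> k" "k \<le> 2 * q" using d by (auto simp: k_def)
  define B where "B = P div q"
  define C where "C = P div k"
  define a where "a = sqrt (r2 / q)"
  define b where "b = sqrt (r2 / k)"
  have a: "a > 0" "b > 0" "b\<^sup>2 = r2 / k" using r2 q by (auto simp: a_def b_def k_def)
  have close: "\<bar>(\<Sum>I\<in>block_choices q B. (1 / real B ^ q) * mean_test n p (block_vec q B a I) \<psi>)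
      - ref_mean n p (sqrt (1 + r2)) \<psi>\<bar> \<le> 0.3"
    "\<bar>(\<Sum>I\<in>block_choices k C. (1 / real C ^ k) * mean_test n p (block_vec k C b I) \<psi>)
      - ref_mean n p (sqrt (1 + r2)) \<psi>\<bar> \<le> 0.3"
    if "\<psi> \<in> borel_measurable (obs_space n p)" "\<And>z. 0 \<le> \<psi> z" "\<And>z. \<psi> z \<le> 1" for \<psi>
    unfolding B_def a_def C_def b_def
    by (rule block_close[OF p q(1,2) _ _ P r2 nr that]; use q k in auto)+
  have B: "B > 0" "C > 0" unfolding B_def C_def
    by (rule block_close(1)[OF p q(1,2) _ _ P r2 nr, of _ "\<lambda>_. 0"]; use q k in auto)+
  have qB: "q * B \<le> p - (k0 - q)" "k * C \<le> p - (k0 - q)" by (simp_all add: B_def C_def P_def)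
  have "(minimax_sep n p \<sigma> \<gamma> k0 \<Delta>)\<^sup>2 \<ge> ereal (d * b\<^sup>2)"
  proof (rule minimax_sep_ge_priors[where q="k0 - q" and I="block_choices q B" and u="\<lambda>_. 1 / real B ^ q" and G=UNIV and \<mu>="block_vec q B a" and \<delta>=0 and \<epsilon>=0
        and J="block_choices k C" and w="\<lambda>_. 1 / real C ^ k" and H=UNIV and \<nu>="block_vec k C b" and \<eta>="0.6"])
    show "finite (block_choices q B)" "finite (block_choices k C)" by (auto intro!: finite_PiE)
    show "(\<Sum>i\<in>block_choices q B. 1 / real B ^ q) = 1" using B by (simp add: card_PiE)
    show "(\<Sum>i\<in>block_choices k C. 1 / real C ^ k) = 1" using B by (simp add: card_PiE)
    show "block_vec q B a i j = 0" if "p - (k0 - q) \<le> j" for i j using block_vec_supp[OF qB(1) that] .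
    show "block_vec k C b i j = 0" if "p - (k0 - q) \<le> j" for i j using block_vec_supp[OF qB(2) that] .
    show "l0norm p (block_vec q B a i) + (k0 - q) \<le> k0" if "i \<in> block_choices q B \<inter> UNIV" for i
      using that block_vec_card[OF B(1) _ _ a(1)] qB q by auto
    fix i assume "i \<in> block_choices k C \<inter> UNIV"
    then have c: "l0norm p (block_vec k C b i) = k" "card {j\<in>{..<p}. b \<le> \<bar>block_vec k C b i j\<bar>} = k"
      using block_vec_card[OF B(2) _ _ a(2)] qB by auto
    show "l0norm p (block_vec k C b i) + (k0 - q) \<le> k0 + \<Delta>" using c q d by (simp add: k_def)
    show "real k0 + real d \<le> real (card {j\<in>{..<p}. b \<le> \<bar>block_vec k C b i j\<bar>}) + real (k0 - q)"
      using c q by (simp add: k_def)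
  next
    fix \<psi> :: "obs \<Rightarrow> real"
    assume \<psi>: "\<psi> \<in> borel_measurable (obs_space n p)" "\<And>z. 0 \<le> \<psi> z" "\<And>z. \<psi> z \<le> 1"
    show "\<bar>(\<Sum>i\<in>block_choices q B. 1 / real B ^ q * mean_test n p (block_vec q B a i) \<psi>)
      - (\<Sum>i\<in>block_choices k C. 1 / real C ^ k * mean_test n p (block_vec k C b i) \<psi>)\<bar> \<le> 0.6"
      using two_close[OF close[OF \<psi>]] .
  qed (use assms a in auto)
  then show ?thesis using a by (simp add: r2_def k_def add.commute)
qed

section \<open>Moment matching\<close>

lemma lagrange_interpolation_eval:
  fixes P :: "real poly" and y :: "nat \<Rightarrow> real"
  assumes inj: "inj_on y {..m}" and deg: "degree P \<le> m"
  shows "poly P z = (\<Sum>i\<le>m. poly P (y i) * (\<Prod>j\<in>{..m}-{i}. (z - y j) / (y i - y j)))"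
proof -
  define L where "L = (\<Sum>i\<le>m. smult (poly P (y i)) (\<Prod>j\<in>{..m}-{i}. smult (1 / (y i - y j)) [:- y j, 1:]))"
  have evalL: "poly L z = (\<Sum>i\<le>m. poly P (y i) * (\<Prod>j\<in>{..m}-{i}. (z - y j) / (y i - y j)))" for z
    by (simp add: L_def poly_sum poly_prod diff_divide_distrib)
  have "degree L \<le> m"
    unfolding L_def
  proof (intro degree_sum_le)
    fix i assume i: "i \<in> {..m}"
    have "degree (\<Prod>j\<in>{..m}-{i}. smult (1 / (y i - y j)) [:- y j, 1:]) \<le> (\<Sum>j\<in>{..m}-{i}. degree (smult (1 / (y i - y j)) [:- y j, 1:]))"
      using degree_prod_sum_le[of "{..m}-{i}" "\<lambda>j. smult (1 / (y i - y j)) [:- y j, 1:]"] by (simp add: o_def)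
    also have "\<dots> \<le> (\<Sum>j\<in>{..m}-{i}. 1)"
      by (intro sum_mono) (auto intro: order_trans[OF degree_smult_le])
    also have "\<dots> = m" using i by simp
    finally show "degree (smult (poly P (y i)) (\<Prod>j\<in>{..m}-{i}. smult (1 / (y i - y j)) [:- y j, 1:])) \<le> m"
      by (rule order_trans[OF degree_smult_le])
  qed simp
  moreover have "card (y ` {..m}) = Suc m" using inj by (simp add: card_image)
  moreover have "poly P (y k) = poly L (y k)" if "k \<le> m" for k
  proof -
    have "(\<Prod>j\<in>{..m}-{i}. (y k - y j) / (y i - y j)) = (if i = k then 1 else 0)" if "i \<le> m" for i
    proof (cases "i = k")
      case True
      have "(\<Prod>j\<in>{..m}-{i}. (y k - y j) / (y i - y j)) = (\<Prod>j\<in>{..m}-{i}. 1)"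
        using True inj \<open>i \<le> m\<close> by (intro prod.cong) (auto simp: inj_on_def)
      then show ?thesis using True by simp
    next
      case False
      then show ?thesis using \<open>k \<le> m\<close> by (auto intro!: prod_zero bexI[of _ k])
    qed
    then have "poly L (y k) = (\<Sum>i\<le>m. poly P (y i) * (if i = k then 1 else 0))"
      unfolding evalL by (intro sum.cong) auto
    also have "\<dots> = (\<Sum>i\<le>m. if i = k then poly P (y i) else 0)" by (intro sum.cong) auto
    also have "\<dots> = poly P (y k)" using that by simp
    finally show ?thesis by simp
  qed
  ultimately have "P = L"
    using deg by (intro poly_eqI_degree[of "y ` {..m}"]) auto
  then have "poly P z = poly L z" by (rule arg_cong)
  also note evalL
  finally show ?thesis .
qed

section \<open>Chebyshev polynomials and extrapolation to zero\<close>

fun chebyshev :: "nat \<Rightarrow> real poly" where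
  "chebyshev 0 = 1"
| "chebyshev (Suc 0) = [:0, 1:]"
| "chebyshev (Suc (Suc n)) = [:0, 2:] * chebyshev (Suc n) - chebyshev n"

lemma degree_chebyshev: "degree (chebyshev n) \<le> n"
proof (induction n rule: chebyshev.induct)
  case (3 n)
  have "degree ([:0, 2:] * chebyshev (Suc n)) \<le> 1 + Suc n"
    by (rule order_trans[OF degree_mult_le add_mono]) (use 3 in auto)
  then show ?case using 3 by (auto intro!: degree_diff_le)
qed auto

lemma chebyshev_cos: "poly (chebyshev n) (cos t) = cos (n * t)"
proof (induction n rule: chebyshev.induct)
  case (3 n)
  have h: "u * c - s + (u * c + s) = 2 * c * u" for u c s :: real by simp
  have "cos (real (Suc (Suc n)) * t) = cos (real (Suc n) * t + t)" "cos (real n * t) = cos (real (Suc n) * t - t)"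
    by (simp_all add: algebra_simps)
  then have "cos (real (Suc (Suc n)) * t) + cos (real n * t) = 2 * cos t * cos (real (Suc n) * t)"
    by (simp only: cos_add cos_diff h)
  then show ?case using 3 by (simp add: algebra_simps)
qed auto

text \<open>The counterpart of \<open>chebyshev_cos\<close> outside [-1, 1], where the point 0 lands
  once the node interval has been rescaled to [-1, 1].\<close>

lemma chebyshev_joukowski:
  assumes "z \<noteq> 0"
  shows "poly (chebyshev n) ((z + 1 / z) / 2) = (z ^ n + (1 / z) ^ n) / 2"
proof (induction n rule: chebyshev.induct)
  case (3 n)
  define w where "w = 1 / z"
  have zw: "z * w = 1" using assms by (simp add: w_def)
  have g: "2 * ((z + w) / 2) * ((z * u + w * v) / 2) - (u + v) / 2 = (z * (z * u) + w * (w * v)) / 2" for u v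
  proof -
    have "2 * ((z + w) / 2) * ((z * u + w * v) / 2) - (u + v) / 2
      = (z * (z * u) + w * (w * v)) / 2 + (z * w - 1) * (u + v) / 2"
      by (simp add: field_simps)
    then show ?thesis using zw by simp
  qed
  have "2 * ((z + w) / 2) * ((z ^ Suc n + w ^ Suc n) / 2) - (z ^ n + w ^ n) / 2 = (z ^ Suc (Suc n) + w ^ Suc (Suc n)) / 2"
    unfolding power_Suc by (rule g)
  moreover have "poly (chebyshev (Suc (Suc n))) x = 2 * x * poly (chebyshev (Suc n)) x - poly (chebyshev n) x" for x
    by (simp add: algebra_simps)
  ultimately show ?case using 3 unfolding w_def[symmetric] by (simp only:)
qed auto

text \<open>The nodes are the extremal points of the Chebyshev polynomial carried over to
  [a^2, M^2]. There the transported polynomial \<open>Q\<close> takes the values (-1)^i, and the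
  Lagrange weights for extrapolation to 0 alternate in sign as well, so the sum of their absolute
  values is |Q(0)|.\<close>

lemma chebyshev_node_weights:
  fixes a M :: real and m :: nat
  assumes a: "0 < a" "a < M" and m: "m \<ge> 1"
  shows "\<exists>y l :: nat \<Rightarrow> real. (\<forall>i\<le>m. a\<^sup>2 \<le> y i \<and> y i \<le> M\<^sup>2) \<and>
    (\<forall>P. degree P \<le> m \<longrightarrow> (\<Sum>i\<le>m. l i * poly P (y i)) = poly P 0) \<and>
    (\<Sum>i\<le>m. \<bar>l i\<bar>) \<le> ((M + a) / (M - a)) ^ m"
proof -
  define h0 where "h0 = (M\<^sup>2 + a\<^sup>2) / 2"
  define h1 where "h1 = (M\<^sup>2 - a\<^sup>2) / 2"
  have "a\<^sup>2 < M\<^sup>2" using a by (intro power_strict_mono) auto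
  then have h1: "h1 > 0" by (simp add: h1_def)
  define c where "c i = cos (i * (pi / m))" for i :: nat
  define y where "y i = h0 + h1 * c i" for i :: nat
  have c: "-1 \<le> c i" "c i \<le> 1" for i by (simp_all add: c_def)
  have y: "a\<^sup>2 \<le> y i \<and> y i \<le> M\<^sup>2" for i
  proof -
    have "h1 * -1 \<le> h1 * c i" "h1 * c i \<le> h1 * 1" using c h1 by (intro mult_left_mono; simp)+
    moreover have "h0 - h1 = a\<^sup>2" "h0 + h1 = M\<^sup>2" by (simp_all add: h0_def h1_def field_simps)
    ultimately show ?thesis unfolding y_def by linarith
  qed
  have y0: "y i > 0" for i using y[of i] a by (meson less_le_trans zero_less_power)
  have less: "y j < y i" if "i < j" "j \<le> m" for i j
  proof -
    have "real j * (pi / m) \<le> real m * (pi / m)" using that by (intro mult_right_mono) auto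
    moreover have "real i * (pi / m) < real j * (pi / m)" using that m by (intro mult_strict_right_mono) auto
    ultimately have "cos (j * (pi / m)) < cos (i * (pi / m))"
      using m by (intro cos_monotone_0_pi) auto
    then show ?thesis using h1 by (simp add: y_def c_def)
  qed
  then have inj: "inj_on y {..m}"
    by (intro linorder_inj_onI') (metis atMost_iff less_irrefl)
  define t where "t i j = y j / (y j - y i)" for i j
  define l where "l i = (\<Prod>j\<in>{..m}-{i}. (0 - y j) / (y i - y j))" for i
  have lt: "l i = (\<Prod>j\<in>{..m}-{i}. t i j)" for i
    unfolding l_def t_def by (intro prod.cong refl) (metis diff_0 minus_diff_eq minus_divide_divide)
  have lagr: "(\<Sum>i\<le>m. l i * poly P (y i)) = poly P 0" if "degree P \<le> m" for P
    using lagrange_interpolation_eval[OF inj that, of 0] by (simp add: l_def mult.commute)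
  \<comment> \<open>The nodes decrease in the index, so exactly the m - i factors with j > i are
    negative.\<close>
  have abs_l: "\<bar>l i\<bar> = (-1) ^ m * ((-1) ^ i * l i)" if i: "i \<le> m" for i
  proof -
    have "\<bar>l i\<bar> = (\<Prod>j\<in>{..m}-{i}. \<bar>t i j\<bar>)" by (simp add: lt abs_prod)
    also have "\<dots> = (\<Prod>j\<in>{..m}-{i}. t i j * (if i < j then -1 else 1))"
    proof (intro prod.cong refl)
      fix j assume j: "j \<in> {..m} - {i}"
      show "\<bar>t i j\<bar> = t i j * (if i < j then -1 else 1)"
      proof (cases "i < j")
        case True
        then have "y j - y i < 0" using less[of i j] j by auto
        then have "t i j < 0" unfolding t_def using y0[of j] by (rule divide_pos_neg[rotated])
        then show ?thesis using True by simp
      next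
        case False
        then have "y j - y i > 0" using less[of j i] j i by auto
        then have "t i j > 0" unfolding t_def using y0[of j] by simp
        then show ?thesis using False by simp
      qed
    qed
    also have "\<dots> = l i * (\<Prod>j\<in>{..m}-{i}. if i < j then -1 else 1)" by (simp add: prod.distrib lt)
    also have "(\<Prod>j\<in>{..m}-{i}. if i < j then -1 else 1 :: real) = (\<Prod>j\<in>{j\<in>{..m}-{i}. i < j}. -1)"
      by (subst prod.inter_filter) auto
    also have "{j\<in>{..m}-{i}. i < j} = {i<..m}" by auto
    also have "(\<Prod>j\<in>{i<..m}. -1 :: real) = (-1) ^ (m - i)" by simp
    also have "(-1 :: real) ^ (m - i) = (-1) ^ m * (-1) ^ i"
    proof -
      have "(-1 :: real) ^ m = (-1) ^ i * (-1) ^ (m - i)" using i by (simp flip: power_add)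
      moreover have "(-1 :: real) ^ i * (-1) ^ i = 1" by (simp flip: power_mult_distrib)
      ultimately show ?thesis by (simp add: mult_ac)
    qed
    finally show ?thesis by (simp add: mult_ac)
  qed
  define Q where "Q = pcompose (chebyshev m) [:- h0 / h1, 1 / h1:]"
  have Qdeg: "degree Q \<le> m"
  proof -
    have "degree Q \<le> degree (chebyshev m) * degree [:- h0 / h1, 1 / h1:]"
      unfolding Q_def by (rule degree_pcompose_le)
    also have "\<dots> \<le> m" using degree_chebyshev[of m] by simp
    finally show ?thesis .
  qed
  have Qy: "poly Q (y i) = (-1) ^ i" for i
  proof -
    have "poly Q (y i) = poly (chebyshev m) (c i)"
      using h1 by (simp add: Q_def poly_pcompose y_def field_simps)
    also have "\<dots> = cos (i * pi)" using m by (simp add: c_def chebyshev_cos field_simps)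
    finally show ?thesis by (simp add: cos_npi mult.commute)
  qed
  \<comment> \<open>The Joukowski parameter of -h0/h1, the image of 0 under the rescaling; it is
    negative because 0 lies below all nodes.\<close>
  define z where "z = - ((M + a) / (M - a))"
  have z: "\<bar>z\<bar> \<ge> 1" "\<bar>z\<bar> = (M + a) / (M - a)" "z \<noteq> 0" using a by (auto simp: z_def)
  have "(\<Sum>i\<le>m. \<bar>l i\<bar>) = (\<Sum>i\<le>m. (-1) ^ m * (l i * poly Q (y i)))"
    by (intro sum.cong) (auto simp: abs_l Qy)
  also have "\<dots> = (-1) ^ m * (\<Sum>i\<le>m. l i * poly Q (y i))"
    by (simp add: sum_distrib_left)
  also have "\<dots> = (-1) ^ m * poly Q 0" by (simp add: lagr[OF Qdeg])
  also have "poly Q 0 = poly (chebyshev m) ((z + 1 / z) / 2)"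
  proof -
    have e: "- (h0 / h1) = (z + 1 / z) / 2"
      using a h1 by (simp add: z_def h0_def h1_def field_simps power2_eq_square)
    show ?thesis by (simp add: Q_def poly_pcompose) (simp only: e)
  qed
  also have "\<dots> = (z ^ m + (1 / z) ^ m) / 2" by (rule chebyshev_joukowski[OF z(3)])
  finally have "(\<Sum>i\<le>m. \<bar>l i\<bar>) = (-1) ^ m * ((z ^ m + (1 / z) ^ m) / 2)" .
  also have "\<dots> \<le> \<bar>(-1) ^ m * ((z ^ m + (1 / z) ^ m) / 2)\<bar>" by (rule abs_ge_self)
  also have "\<dots> = \<bar>z ^ m + (1 / z) ^ m\<bar> / 2" by (simp add: abs_mult power_abs)
  also have "\<dots> \<le> (\<bar>z\<bar> ^ m + \<bar>1 / z\<bar> ^ m) / 2"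
    using abs_triangle_ineq[of "z ^ m" "(1 / z) ^ m"] by (simp add: power_abs)
  also have "\<bar>1 / z\<bar> ^ m \<le> \<bar>z\<bar> ^ m"
  proof -
    have "\<bar>1 / z\<bar> \<le> 1" using z(1) by (simp add: divide_le_eq_1)
    then have "\<bar>1 / z\<bar> ^ m \<le> 1" by (intro power_le_one) auto
    also have "1 \<le> \<bar>z\<bar> ^ m" using z(1) by (rule one_le_power)
    finally show ?thesis .
  qed
  finally have "(\<Sum>i\<le>m. \<bar>l i\<bar>) \<le> ((M + a) / (M - a)) ^ m" using z(2) by simp
  then show ?thesis using y lagr by blast
qed

text \<open>The difference of the two priors is a multiple of \<open>\<delta>\<^sub>0 - \<Sum>\<^sub>i l\<^sub>i (\<delta>\<^bsub>x\<^sub>i\<^esub> + \<delta>\<^bsub>-x\<^sub>i\<^esub>) / 2\<close>, with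
  \<open>x\<^sub>i\<^sup>2\<close> the Chebyshev nodes on \<open>[a\<^sup>2, M\<^sup>2]\<close> and \<open>l\<^sub>i\<close> the Lagrange weights for extrapolation to \<open>0\<close>.\<close>

lemma moment_matching_priors:
  fixes a M \<kappa> \<delta> N :: real and m :: nat
  assumes a: "0 < a" "a < M" and m: "m \<ge> 1" and \<delta>: "\<delta> > 0" and N: "\<kappa> + \<delta> \<le> N"
    and growth: "((M + a) / (M - a)) ^ m \<le> 1 + 2 * \<kappa> / \<delta>"
  shows "\<exists>(T :: (nat \<times> bool) option set) val \<mu> \<nu> \<kappa>'. finite T \<and>
    (\<forall>t\<in>T. 0 \<le> \<mu> t \<and> 0 \<le> \<nu> t \<and> \<bar>val t\<bar> \<le> M \<and> (val t = 0 \<or> a \<le> \<bar>val t\<bar>)) \<and>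
    (\<Sum>t\<in>T. \<mu> t) = 1 \<and> (\<Sum>t\<in>T. \<nu> t) = 1 \<and>
    (\<forall>l<2 * m + 2. (\<Sum>t\<in>T. (\<mu> t - \<nu> t) * val t ^ l) = 0) \<and>
    (\<Sum>t\<in>T. \<mu> t * of_bool (val t \<noteq> 0)) = \<kappa>' / N \<and> (\<Sum>t\<in>T. \<nu> t * of_bool (val t \<noteq> 0)) = (\<kappa>' + \<delta>) / N \<and>
    0 \<le> \<kappa>' \<and> \<kappa>' \<le> \<kappa>"
proof -
  obtain y l :: "nat \<Rightarrow> real" where y: "\<And>i. i \<le> m \<Longrightarrow> a\<^sup>2 \<le> y i" "\<And>i. i \<le> m \<Longrightarrow> y i \<le> M\<^sup>2"
    and lagr: "\<And>P. degree P \<le> m \<Longrightarrow> (\<Sum>i\<le>m. l i * poly P (y i)) = poly P 0"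
    and l: "(\<Sum>i\<le>m. \<bar>l i\<bar>) \<le> ((M + a) / (M - a)) ^ m"
    using chebyshev_node_weights[OF a m] by blast
  define \<Lambda> where "\<Lambda> = (\<Sum>i\<le>m. \<bar>l i\<bar>)"
  have l1: "(\<Sum>i\<le>m. l i) = 1" using lagr[of 1] by simp
  have \<Lambda>1: "1 \<le> \<Lambda>" unfolding \<Lambda>_def using l1 by (metis abs_ge_self sum_mono)
  \<comment> \<open>As the weights sum to 1, their positive part has mass (\<Lambda> + 1)/2 and
    their negative part (\<Lambda> - 1)/2. Scaled by \<delta>, the latter is
    \<open>\<kappa>'\<close> and the former \<open>\<kappa>' + \<delta>\<close>;
    \<open>growth\<close> then yields \<open>\<kappa>' \<le> \<kappa>\<close>.\<close>
  define \<kappa>' where "\<kappa>' = \<delta> * (\<Lambda> - 1) / 2"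
  have \<kappa>'0: "0 \<le> \<kappa>'" using \<Lambda>1 \<delta> by (simp add: \<kappa>'_def)
  have "\<Lambda> \<le> 1 + 2 * \<kappa> / \<delta>" using l growth unfolding \<Lambda>_def by linarith
  then have "\<delta> * (\<Lambda> - 1) / 2 \<le> \<delta> * (2 * \<kappa> / \<delta>) / 2" using \<delta> by (intro divide_right_mono mult_left_mono) auto
  then have \<kappa>': "\<kappa>' \<le> \<kappa>" using \<delta> by (simp add: \<kappa>'_def)
  have Np: "N > 0" "\<kappa>' + \<delta> \<le> N" using N \<kappa>' \<kappa>'0 \<delta> by linarith+
  \<comment> \<open>\<open>None\<close> is the atom at 0, \<open>Some (i, b)\<close> the atom of
    sign b at distance sqrt (y i). \<open>\<mu>\<close> carries the negative parts of the weights
    and \<open>\<nu>\<close> the positive ones; 1/4 is 1/2 for taking the part times 1/2 for the two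
    signs.\<close>
  define T :: "(nat \<times> bool) option set" where "T = insert None (Some ` ({..m} \<times> UNIV))"
  define val :: "(nat \<times> bool) option \<Rightarrow> real" where
    "val t = (case t of None \<Rightarrow> 0 | Some (i, b) \<Rightarrow> (if b then 1 else -1) * sqrt (y i))" for t
  define \<mu> :: "(nat \<times> bool) option \<Rightarrow> real" where
    "\<mu> t = (case t of None \<Rightarrow> 1 - \<kappa>' / N | Some (i, b) \<Rightarrow> \<delta> / N * (\<bar>l i\<bar> - l i) / 4)" for t
  define \<nu> :: "(nat \<times> bool) option \<Rightarrow> real" where
    "\<nu> t = (case t of None \<Rightarrow> 1 - (\<kappa>' + \<delta>) / N | Some (i, b) \<Rightarrow> \<delta> / N * (\<bar>l i\<bar> + l i) / 4)" for t
  let ?m = "\<lambda>i. \<delta> / N * (\<bar>l i\<bar> - l i) / 4" and ?q = "\<lambda>i. \<delta> / N * (\<bar>l i\<bar> + l i) / 4"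
  have sumT: "(\<Sum>t\<in>T. f t) = f None + (\<Sum>i\<le>m. f (Some (i, True)) + f (Some (i, False)))" for f :: "_ \<Rightarrow> real"
  proof -
    have "(\<Sum>t\<in>T. f t) = f None + (\<Sum>t\<in>Some ` ({..m} \<times> UNIV). f t)"
      unfolding T_def by (intro sum.insert) (auto intro: finite_cartesian_product)
    also have "(\<Sum>t\<in>Some ` ({..m} \<times> UNIV). f t) = (\<Sum>t\<in>{..m} \<times> UNIV. f (Some t))"
      by (subst sum.reindex) auto
    also have "\<dots> = (\<Sum>i\<le>m. \<Sum>b\<in>UNIV. f (Some (i, b)))"
      by (simp add: sum.cartesian_product split_def)
    finally show ?thesis by (simp add: UNIV_bool add.commute)
  qed
  have sy: "sqrt (y i) > 0" "a \<le> sqrt (y i)" "sqrt (y i) \<le> M" if "i \<le> m" for i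
  proof -
    show "a \<le> sqrt (y i)" using y(1)[OF that] by (rule real_le_rsqrt)
    then show "sqrt (y i) > 0" using a by linarith
    show "sqrt (y i) \<le> M" using y(2)[OF that] a by (intro real_le_lsqrt) auto
  qed
  have half: "(\<Sum>i\<le>m. ?m i + ?m i) = \<kappa>' / N"
    "(\<Sum>i\<le>m. ?q i + ?q i) = (\<kappa>' + \<delta>) / N"
  proof -
    have h: "c * (u - v) / 4 + c * (u - v) / 4 = c / 2 * u - c / 2 * v"
      "c * (u + v) / 4 + c * (u + v) / 4 = c / 2 * u + c / 2 * v" for c u v :: real
      by (simp_all add: field_simps)
    have "(\<Sum>i\<le>m. ?m i + ?m i) = (\<Sum>i\<le>m. \<delta> / N / 2 * \<bar>l i\<bar> - \<delta> / N / 2 * l i)"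
      by (simp only: h)
    also have "\<dots> = \<delta> / N / 2 * \<Lambda> - \<delta> / N / 2 * 1"
      unfolding sum_subtractf sum_distrib_left[symmetric] l1 \<Lambda>_def ..
    also have "\<dots> = \<kappa>' / N"
      using Np by (simp add: \<kappa>'_def field_simps)
    finally show "(\<Sum>i\<le>m. ?m i + ?m i) = \<kappa>' / N" .
    have "(\<Sum>i\<le>m. ?q i + ?q i) = (\<Sum>i\<le>m. \<delta> / N / 2 * \<bar>l i\<bar> + \<delta> / N / 2 * l i)"
      by (simp only: h)
    also have "\<dots> = \<delta> / N / 2 * \<Lambda> + \<delta> / N / 2 * 1"
      unfolding sum.distrib sum_distrib_left[symmetric] l1 \<Lambda>_def ..
    also have "\<dots> = (\<kappa>' + \<delta>) / N"
      using \<delta> Np by (simp add: \<kappa>'_def field_simps)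
    finally show "(\<Sum>i\<le>m. ?q i + ?q i) = (\<kappa>' + \<delta>) / N" .
  qed
  \<comment> \<open>Odd moments vanish by symmetry. The even one of order 2 r is the extrapolation
    identity for the monomial of degree r \<le> m; the factor 0^k, which is 1 at k = 0, comes from
    the atom at 0.\<close>
  have mom: "(\<Sum>t\<in>T. (\<mu> t - \<nu> t) * val t ^ k) = 0" if k: "k < 2 * m + 2" for k
  proof -
    have "(\<Sum>t\<in>T. (\<mu> t - \<nu> t) * val t ^ k) = \<delta> / N * 0 ^ k + (\<Sum>i\<le>m. - (\<delta> / N / 2) * (l i * (sqrt (y i) ^ k + (- sqrt (y i)) ^ k)))"
      unfolding sumT
    proof (intro arg_cong2[where f="(+)"] sum.cong refl)
      show "(\<mu> None - \<nu> None) * val None ^ k = \<delta> / N * 0 ^ k"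
        by (simp add: \<mu>_def \<nu>_def val_def add_divide_distrib)
      show "(\<mu> (Some (i, True)) - \<nu> (Some (i, True))) * val (Some (i, True)) ^ k +
         (\<mu> (Some (i, False)) - \<nu> (Some (i, False))) * val (Some (i, False)) ^ k =
         - (\<delta> / N / 2) * (l i * (sqrt (y i) ^ k + (- sqrt (y i)) ^ k))" for i
        using Np by (simp add: \<mu>_def \<nu>_def val_def field_simps)
    qed
    also have "\<dots> = \<delta> / N * 0 ^ k - \<delta> / N / 2 * (\<Sum>i\<le>m. l i * (sqrt (y i) ^ k + (- sqrt (y i)) ^ k))"
      by (simp only: sum_distrib_left[symmetric])
    also have "\<dots> = 0"
    proof (cases "even k")
      case False
      then show ?thesis by (auto simp: zero_power odd_pos)
    next
      case True
      then obtain r where r: "k = 2 * r" by auto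
      then have rm: "r \<le> m" using k by simp
      have "(\<Sum>i\<le>m. l i * (sqrt (y i) ^ k + (- sqrt (y i)) ^ k)) = (\<Sum>i\<le>m. 2 * (l i * poly (monom 1 r) (y i)))"
      proof (intro sum.cong refl)
        fix i assume i: "i \<in> {..m}"
        then have "sqrt (y i) ^ k = y i ^ r" "(- sqrt (y i)) ^ k = y i ^ r"
          using sy(1)[of i] by (simp_all add: r power_mult)
        then show "l i * (sqrt (y i) ^ k + (- sqrt (y i)) ^ k) = 2 * (l i * poly (monom 1 r) (y i))"
          by (simp add: poly_monom)
      qed
      also have "\<dots> = 2 * poly (monom 1 r) 0"
        unfolding sum_distrib_left[symmetric] using rm by (subst lagr) (auto intro: order_trans[OF degree_monom_le])
      finally show ?thesis by (simp add: r poly_monom power_0_left)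
    qed
    finally show ?thesis .
  qed
  have "\<forall>l<2 * m + 2. (\<Sum>t\<in>T. (\<mu> t - \<nu> t) * val t ^ l) = 0" using mom by blast
  moreover have "\<forall>t\<in>T. 0 \<le> \<mu> t \<and> 0 \<le> \<nu> t \<and> \<bar>val t\<bar> \<le> M \<and> (val t = 0 \<or> a \<le> \<bar>val t\<bar>)"
  proof
    fix t assume t: "t \<in> T"
    show "0 \<le> \<mu> t \<and> 0 \<le> \<nu> t \<and> \<bar>val t\<bar> \<le> M \<and> (val t = 0 \<or> a \<le> \<bar>val t\<bar>)"
    proof (cases t)
      case None
      then show ?thesis using a Np \<delta> by (simp add: \<mu>_def \<nu>_def val_def)
    next
      case (Some ib)
      then obtain i b where ib: "t = Some (i, b)" "i \<le> m" using t by (cases ib) (auto simp: T_def)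
      have "\<bar>l i\<bar> - l i \<ge> 0" "\<bar>l i\<bar> + l i \<ge> 0" by linarith+
      then show ?thesis using ib sy[of i] Np \<delta>
        by (auto simp: \<mu>_def \<nu>_def val_def intro!: mult_nonneg_nonneg)
    qed
  qed
  moreover have "(\<Sum>t\<in>T. \<mu> t) = 1" "(\<Sum>t\<in>T. \<nu> t) = 1"
    unfolding sumT \<mu>_def \<nu>_def option.case prod.case half by simp_all
  moreover have "(\<Sum>t\<in>T. \<mu> t * of_bool (val t \<noteq> 0)) = \<kappa>' / N"
  proof -
    have "(\<Sum>t\<in>T. \<mu> t * of_bool (val t \<noteq> 0)) = (\<Sum>i\<le>m. ?m i + ?m i)"
    proof -
      have "\<mu> None * of_bool (val None \<noteq> 0) = 0" by (simp add: val_def)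
      moreover have "\<mu> (Some (i, b)) * of_bool (val (Some (i, b)) \<noteq> 0) = ?m i" if "i \<in> {..m}" for i b
        using sy(1)[of i] that by (simp add: val_def \<mu>_def)
      ultimately show ?thesis unfolding sumT by (simp only: cong: sum.cong)
    qed
    then show ?thesis using half(1) by simp
  qed
  moreover have "(\<Sum>t\<in>T. \<nu> t * of_bool (val t \<noteq> 0)) = (\<kappa>' + \<delta>) / N"
  proof -
    have "(\<Sum>t\<in>T. \<nu> t * of_bool (val t \<noteq> 0)) = (\<Sum>i\<le>m. ?q i + ?q i)"
    proof -
      have "\<nu> None * of_bool (val None \<noteq> 0) = 0" by (simp add: val_def)
      moreover have "\<nu> (Some (i, b)) * of_bool (val (Some (i, b)) \<noteq> 0) = ?q i" if "i \<in> {..m}" for i b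
        using sy(1)[of i] that by (simp add: val_def \<nu>_def)
      ultimately show ?thesis unfolding sumT by (simp only: cong: sum.cong)
    qed
    then show ?thesis using half(2) by simp
  qed
  moreover have "finite T" by (simp add: T_def finite_cartesian_product)
  moreover note \<kappa>' \<kappa>'0
  ultimately show ?thesis
    by (intro exI[of _ T] exI[of _ val] exI[of _ \<mu>] exI[of _ \<nu>] exI[of _ \<kappa>'] conjI)
qed

section \<open>Exchanging one coordinate at a time\<close>

text \<open>Expanding exp turns the double sum into a series of squared moments that starts only at
  order L. Inserting 10^(l - L) \<ge> 1 into the remaining terms and resumming trades a factor 10 in
  the exponent for the gain 10^(-L).\<close>

lemma moment_series_bound:
  fixes c v :: "'t \<Rightarrow> real"
  assumes T: "finite T" and M: "M > 0" "\<And>t. t \<in> T \<Longrightarrow> \<bar>v t\<bar> \<le> M" and R: "R \<ge> 0"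
    and V: "(\<Sum>t\<in>T. \<bar>c t\<bar>) \<le> V"
    and mom: "\<And>l. l < L \<Longrightarrow> (\<Sum>t\<in>T. c t * v t ^ l) = 0"
  shows "(\<Sum>t\<in>T. \<Sum>s\<in>T. c t * c s * exp (v t * v s * R)) \<le> V\<^sup>2 / 10 ^ L * exp (10 * M\<^sup>2 * R)"
proof -
  have V0: "V \<ge> 0" using V by (rule order_trans[rotated]) (auto intro: sum_nonneg)
  have "(\<lambda>l. \<Sum>t\<in>T. \<Sum>s\<in>T. c t * c s * ((v t * v s * R) ^ l /\<^sub>R fact l)) sums
      (\<Sum>t\<in>T. \<Sum>s\<in>T. c t * c s * exp (v t * v s * R))"
    by (intro sums_sum sums_mult exp_converges)
  moreover have "(\<Sum>t\<in>T. \<Sum>s\<in>T. c t * c s * ((v t * v s * R) ^ l /\<^sub>R fact l)) = R ^ l / fact l * (\<Sum>t\<in>T. c t * v t ^ l)\<^sup>2" for l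
    unfolding power2_eq_square sum_product
    by (simp add: sum_distrib_left power_mult_distrib divide_inverse mult_ac)
  ultimately have s1: "(\<lambda>l. R ^ l / fact l * (\<Sum>t\<in>T. c t * v t ^ l)\<^sup>2) sums
      (\<Sum>t\<in>T. \<Sum>s\<in>T. c t * c s * exp (v t * v s * R))" by simp
  have s2: "(\<lambda>l. V\<^sup>2 / 10 ^ L * ((10 * M\<^sup>2 * R) ^ l /\<^sub>R fact l)) sums (V\<^sup>2 / 10 ^ L * exp (10 * M\<^sup>2 * R))"
    by (intro sums_mult exp_converges)
  show ?thesis
  proof (rule sums_le[OF _ s1 s2])
    fix l
    show "R ^ l / fact l * (\<Sum>t\<in>T. c t * v t ^ l)\<^sup>2 \<le> V\<^sup>2 / 10 ^ L * ((10 * M\<^sup>2 * R) ^ l /\<^sub>R fact l)"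
    proof (cases "l < L")
      case True
      then show ?thesis using mom[OF True] R M by (auto intro!: mult_nonneg_nonneg divide_nonneg_nonneg)
    next
      case False
      have "\<bar>\<Sum>t\<in>T. c t * v t ^ l\<bar> \<le> (\<Sum>t\<in>T. \<bar>c t * v t ^ l\<bar>)" by (rule sum_abs)
      also have "\<dots> \<le> (\<Sum>t\<in>T. \<bar>c t\<bar> * M ^ l)"
        unfolding abs_mult power_abs by (intro sum_mono mult_left_mono power_mono M) auto
      also have "\<dots> = (\<Sum>t\<in>T. \<bar>c t\<bar>) * M ^ l" by (simp add: sum_distrib_right)
      also have "\<dots> \<le> V * M ^ l" using V M by (intro mult_right_mono) auto
      finally have "\<bar>\<Sum>t\<in>T. c t * v t ^ l\<bar>\<^sup>2 \<le> (V * M ^ l)\<^sup>2" by (intro power_mono) auto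
      then have "(\<Sum>t\<in>T. c t * v t ^ l)\<^sup>2 \<le> V\<^sup>2 * (M\<^sup>2) ^ l"
        by (simp add: power_mult_distrib power_mult[symmetric] mult.commute)
      also have "\<dots> \<le> V\<^sup>2 * (M\<^sup>2) ^ l * (10 ^ l / 10 ^ L)"
      proof -
        have "(1::real) \<le> 10 ^ l / 10 ^ L" using False by (simp add: power_increasing)
        then show ?thesis using mult_left_mono[of 1 "10 ^ l / 10 ^ L" "V\<^sup>2 * (M\<^sup>2) ^ l"] by simp
      qed
      finally have "R ^ l / fact l * (\<Sum>t\<in>T. c t * v t ^ l)\<^sup>2 \<le> R ^ l / fact l * (V\<^sup>2 * (M\<^sup>2) ^ l * (10 ^ l / 10 ^ L))"
        using R by (intro mult_left_mono) auto
      also have "\<dots> = V\<^sup>2 / 10 ^ L * ((10 * M\<^sup>2 * R) ^ l /\<^sub>R fact l)"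
        by (simp add: power_mult_distrib divide_inverse mult_ac)
      finally show ?thesis .
    qed
  qed
qed

section \<open>Likelihood ratios in a single coordinate\<close>

lemma nn_integral_exp_sq_std_gauss:
  assumes "l < 1 / 2"
  shows "(\<integral>\<^sup>+z. ennreal (exp (l * z\<^sup>2)) \<partial>std_gauss) = ennreal (1 / sqrt (1 - 2 * l))"
proof -
  define s where "s = 1 / sqrt (1 - 2 * l)"
  have s: "s > 0" "s\<^sup>2 = 1 / (1 - 2 * l)" using assms by (auto simp: s_def power_divide)
  have eq: "std_normal_density z * exp (l * z\<^sup>2) = s * gauss s z" for z
  proof -
    have "exp (- (z - 0)\<^sup>2 / (2 * s\<^sup>2)) = exp (- z\<^sup>2 / 2) * exp (l * z\<^sup>2)"
      unfolding exp_add[symmetric] s(2) using assms by (simp add: field_simps)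
    moreover have "sqrt (2 * pi * s\<^sup>2) = sqrt (2 * pi) * s" using s(1) by (simp add: real_sqrt_mult)
    ultimately show ?thesis using s(1) by (simp add: normal_density_def)
  qed
  have "(\<integral>\<^sup>+z. ennreal (exp (l * z\<^sup>2)) \<partial>std_gauss) = (\<integral>\<^sup>+z. ennreal (std_normal_density z) * ennreal (exp (l * z\<^sup>2)) \<partial>lborel)"
    by (intro nn_integral_std_gauss) auto
  also have "\<dots> = (\<integral>\<^sup>+z. ennreal s * ennreal (gauss s z) \<partial>lborel)"
    using s by (intro nn_integral_cong) (simp add: ennreal_mult'[symmetric] eq)
  also have "\<dots> = ennreal s"
    using s by (subst nn_integral_cmult) (auto simp: nn_integral_normal_density)
  finally show ?thesis by (simp add: s_def)
qed

text \<open>The only feature of the design that survives in the kernel when a single coordinate of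
  \<theta> varies; its law is chi-square with n degrees of freedom.\<close>

definition col_sq :: "nat \<Rightarrow> nat \<Rightarrow> (nat \<times> nat \<Rightarrow> real) \<Rightarrow> real" where
  "col_sq n j x = (\<Sum>i<n. (x (i, j))\<^sup>2)"

lemma measurable_col_sq [measurable]:
  "j < p \<Longrightarrow> (\<lambda>\<omega>. col_sq n j (snd \<omega>)) \<in> borel_measurable (obs_space n p)"
  unfolding col_sq_def obs_space_def by measurable

lemma nn_integral_exp_col_sq:
  assumes j: "j < p" and l: "l < 1 / 2"
  shows "(\<integral>\<^sup>+\<omega>. ennreal (exp (l * col_sq n j (snd \<omega>))) \<partial>noise_law n p) = ennreal ((1 / sqrt (1 - 2 * l)) ^ n)"
proof -
  let ?X = "gauss_prod ({..<n} \<times> {..<p})"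
  interpret X: prob_space ?X by (rule prob_space_PiM_std_gauss)
  interpret E: prob_space "PiM {..<n} (\<lambda>_::nat. std_gauss)" by (rule prob_space_PiM_std_gauss)
  interpret S: prob_space std_gauss by (rule prob_space_std_gauss)
  define g where "g k z = (if snd k = j then ennreal (exp (l * z\<^sup>2)) else 1)" for k :: "nat \<times> nat" and z :: real
  have prod: "ennreal (exp (l * col_sq n j x)) = (\<Prod>k\<in>{..<n} \<times> {..<p}. g k (x k))" for x
  proof -
    have "(\<Prod>k\<in>{..<n} \<times> {..<p}. g k (x k)) = (\<Prod>i<n. \<Prod>k<p. g (i, k) (x (i, k)))"
      by (simp add: prod.cartesian_product split_def)
    also have "\<dots> = (\<Prod>i<n. ennreal (exp (l * (x (i, j))\<^sup>2)))"
      using j by (intro prod.cong) (auto simp: g_def prod.delta)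
    also have "\<dots> = ennreal (exp (l * col_sq n j x))"
      by (simp add: prod_ennreal col_sq_def exp_sum[symmetric] sum_distrib_left)
    finally show ?thesis by simp
  qed
  have m: "(\<lambda>\<omega>. ennreal (exp (l * col_sq n j (snd \<omega>)))) \<in> borel_measurable (noise_law n p)"
    unfolding measurable_cong_sets[OF sets_noise_law refl] using j by measurable
  have "(\<integral>\<^sup>+\<omega>. ennreal (exp (l * col_sq n j (snd \<omega>))) \<partial>noise_law n p)
    = (\<integral>\<^sup>+e. \<integral>\<^sup>+x. ennreal (exp (l * col_sq n j (snd (e, x)))) \<partial>?X \<partial>gauss_prod {..<n})"
    using m unfolding noise_law_def by (intro X.nn_integral_fst[symmetric])
  also have "\<dots> = (\<integral>\<^sup>+x. (\<Prod>k\<in>{..<n} \<times> {..<p}. g k (x k)) \<partial>?X)"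
    using E.emeasure_space_1 by (simp add: prod)
  also have "\<dots> = (\<Prod>k\<in>{..<n} \<times> {..<p}. \<integral>\<^sup>+z. g k z \<partial>std_gauss)"
    by (intro product_sigma_finite.product_nn_integral_prod[OF psf_std_gauss]) (auto simp: g_def)
  also have "\<dots> = (\<Prod>i<n. \<Prod>k<p. if k = j then ennreal (1 / sqrt (1 - 2 * l)) else 1)"
  proof -
    have h: "(\<integral>\<^sup>+z. g k z \<partial>std_gauss) = (if snd k = j then ennreal (1 / sqrt (1 - 2 * l)) else 1)" for k
      using S.emeasure_space_1 by (simp add: g_def nn_integral_exp_sq_std_gauss[OF l])
    show ?thesis unfolding h prod.cartesian_product by (intro prod.cong) auto
  qed
  also have "\<dots> = ennreal ((1 / sqrt (1 - 2 * l)) ^ n)"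
    using j l by (simp add: ennreal_power prod.delta)
  finally show ?thesis .
qed

lemma design_mult_upd:
  assumes "j < p"
  shows "design_mult p (\<theta>(j := t)) x i = design_mult p (\<theta>(j := 0)) x i + t * x (i, j)"
proof -
  have "design_mult p (\<theta>(j := t)) x i = (\<Sum>k<p. x (i, k) * (\<theta>(j := 0)) k + (if k = j then t * x (i, j) else 0))"
    unfolding design_mult_def by (intro sum.cong) auto
  also have "\<dots> = design_mult p (\<theta>(j := 0)) x i + t * x (i, j)"
    using assms by (simp add: sum.distrib design_mult_def)
  finally show ?thesis .
qed

text \<open>Completing the square in the j-th coordinate: the ratio is again a likelihood, at t + s,
  tilted by a function of the design alone. Its integral is a Laplace transform of
  \<open>col_sq\<close> whatever the other coordinates are, since the law of the design does not
  depend on \<theta>.\<close>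

lemma lik_upd_mult:
  assumes "j < p"
  shows "lik n p (\<theta>(j := t)) \<omega> * lik n p (\<theta>(j := s)) \<omega> / lik n p (\<theta>(j := 0)) \<omega>
    = exp (t * s * col_sq n j (snd \<omega>)) * lik n p (\<theta>(j := t + s)) \<omega>"
proof -
  obtain y x where \<omega>: "\<omega> = (y, x)" by (cases \<omega>)
  have one: "normal_density (u + t * z) 1 v * normal_density (u + s * z) 1 v / normal_density u 1 v
    = exp (t * s * z\<^sup>2) * normal_density (u + (t + s) * z) 1 v" for u z v :: real
  proof -
    define k where "k = 1 / sqrt (2 * pi)"
    have k: "k \<noteq> 0" by (simp add: k_def)
    have E: "exp (- (v - (u + t * z))\<^sup>2 / 2) * exp (- (v - (u + s * z))\<^sup>2 / 2) = exp (- (v - u)\<^sup>2 / 2) * (exp (t * s * z\<^sup>2) * exp (- (v - (u + (t + s) * z))\<^sup>2 / 2))"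
      unfolding exp_add[symmetric] by (rule arg_cong[of _ _ exp]) (simp add: field_simps power2_eq_square)
    have nd: "normal_density u 1 v = k * exp (- (v - u)\<^sup>2 / 2)" for u v by (simp add: normal_density_def k_def)
    have "(k * a) * (k * b) / (k * d) = e * (k * f)" if "a * b = d * (e * f)" "d \<noteq> 0" for a b d e f :: real
    proof -
      have "(k * a) * (k * b) = k * k * (a * b)" by simp
      then have *: "(k * a) * (k * b) = k * k * (d * (e * f))" unfolding that(1) .
      show ?thesis unfolding * using k that(2) by simp
    qed
    from this[OF E] show ?thesis unfolding nd by simp
  qed
  show ?thesis
    unfolding \<omega> lik_def prod.case snd_conv col_sq_def sum_distrib_left exp_sum[OF finite_lessThan]
      prod.distrib[symmetric] prod_dividef[symmetric]
    by (intro prod.cong refl) (simp add: design_mult_upd[OF assms, of \<theta> t] design_mult_upd[OF assms, of \<theta> s] design_mult_upd[OF assms, of \<theta> "t + s"] one)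
qed

text \<open>\<open>chi2_bound\<close> with \<open>d = 0\<close>, the other coordinates being frozen
  and the likelihood with 0 at position j serving as reference. \<open>small\<close> keeps 10 M^2
  below 1/2, where the Laplace transform of \<open>col_sq\<close> is finite.\<close>

lemma coordinate_swap_bound:
  fixes c v :: "'t \<Rightarrow> real"
  assumes T: "finite T" and M: "M > 0" "\<And>t. t \<in> T \<Longrightarrow> \<bar>v t\<bar> \<le> M" and small: "40 * M\<^sup>2 \<le> 1"
    and V: "(\<Sum>t\<in>T. \<bar>c t\<bar>) \<le> V"
    and mom: "\<And>l. l < L \<Longrightarrow> (\<Sum>t\<in>T. c t * v t ^ l) = 0" and j: "j < p"
    and \<psi>[measurable]: "\<psi> \<in> borel_measurable (obs_space n p)" and \<psi>01: "\<And>\<omega>. 0 \<le> \<psi> \<omega>" "\<And>\<omega>. \<psi> \<omega> \<le> 1"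
  shows "\<bar>\<Sum>t\<in>T. c t * mean_test n p (\<theta>(j := v t)) \<psi>\<bar> \<le> sqrt (V\<^sup>2 / 10 ^ L * exp (20 * real n * M\<^sup>2))"
proof -
  let ?r = "\<lambda>t s \<omega>. lik n p (\<theta>(j := v t)) \<omega> * lik n p (\<theta>(j := v s)) \<omega> / lik n p (\<theta>(j := 0)) \<omega>"
  define R where "R \<omega> = col_sq n j (snd \<omega>)" for \<omega> :: obs
  have R0: "R \<omega> \<ge> 0" for \<omega> unfolding R_def col_sq_def by (intro sum_nonneg) auto
  have Rm[measurable]: "R \<in> borel_measurable (obs_space n p)" unfolding R_def using j by measurable
  have prodM: "v t * v s \<le> M\<^sup>2" if "t \<in> T" "s \<in> T" for t s
  proof -
    have "v t * v s \<le> \<bar>v t\<bar> * \<bar>v s\<bar>" by (simp flip: abs_mult)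
    also have "\<dots> \<le> M * M" using M that by (intro mult_mono) auto
    finally show ?thesis by (simp add: power2_eq_square)
  qed
  define K where "K l = (1 / sqrt (1 - 2 * l)) ^ n" for l :: real
  have K: "(\<integral>\<^sup>+\<omega>. ennreal (exp (l * R \<omega>)) \<partial>noise_law n p) = ennreal (K l)" and K0: "0 \<le> K l" if "l < 1 / 2" for l
    using nn_integral_exp_col_sq[OF j that, of n] that by (simp_all add: R_def K_def)
  have HK: "has_bochner_integral (noise_law n p) (\<lambda>\<omega>. exp (l * R \<omega>)) (K l)" if "l < 1 / 2" for l
    using K[OF that] K0[OF that] by (intro has_bochner_integral_nn_integral)
      (auto simp: measurable_cong_sets[OF sets_noise_law refl])
  have half: "v t * v s < 1 / 2" if "t \<in> T" "s \<in> T" for t s using prodM[OF that] small by linarith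
  have "\<bar>(\<Sum>t\<in>T. c t * (\<integral>\<omega>. \<psi> \<omega> * lik n p (\<theta>(j := v t)) \<omega> \<partial>base_measure n p)) - 0 * (\<integral>\<omega>. \<psi> \<omega> * lik n p (\<theta>(j := 0)) \<omega> \<partial>base_measure n p)\<bar>
    \<le> sqrt ((\<Sum>t\<in>T. \<Sum>s\<in>T. c t * c s * K (v t * v s)) - 2 * 0 * (\<Sum>t\<in>T. c t) + 0\<^sup>2)"
  proof (rule chi2_bound[OF T])
    fix t s assume ts: "t \<in> T" "s \<in> T"
    have "(\<integral>\<^sup>+\<omega>. ennreal (?r t s \<omega>) \<partial>base_measure n p)
      = (\<integral>\<^sup>+\<omega>. ennreal (exp (v t * v s * R \<omega>)) * ennreal (lik n p (\<theta>(j := v t + v s)) \<omega>) \<partial>base_measure n p)"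
      by (simp add: lik_upd_mult[OF j] R_def ennreal_mult')
    also have "\<dots> = (\<integral>\<^sup>+(e, x). ennreal (exp (v t * v s * R (\<lambda>i\<in>{..<n}. design_mult p (\<theta>(j := v t + v s)) x i + e i, x))) \<partial>noise_law n p)"
      by (rule nn_integral_lik[symmetric]) measurable
    also have "\<dots> = (\<integral>\<^sup>+\<omega>. ennreal (exp (v t * v s * R \<omega>)) \<partial>noise_law n p)"
      by (simp add: R_def split_def)
    also have "\<dots> = ennreal (K (v t * v s))" by (rule K[OF half[OF ts]])
    finally show "(\<integral>\<^sup>+\<omega>. ennreal (?r t s \<omega>) \<partial>base_measure n p) = ennreal (K (v t * v s))" .
    show "0 \<le> K (v t * v s)" by (rule K0[OF half[OF ts]])
  qed (use \<psi>01 in \<open>auto simp: lik_nonneg lik_pos nn_integral_lik_1 intro!: measurable_obs_base\<close>)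
  then have "\<bar>\<Sum>t\<in>T. c t * mean_test n p (\<theta>(j := v t)) \<psi>\<bar> \<le> sqrt (\<Sum>t\<in>T. \<Sum>s\<in>T. c t * c s * K (v t * v s))"
    by (simp add: mean_test_lik[OF \<psi> \<psi>01(1)])
  also have "(\<Sum>t\<in>T. \<Sum>s\<in>T. c t * c s * K (v t * v s)) \<le> V\<^sup>2 / 10 ^ L * exp (20 * real n * M\<^sup>2)"
  proof -
    have l10: "10 * M\<^sup>2 < 1 / 2" using small by linarith
    have H1: "has_bochner_integral (noise_law n p) (\<lambda>\<omega>. \<Sum>t\<in>T. \<Sum>s\<in>T. c t * c s * exp (v t * v s * R \<omega>))
      (\<Sum>t\<in>T. \<Sum>s\<in>T. c t * c s * K (v t * v s))"
      by (intro has_bochner_integral_sum has_bochner_integral_mult_right HK half)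
    have H2: "has_bochner_integral (noise_law n p) (\<lambda>\<omega>. V\<^sup>2 / 10 ^ L * exp (10 * M\<^sup>2 * R \<omega>)) (V\<^sup>2 / 10 ^ L * K (10 * M\<^sup>2))"
      by (intro has_bochner_integral_mult_right HK l10)
    have "(\<Sum>t\<in>T. \<Sum>s\<in>T. c t * c s * K (v t * v s)) \<le> V\<^sup>2 / 10 ^ L * K (10 * M\<^sup>2)"
      using H1 H2 moment_series_bound[OF T M R0 V mom]
      by (metis (no_types, lifting) has_bochner_integral_iff integral_mono)
    also have "K (10 * M\<^sup>2) \<le> exp (20 * real n * M\<^sup>2)"
    proof -
      define u where "u = 20 * M\<^sup>2"
      have u: "0 \<le> u" "u \<le> 1 / 2" using small by (auto simp: u_def)
      have "1 / (1 - u) \<le> 1 + 2 * u"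
        using u mult_nonneg_nonneg[of u "1 - 2 * u"] by (simp add: field_simps)
      also have "\<dots> \<le> exp (2 * u)" by (rule exp_ge_add_one_self)
      finally have "sqrt (1 / (1 - u)) \<le> sqrt (exp (2 * u))" by simp
      also have "sqrt (exp (2 * u)) = exp u" by (intro real_sqrt_unique) (auto simp: exp_double)
      finally have "(1 / sqrt (1 - u)) ^ n \<le> exp u ^ n"
        using u by (intro power_mono) (auto simp: real_sqrt_divide)
      then show ?thesis by (simp add: K_def u_def exp_of_nat_mult[symmetric] mult_ac)
    qed
    then have "V\<^sup>2 / 10 ^ L * K (10 * M\<^sup>2) \<le> V\<^sup>2 / 10 ^ L * exp (20 * real n * M\<^sup>2)"
      by (intro mult_left_mono) auto
    finally show ?thesis .
  qed
  finally show ?thesis by simp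
qed

section \<open>Product priors: telescoping and concentration\<close>

lemma sum_PiE_insert:
  fixes h :: "('i \<Rightarrow> 't) \<Rightarrow> real"
  assumes "j \<notin> J"
  shows "(\<Sum>\<tau>\<in>PiE (insert j J) (\<lambda>_. T). h \<tau>) = (\<Sum>t\<in>T. \<Sum>\<tau>\<in>PiE J (\<lambda>_. T). h (\<tau>(j := t)))"
proof -
  have "(\<Sum>\<tau>\<in>PiE (insert j J) (\<lambda>_. T). h \<tau>) = (\<Sum>(t, \<tau>)\<in>T \<times> PiE J (\<lambda>_. T). h (\<tau>(j := t)))"
    unfolding PiE_insert_eq using inj_combinator[OF assms, of "\<lambda>_. T"]
    by (subst sum.reindex) (auto simp: split_def)
  then show ?thesis by (simp add: sum.cartesian_product)
qed

lemma prod_upd_insert: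
  assumes "finite J" "j \<notin> J"
  shows "(\<Prod>i\<in>insert j J. f ((\<tau>(j := t)) i)) = f t * (\<Prod>i\<in>J. f (\<tau> i))"
  using assms by (auto intro!: arg_cong2[where f="(*)"] prod.cong)

lemma sum_prod_weights:
  fixes \<mu> :: "'t \<Rightarrow> real"
  assumes "finite J" "finite T" "(\<Sum>t\<in>T. \<mu> t) = 1"
  shows "(\<Sum>\<tau>\<in>PiE J (\<lambda>_. T). \<Prod>i\<in>J. \<mu> (\<tau> i)) = 1"
  using prod_sum_PiE[of J "\<lambda>_. T" "\<lambda>_. \<mu>"] assms by simp

text \<open>Telescoping over coordinates. \<open>swap\<close> is required for every frozen vector
  because, while one coordinate is exchanged, the others are already random, some under \<mu> and
  some under \<nu>.\<close>

lemma hybrid_bound: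
  fixes \<mu> \<nu> :: "'t \<Rightarrow> real" and G :: "('i \<Rightarrow> real) \<Rightarrow> real" and \<eta> :: real
  assumes J: "finite J" and T: "finite T"
    and \<mu>: "\<And>t. t \<in> T \<Longrightarrow> 0 \<le> \<mu> t" "(\<Sum>t\<in>T. \<mu> t) = 1" and \<nu>: "\<And>t. t \<in> T \<Longrightarrow> 0 \<le> \<nu> t" "(\<Sum>t\<in>T. \<nu> t) = 1"
    and swap: "\<And>\<theta> j. j \<in> J \<Longrightarrow> \<bar>\<Sum>t\<in>T. (\<mu> t - \<nu> t) * G (\<theta>(j := v t))\<bar> \<le> \<eta>"
  shows "\<bar>(\<Sum>\<tau>\<in>PiE J (\<lambda>_. T). (\<Prod>i\<in>J. \<mu> (\<tau> i)) * G (\<lambda>i. if i \<in> J then v (\<tau> i) else \<theta> i))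
      - (\<Sum>\<tau>\<in>PiE J (\<lambda>_. T). (\<Prod>i\<in>J. \<nu> (\<tau> i)) * G (\<lambda>i. if i \<in> J then v (\<tau> i) else \<theta> i))\<bar> \<le> card J * \<eta>"
  using J swap
proof (induction J arbitrary: \<theta> rule: finite_induct)
  case empty
  then show ?case by simp
next
  case (insert j J)
  define F where "F J \<theta> \<tau> = (\<lambda>i. if i \<in> J then v (\<tau> i) else \<theta> i)" for J \<theta> and \<tau> :: "'i \<Rightarrow> 't"
  let ?S = "PiE J (\<lambda>_. T)"
  have F1: "F (insert j J) \<theta> (\<tau>(j := t)) = F J (\<theta>(j := v t)) \<tau>" for \<tau> t
    using insert.hyps by (auto simp: F_def fun_eq_iff)
  have F2: "F J (\<theta>(j := v t)) \<tau> = (F J \<theta> \<tau>)(j := v t)" for \<tau> t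
    using insert.hyps by (auto simp: F_def fun_eq_iff)
  have exp: "(\<Sum>\<tau>\<in>PiE (insert j J) (\<lambda>_. T). (\<Prod>i\<in>insert j J. w (\<tau> i)) * G (F (insert j J) \<theta> \<tau>))
    = (\<Sum>t\<in>T. w t * (\<Sum>\<tau>\<in>?S. (\<Prod>i\<in>J. w (\<tau> i)) * G (F J (\<theta>(j := v t)) \<tau>)))" for w :: "'t \<Rightarrow> real"
    unfolding sum_PiE_insert[OF insert.hyps(2)] prod_upd_insert[OF insert.hyps] F1
    by (simp add: sum_distrib_left mult_ac)
  define A where "A w t = (\<Sum>\<tau>\<in>?S. (\<Prod>i\<in>J. w (\<tau> i)) * G (F J (\<theta>(j := v t)) \<tau>))" for w t
  have IH: "\<bar>A \<mu> t - A \<nu> t\<bar> \<le> card J * \<eta>" for t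
    unfolding A_def F_def by (rule insert.IH) (use insert.prems in auto)
  \<comment> \<open>The first term exchanges the coordinates of \<open>J\<close>, by induction and
    averaged over \<mu>; the second exchanges j, with \<open>J\<close> already under \<nu>.\<close>
  have "\<bar>(\<Sum>t\<in>T. \<mu> t * A \<mu> t) - (\<Sum>t\<in>T. \<nu> t * A \<nu> t)\<bar>
    = \<bar>(\<Sum>t\<in>T. \<mu> t * (A \<mu> t - A \<nu> t)) + (\<Sum>t\<in>T. (\<mu> t - \<nu> t) * A \<nu> t)\<bar>"
    by (simp add: sum.distrib[symmetric] sum_subtractf[symmetric] algebra_simps)
  also have "\<dots> \<le> card J * \<eta> + \<eta>"
  proof (rule order_trans[OF abs_triangle_ineq add_mono])
    have "\<bar>\<Sum>t\<in>T. \<mu> t * (A \<mu> t - A \<nu> t)\<bar> \<le> (\<Sum>t\<in>T. \<mu> t * \<bar>A \<mu> t - A \<nu> t\<bar>)"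
      by (rule order_trans[OF sum_abs]) (use \<mu> in \<open>auto simp: abs_mult\<close>)
    also have "\<dots> \<le> (\<Sum>t\<in>T. \<mu> t * (card J * \<eta>))" using \<mu> IH by (intro sum_mono mult_left_mono) auto
    also have "\<dots> = card J * \<eta>" using \<mu>(2) by (simp flip: sum_distrib_right)
    finally show "\<bar>\<Sum>t\<in>T. \<mu> t * (A \<mu> t - A \<nu> t)\<bar> \<le> card J * \<eta>" .
    have "(\<Sum>t\<in>T. (\<mu> t - \<nu> t) * A \<nu> t) = (\<Sum>\<tau>\<in>?S. (\<Prod>i\<in>J. \<nu> (\<tau> i)) * (\<Sum>t\<in>T. (\<mu> t - \<nu> t) * G ((F J \<theta> \<tau>)(j := v t))))"
      unfolding A_def F2 sum_distrib_left by (subst sum.swap) (simp add: mult_ac)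
    also have "\<bar>\<dots>\<bar> \<le> (\<Sum>\<tau>\<in>?S. \<bar>(\<Prod>i\<in>J. \<nu> (\<tau> i)) * (\<Sum>t\<in>T. (\<mu> t - \<nu> t) * G ((F J \<theta> \<tau>)(j := v t)))\<bar>)"
      by (rule sum_abs)
    also have "\<dots> \<le> (\<Sum>\<tau>\<in>?S. (\<Prod>i\<in>J. \<nu> (\<tau> i)) * \<eta>)"
    proof (intro sum_mono)
      fix \<tau> assume "\<tau> \<in> ?S"
      then have "0 \<le> (\<Prod>i\<in>J. \<nu> (\<tau> i))" using \<nu> by (intro prod_nonneg) (auto simp: PiE_iff)
      then show "\<bar>(\<Prod>i\<in>J. \<nu> (\<tau> i)) * (\<Sum>t\<in>T. (\<mu> t - \<nu> t) * G ((F J \<theta> \<tau>)(j := v t)))\<bar> \<le> (\<Prod>i\<in>J. \<nu> (\<tau> i)) * \<eta>"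
      proof -
        have "\<bar>\<Sum>t\<in>T. (\<mu> t - \<nu> t) * G ((F J \<theta> \<tau>)(j := v t))\<bar> \<le> \<eta>" by (rule insert.prems) simp
        then show ?thesis using \<open>0 \<le> (\<Prod>i\<in>J. \<nu> (\<tau> i))\<close> unfolding abs_mult by (simp only: abs_of_nonneg mult_left_mono)
      qed
    qed
    also have "\<dots> = \<eta>" using sum_prod_weights[OF insert.hyps(1) T \<nu>(2)] by (simp flip: sum_distrib_right)
    finally show "\<bar>\<Sum>t\<in>T. (\<mu> t - \<nu> t) * A \<nu> t\<bar> \<le> \<eta>" .
  qed
  finally show ?case
    using insert.hyps unfolding F_def[symmetric] exp A_def[symmetric] by (simp add: algebra_simps)
qed

text \<open>The offset c absorbs the deviation of the coordinate split off in the induction. Equal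
  first and second moments of X, as for an indicator, give the variance \<pi> - \<pi>^2 per
  coordinate.\<close>

lemma product_weights_variance:
  fixes \<mu> X :: "'t \<Rightarrow> real" and \<pi> c h :: real
  assumes J: "finite J" and T: "finite T" and \<mu>: "(\<Sum>t\<in>T. \<mu> t) = 1"
    and \<pi>: "(\<Sum>t\<in>T. \<mu> t * X t) = \<pi>" "(\<Sum>t\<in>T. \<mu> t * (X t)\<^sup>2) = \<pi>"
  shows "(\<Sum>\<tau>\<in>PiE J (\<lambda>_. T). (\<Prod>i\<in>J. \<mu> (\<tau> i)) * (c + (\<Sum>i\<in>J. X (\<tau> i) - \<pi>))\<^sup>2) = c\<^sup>2 + card J * (\<pi> - \<pi>\<^sup>2)"
  using J
proof (induction J arbitrary: c rule: finite_induct)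
  case empty
  then show ?case by simp
next
  case (insert j J)
  have s: "(\<Sum>i\<in>insert j J. X ((\<tau>(j := t)) i) - \<pi>) = (X t - \<pi>) + (\<Sum>i\<in>J. X (\<tau> i) - \<pi>)" for \<tau> t
    using insert.hyps by (auto intro!: sum.cong)
  have "(\<Sum>\<tau>\<in>PiE (insert j J) (\<lambda>_. T). (\<Prod>i\<in>insert j J. \<mu> (\<tau> i)) * (c + (\<Sum>i\<in>insert j J. X (\<tau> i) - \<pi>))\<^sup>2)
    = (\<Sum>t\<in>T. \<mu> t * (\<Sum>\<tau>\<in>PiE J (\<lambda>_. T). (\<Prod>i\<in>J. \<mu> (\<tau> i)) * ((c + (X t - \<pi>)) + (\<Sum>i\<in>J. X (\<tau> i) - \<pi>))\<^sup>2))"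
    unfolding sum_PiE_insert[OF insert.hyps(2)] prod_upd_insert[OF insert.hyps] s
    by (simp add: sum_distrib_left mult_ac add_ac)
  also have "\<dots> = (\<Sum>t\<in>T. \<mu> t * ((c + (X t - \<pi>))\<^sup>2 + card J * (\<pi> - \<pi>\<^sup>2)))"
    unfolding insert.IH ..
  also have "\<dots> = (\<Sum>t\<in>T. \<mu> t * (c\<^sup>2 - 2 * c * \<pi> + \<pi>\<^sup>2 + card J * (\<pi> - \<pi>\<^sup>2)) + (2 * c - 2 * \<pi>) * (\<mu> t * X t) + \<mu> t * (X t)\<^sup>2)"
    by (intro sum.cong) (auto simp: algebra_simps power2_eq_square)
  also have "\<dots> = (c\<^sup>2 - 2 * c * \<pi> + \<pi>\<^sup>2 + card J * (\<pi> - \<pi>\<^sup>2)) + (2 * c - 2 * \<pi>) * \<pi> + \<pi>"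
    by (simp only: sum.distrib sum_distrib_left[symmetric] sum_distrib_right[symmetric] \<mu> \<pi> mult_1)
  also have "\<dots> = c\<^sup>2 + card (insert j J) * (\<pi> - \<pi>\<^sup>2)"
    using insert.hyps by (simp add: algebra_simps power2_eq_square)
  finally show ?case .
qed

lemma product_weights_chebyshev:
  fixes \<mu> X :: "'t \<Rightarrow> real" and \<pi> c h :: real
  assumes J: "finite J" and T: "finite T" and \<mu>: "(\<Sum>t\<in>T. \<mu> t) = 1" "\<And>t. t \<in> T \<Longrightarrow> 0 \<le> \<mu> t"
    and \<pi>: "(\<Sum>t\<in>T. \<mu> t * X t) = \<pi>" "(\<Sum>t\<in>T. \<mu> t * (X t)\<^sup>2) = \<pi>" and h: "h > 0"
  shows "(\<Sum>\<tau>\<in>PiE J (\<lambda>_. T) - {\<tau>. \<bar>(\<Sum>i\<in>J. X (\<tau> i)) - card J * \<pi>\<bar> \<le> h}. \<Prod>i\<in>J. \<mu> (\<tau> i)) \<le> card J * \<pi> / h\<^sup>2"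
proof -
  let ?W = "\<lambda>\<tau>. \<Prod>i\<in>J. \<mu> (\<tau> i)"
  let ?S = "PiE J (\<lambda>_. T)" and ?B = "PiE J (\<lambda>_. T) - {\<tau>. \<bar>(\<Sum>i\<in>J. X (\<tau> i)) - card J * \<pi>\<bar> \<le> h}"
  have fin: "finite ?S" using J T by (intro finite_PiE) auto
  have W0: "0 \<le> (?W \<tau>)" if "\<tau> \<in> ?S" for \<tau>
    using that \<mu> by (intro prod_nonneg) (auto simp: PiE_iff)
  have dev: "(\<Sum>i\<in>J. X (\<tau> i) - \<pi>) = (\<Sum>i\<in>J. X (\<tau> i)) - card J * \<pi>" for \<tau>
    by (simp add: sum_subtractf)
  have "h\<^sup>2 * (\<Sum>\<tau>\<in>?B. ?W \<tau>) = (\<Sum>\<tau>\<in>?B. (?W \<tau>) * h\<^sup>2)"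
    by (simp add: sum_distrib_left mult.commute)
  also have "\<dots> \<le> (\<Sum>\<tau>\<in>?B. (?W \<tau>) * (0 + (\<Sum>i\<in>J. X (\<tau> i) - \<pi>))\<^sup>2)"
  proof (intro sum_mono mult_left_mono W0)
    fix \<tau> assume "\<tau> \<in> ?B"
    then have "\<bar>h\<bar> \<le> \<bar>0 + (\<Sum>i\<in>J. X (\<tau> i) - \<pi>)\<bar>" using h by (auto simp: dev)
    then show "h\<^sup>2 \<le> (0 + (\<Sum>i\<in>J. X (\<tau> i) - \<pi>))\<^sup>2" by (simp only: abs_le_square_iff)
  qed auto
  also have "\<dots> \<le> (\<Sum>\<tau>\<in>?S. (?W \<tau>) * (0 + (\<Sum>i\<in>J. X (\<tau> i) - \<pi>))\<^sup>2)"
    using fin W0 by (intro sum_mono2) auto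
  also have "\<dots> = card J * (\<pi> - \<pi>\<^sup>2)"
    using product_weights_variance[OF J T \<mu>(1) \<pi>, of 0] by simp
  also have "\<dots> \<le> card J * \<pi>" by (intro mult_left_mono) auto
  finally show ?thesis using h by (simp add: field_simps)
qed

text \<open>The sparsity of a draw concentrates within \<delta>/4 of \<open>\<kappa>'\<close> under
  the null prior and of \<open>\<kappa>' + \<delta>\<close> under the alternative. The error budget
  is 0.3 for exchanging the priors, by \<open>tv\<close>, and 0.2 for each atypical set, by
  \<open>var\<close>: in total 0.7, below 0.94.\<close>

lemma minimax_sep_ge_moment_prior:
  fixes n p k0 \<Delta> m N :: nat and a M \<kappa> \<delta> :: real
  assumes \<sigma>: "\<sigma> > 0" and \<gamma>: "\<gamma> \<le> 0.06" and a: "0 < a" "a < M" and m: "m \<ge> 1"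
    and \<delta>: "4 \<le> \<delta>" "\<delta> \<le> \<Delta>" and N: "\<kappa> + \<delta> \<le> N" "N + k0 \<le> p" and budget: "\<kappa> + \<delta> / 4 + 1 \<le> k0"
    and growth: "((M + a) / (M - a)) ^ m \<le> 1 + 2 * \<kappa> / \<delta>"
    and small: "40 * M\<^sup>2 \<le> 1" and tv: "N * sqrt (4 / 10 ^ (2 * m + 2) * exp (20 * real n * M\<^sup>2)) \<le> 0.3"
    and var: "16 * (\<kappa> + \<delta>) / \<delta>\<^sup>2 \<le> 0.2"
  shows "(minimax_sep n p \<sigma> \<gamma> k0 \<Delta>)\<^sup>2 \<ge> ereal (\<delta> / 4 * a\<^sup>2)"
proof -
  have \<delta>0: "\<delta> > 0" using \<delta> by simp
  obtain T :: "(nat \<times> bool) option set" and val \<mu> \<nu> \<kappa>' where T: "finite T"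
    and w: "\<forall>t\<in>T. 0 \<le> \<mu> t \<and> 0 \<le> \<nu> t \<and> \<bar>val t\<bar> \<le> M \<and> (val t = 0 \<or> a \<le> \<bar>val t\<bar>)"
    and s1: "(\<Sum>t\<in>T. \<mu> t) = 1" "(\<Sum>t\<in>T. \<nu> t) = 1"
    and mom: "\<forall>l<2 * m + 2. (\<Sum>t\<in>T. (\<mu> t - \<nu> t) * val t ^ l) = 0"
    and mean: "(\<Sum>t\<in>T. \<mu> t * of_bool (val t \<noteq> 0)) = \<kappa>' / N" "(\<Sum>t\<in>T. \<nu> t * of_bool (val t \<noteq> 0)) = (\<kappa>' + \<delta>) / N"
    and \<kappa>': "0 \<le> \<kappa>'" "\<kappa>' \<le> \<kappa>"
    using moment_matching_priors[OF a m \<delta>0 N(1) growth] by blast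
  have N0: "N > 0" using N(1) \<kappa>' \<delta>0 by (cases N) auto
  \<comment> \<open>The effective null sparsity; the remaining k0 - K units become known spikes.
    Typical alternatives have at least \<open>\<kappa>' + 3 / 4 * \<delta>\<close> nonzero entries,
    hence at least K + \<delta>/2 - 1, which is K + \<delta>/4 or more since \<delta> \<ge> 4; and
    they have at most K + \<delta>.\<close>
  define K where "K = nat \<lceil>\<kappa>' + \<delta> / 4\<rceil>"
  have K: "\<kappa>' + \<delta> / 4 \<le> K" "K \<le> \<kappa>' + \<delta> / 4 + 1"
    using \<kappa>' \<delta>0 unfolding K_def by linarith+
  have Kk: "K \<le> k0" using K(2) budget \<kappa>' by linarith
  define X where "X t = (of_bool (val t \<noteq> 0) :: real)" for t
  define \<theta> where "\<theta> \<tau> j = (if j \<in> {..<N} then val (\<tau> j) else 0)" for \<tau> :: "nat \<Rightarrow> (nat \<times> bool) option" and j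
  define S where "S = PiE {..<N} (\<lambda>_. T)"
  define G where "G = {\<tau>. \<bar>(\<Sum>i<N. X (\<tau> i)) - \<kappa>'\<bar> \<le> \<delta> / 4}"
  define H where "H = {\<tau>. \<bar>(\<Sum>i<N. X (\<tau> i)) - (\<kappa>' + \<delta>)\<bar> \<le> \<delta> / 4}"
  have mX: "(\<Sum>t\<in>T. \<mu> t * X t) = \<kappa>' / N" "(\<Sum>t\<in>T. \<mu> t * (X t)\<^sup>2) = \<kappa>' / N"
    "(\<Sum>t\<in>T. \<nu> t * X t) = (\<kappa>' + \<delta>) / N" "(\<Sum>t\<in>T. \<nu> t * (X t)\<^sup>2) = (\<kappa>' + \<delta>) / N"
  proof -
    have X2: "(X t)\<^sup>2 = X t" for t by (simp add: X_def)
    show "(\<Sum>t\<in>T. \<mu> t * X t) = \<kappa>' / N" "(\<Sum>t\<in>T. \<mu> t * (X t)\<^sup>2) = \<kappa>' / N"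
      "(\<Sum>t\<in>T. \<nu> t * X t) = (\<kappa>' + \<delta>) / N" "(\<Sum>t\<in>T. \<nu> t * (X t)\<^sup>2) = (\<kappa>' + \<delta>) / N"
      unfolding X2 using mean by (simp_all add: X_def)
  qed
  have bad0: "(\<Sum>\<tau>\<in>S - G. \<Prod>i<N. \<mu> (\<tau> i)) \<le> 0.2"
  proof -
    have "(\<Sum>\<tau>\<in>S - G. \<Prod>i<N. \<mu> (\<tau> i)) \<le> \<kappa>' / (\<delta> / 4)\<^sup>2"
      using product_weights_chebyshev[of "{..<N}" T \<mu> X "\<kappa>' / N" "\<delta> / 4"] T s1 w mX \<delta>0 N0
      by (simp add: S_def G_def)
    also have "\<dots> \<le> (\<kappa> + \<delta>) / (\<delta> / 4)\<^sup>2" using \<kappa>' \<delta>0 by (intro divide_right_mono) auto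
    also have "\<dots> = 16 * (\<kappa> + \<delta>) / \<delta>\<^sup>2" by (simp add: power_divide)
    finally show ?thesis using var by linarith
  qed
  have bad1: "(\<Sum>\<tau>\<in>S - H. \<Prod>i<N. \<nu> (\<tau> i)) \<le> 0.2"
  proof -
    have "(\<Sum>\<tau>\<in>S - H. \<Prod>i<N. \<nu> (\<tau> i)) \<le> (\<kappa>' + \<delta>) / (\<delta> / 4)\<^sup>2"
      using product_weights_chebyshev[of "{..<N}" T \<nu> X "(\<kappa>' + \<delta>) / N" "\<delta> / 4"] T s1 w mX \<delta>0 N0
      by (simp add: S_def H_def)
    also have "\<dots> \<le> (\<kappa> + \<delta>) / (\<delta> / 4)\<^sup>2" using \<kappa>' \<delta>0 by (intro divide_right_mono) auto
    also have "\<dots> = 16 * (\<kappa> + \<delta>) / \<delta>\<^sup>2" by (simp add: power_divide)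
    finally show ?thesis using var by linarith
  qed
  have l0: "real (l0norm p (\<theta> \<tau>)) = (\<Sum>i<N. X (\<tau> i))" for \<tau>
  proof -
    have "{j\<in>{..<p}. \<theta> \<tau> j \<noteq> 0} = {j\<in>{..<N}. val (\<tau> j) \<noteq> 0}" using N by (auto simp: \<theta>_def)
    then have "real (l0norm p (\<theta> \<tau>)) = (\<Sum>j\<in>{j\<in>{..<N}. val (\<tau> j) \<noteq> 0}. 1)" by (simp add: l0norm_def)
    also have "\<dots> = (\<Sum>j<N. if val (\<tau> j) \<noteq> 0 then 1 else 0)" by (rule sum.inter_filter) simp
    also have "\<dots> = (\<Sum>i<N. X (\<tau> i))" by (rule sum.cong) (auto simp: X_def)
    finally show ?thesis .
  qed
  have big: "card {j\<in>{..<p}. a \<le> \<bar>\<theta> \<tau> j\<bar>} = l0norm p (\<theta> \<tau>)" if "\<tau> \<in> S" for \<tau>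
  proof -
    have "a \<le> \<bar>\<theta> \<tau> j\<bar> \<longleftrightarrow> \<theta> \<tau> j \<noteq> 0" for j
    proof (cases "j < N")
      case True
      then have "\<tau> j \<in> T" using that by (auto simp: S_def PiE_iff)
      then show ?thesis using w True a by (auto simp: \<theta>_def)
    qed (use a in \<open>simp add: \<theta>_def\<close>)
    then show ?thesis by (simp add: l0norm_def)
  qed
  show ?thesis
  proof (rule minimax_sep_ge_priors[where q="k0 - K" and I=S and u="\<lambda>\<tau>. \<Prod>i<N. \<mu> (\<tau> i)" and G=G and \<mu>=\<theta> and \<delta>="0.2"
        and J=S and w="\<lambda>\<tau>. \<Prod>i<N. \<nu> (\<tau> i)" and H=H and \<nu>=\<theta> and \<epsilon>="0.2" and \<eta>="0.3"])
    show "finite S" using T by (auto simp: S_def intro: finite_PiE)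
    then show "finite S" .
    show "(\<Sum>\<tau>\<in>S. \<Prod>i<N. \<mu> (\<tau> i)) = 1" "(\<Sum>\<tau>\<in>S. \<Prod>i<N. \<nu> (\<tau> i)) = 1"
      unfolding S_def using T s1 by (simp_all add: sum_prod_weights)
    show "(0 :: real) \<le> (\<Prod>i<N. \<mu> (\<tau> i))" "(0 :: real) \<le> (\<Prod>i<N. \<nu> (\<tau> i))" if "\<tau> \<in> S" for \<tau>
      using that w by (auto simp: S_def PiE_iff intro!: prod_nonneg)
    show "\<theta> \<tau> j = 0" "\<theta> \<tau> j = 0" if "p - (k0 - K) \<le> j" for \<tau> j
      using that N by (auto simp: \<theta>_def)
    show "l0norm p (\<theta> \<tau>) + (k0 - K) \<le> k0" if "\<tau> \<in> S \<inter> G" for \<tau>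
    proof -
      have "\<bar>(\<Sum>i<N. X (\<tau> i)) - \<kappa>'\<bar> \<le> \<delta> / 4" using that unfolding G_def by blast
      then have "real (l0norm p (\<theta> \<tau>)) \<le> K" using K unfolding l0 by linarith
      then show ?thesis using Kk by linarith
    qed
    fix \<tau> assume \<tau>: "\<tau> \<in> S \<inter> H"
    then have "\<bar>(\<Sum>i<N. X (\<tau> i)) - (\<kappa>' + \<delta>)\<bar> \<le> \<delta> / 4" unfolding H_def by blast
    then have B: "\<kappa>' + 3 / 4 * \<delta> \<le> l0norm p (\<theta> \<tau>)" "l0norm p (\<theta> \<tau>) \<le> \<kappa>' + 5 / 4 * \<delta>"
      unfolding l0 by linarith+
    then have "real (l0norm p (\<theta> \<tau>)) \<le> real K + real \<Delta>" using K \<delta> by linarith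
    then show "l0norm p (\<theta> \<tau>) + (k0 - K) \<le> k0 + \<Delta>" using Kk by linarith
    show "real k0 + \<delta> / 4 \<le> real (card {j\<in>{..<p}. a \<le> \<bar>\<theta> \<tau> j\<bar>}) + real (k0 - K)"
      using big[of \<tau>] \<tau> B(1) K \<delta> Kk by (auto simp: of_nat_diff)
  next
    fix \<psi> :: "obs \<Rightarrow> real"
    assume \<psi>: "\<psi> \<in> borel_measurable (obs_space n p)" "\<And>\<omega>. 0 \<le> \<psi> \<omega>" "\<And>\<omega>. \<psi> \<omega> \<le> 1"
    have V: "(\<Sum>t\<in>T. \<bar>\<mu> t - \<nu> t\<bar>) \<le> 2"
    proof -
      have "(\<Sum>t\<in>T. \<bar>\<mu> t - \<nu> t\<bar>) \<le> (\<Sum>t\<in>T. \<mu> t + \<nu> t)" using w by (intro sum_mono) (auto simp: abs_le_iff)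
      then show ?thesis by (simp add: sum.distrib s1)
    qed
    have "\<bar>(\<Sum>\<tau>\<in>S. (\<Prod>i\<in>{..<N}. \<mu> (\<tau> i)) * mean_test n p (\<lambda>i. if i \<in> {..<N} then val (\<tau> i) else 0) \<psi>)
      - (\<Sum>\<tau>\<in>S. (\<Prod>i\<in>{..<N}. \<nu> (\<tau> i)) * mean_test n p (\<lambda>i. if i \<in> {..<N} then val (\<tau> i) else 0) \<psi>)\<bar>
      \<le> card {..<N} * sqrt (2\<^sup>2 / 10 ^ (2 * m + 2) * exp (20 * real n * M\<^sup>2))"
      unfolding S_def
    proof (rule hybrid_bound[where \<theta>="\<lambda>_. 0" and G="\<lambda>\<theta>. mean_test n p \<theta> \<psi>"])
      fix \<theta> j assume "j \<in> {..<N}"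
      then have "j < p" using N by auto
      then show "\<bar>\<Sum>t\<in>T. (\<mu> t - \<nu> t) * mean_test n p (\<theta>(j := val t)) \<psi>\<bar> \<le> sqrt (2\<^sup>2 / 10 ^ (2 * m + 2) * exp (20 * real n * M\<^sup>2))"
        using T a w small V mom \<psi> by (intro coordinate_swap_bound) auto
    qed (use T w s1 in auto)
    then show "\<bar>(\<Sum>\<tau>\<in>S. (\<Prod>i<N. \<mu> (\<tau> i)) * mean_test n p (\<theta> \<tau>) \<psi>) - (\<Sum>\<tau>\<in>S. (\<Prod>i<N. \<nu> (\<tau> i)) * mean_test n p (\<theta> \<tau>) \<psi>)\<bar> \<le> 0.3"
      using tv unfolding \<theta>_def by simp
  qed (use \<sigma> \<gamma> a \<delta>0 N bad0 bad1 in auto)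
qed

section \<open>Rates\<close>

lemma minimax_sep_ge_rate:
  fixes n p k0 \<Delta> q :: nat
  assumes p: "p \<ge> 64" and q: "1 \<le> q" "real q \<le> sqrt p" "q \<le> k0" "q \<le> \<Delta>"
    and k0: "2 * k0 \<le> p" and n: "n \<ge> 1" and \<sigma>: "\<sigma> > 0" and \<gamma>: "\<gamma> \<le> 0.06"
  shows "(minimax_sep n p \<sigma> \<gamma> k0 \<Delta>)\<^sup>2 \<ge> ereal (sparse_rate p q / (800 * n))"
proof -
  define T where "T = sparse_rate p q / (400 * n)"
  have "ereal (sparse_rate p q / (800 * n)) \<le> ereal (q * (exp T - 1) / (q + q))"
  proof -
    have "T \<le> exp T - 1" using exp_ge_add_one_self[of T] by linarith
    moreover have "q * (exp T - 1) / (q + q) = (exp T - 1) / 2" using q by (simp add: field_simps)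
    moreover have "sparse_rate p q / (800 * n) = T / 2" by (simp add: T_def)
    ultimately show ?thesis by simp
  qed
  also have "\<dots> \<le> (minimax_sep n p \<sigma> \<gamma> k0 \<Delta>)\<^sup>2"
    using minimax_sep_ge_equal_norm[OF p q(1,2,3) q(1) order_refl q(4) _ n \<sigma> \<gamma>] k0 by (simp add: T_def)
  finally show ?thesis .
qed

text \<open>Block priors reach sparsities up to sqrt p only. No more than a factor 4 is lost, as the
  rate never exceeds sqrt p and is at least q/2 at q = floor (sqrt p).\<close>

lemma sparse_rate_truncate:
  fixes p \<Delta> :: nat
  assumes p: "p \<ge> 4" and \<Delta>: "\<Delta> \<ge> 1"
  shows "\<exists>q\<ge>1. real q \<le> sqrt p \<and> q \<le> \<Delta> \<and> sparse_rate p \<Delta> \<le> 4 * sparse_rate p q"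
proof (cases "real \<Delta> \<le> sqrt p")
  case True
  then show ?thesis using \<Delta> sparse_rate_pos[of \<Delta> p] p by (intro exI[of _ \<Delta>]) auto
next
  case False
  define q where "q = nat \<lfloor>sqrt p\<rfloor>"
  have sp: "sqrt p \<ge> 2" using p by (intro real_le_rsqrt) auto
  then have q: "1 \<le> q" "real q \<le> sqrt p" "sqrt p < q + 1" unfolding q_def by linarith+
  have "1 / 2 \<le> ln (2 :: real)" using ln2_ge_two_thirds by simp
  also have "\<dots> \<le> ln (1 + sqrt p / q)" using q by (subst ln_le_cancel_iff) (auto simp: add_pos_nonneg)
  finally have h: "real q * (1 / 2) \<le> sparse_rate p q" unfolding sparse_rate_def by (intro mult_left_mono) auto
  have "sparse_rate p \<Delta> \<le> \<Delta> * (sqrt p / \<Delta>)"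
    unfolding sparse_rate_def by (intro mult_left_mono ln_add_one_self_le_self) auto
  also have "\<dots> = sqrt p" using \<Delta> by simp
  finally have "sparse_rate p \<Delta> \<le> 4 * sparse_rate p q" using h q by linarith
  then show ?thesis using q False by (intro exI[of _ q]) auto
qed

lemma lower_bound_low_sparsity:
  fixes n p k0 \<Delta> :: nat
  assumes p: "p \<ge> 64" and np: "2 * n \<le> p" and k0: "k0 < n" "real k0 \<le> sqrt p" and \<Delta>: "\<Delta> \<ge> 1"
    and \<sigma>: "\<sigma> > 0" and \<gamma>: "\<gamma> \<le> 0.06"
  shows "(minimax_sep n p \<sigma> \<gamma> k0 \<Delta>)\<^sup>2 \<ge> ereal (1 / 6400 * min (1 / sqrt n + sparse_rate p k0 / n) (sparse_rate p \<Delta> / n))"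
proof -
  let ?sep = "(minimax_sep n p \<sigma> \<gamma> k0 \<Delta>)\<^sup>2"
  have n: "n \<ge> 1" "real n > 0" using k0 by auto
  obtain q where q: "q \<ge> 1" "real q \<le> sqrt p" "q \<le> \<Delta>" "sparse_rate p \<Delta> \<le> 4 * sparse_rate p q"
    using sparse_rate_truncate[of p \<Delta>] p \<Delta> by auto
  define F where "F = sparse_rate p q / n"
  define S where "S = 1 / sqrt (real n)"
  define K where "K = sparse_rate p k0 / n"
  have nn: "F \<ge> 0" "S \<ge> 0" using q n by (auto simp: F_def S_def sparse_rate_def)
  have K0: "K \<ge> 0" unfolding K_def sparse_rate_def by (cases "k0 = 0") auto
  have "sparse_rate p \<Delta> / n \<le> 4 * sparse_rate p q / n" using q(4) n by (intro divide_right_mono) auto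
  \<comment> \<open>The sum inside the minimum is split into two minima, one for the zero-vector
    null and one for priors of equal norm.\<close>
  then have t: "min (S + K) (sparse_rate p \<Delta> / n) \<le> 4 * (min S F + min K F)"
    using nn K0 by (auto simp: F_def min_def)
  have A: "ereal (min S F / 400) \<le> ?sep"
    using minimax_sep_ge_zero_null[OF p q(1,2,3) _ n(1) \<sigma> \<gamma>, of k0] np k0 by (simp add: S_def F_def)
  have B: "ereal (min K F / 800) \<le> ?sep"
  proof (cases "k0 = 0")
    case True
    then have "K = 0" by (simp add: K_def sparse_rate_def)
    then have "min K F = 0" using nn by simp
    then have "ereal (min K F / 800) \<le> ereal (min S F / 400)" using nn by simp
    then show ?thesis using A by (rule order_trans)
  next
    case False
    \<comment> \<open>\<open>q'\<close> respects both sparsity limits, and its rate is one of the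
      two terms of the minimum, so no monotonicity of the rate is involved.\<close>
    define q' where "q' = min q k0"
    have "sparse_rate p q' / n \<ge> min K F" unfolding q'_def F_def K_def by (auto simp: min_def)
    then have "min K F / 800 \<le> sparse_rate p q' / (800 * n)" by simp
    then have "ereal (min K F / 800) \<le> ereal (sparse_rate p q' / (800 * n))" by simp
    also have "\<dots> \<le> ?sep"
      by (rule minimax_sep_ge_rate[OF p _ _ _ _ _ n(1) \<sigma> \<gamma>]) (use False q k0 np in \<open>auto simp: q'_def\<close>)
    finally show ?thesis .
  qed
  have "1 / 6400 * min (S + K) (sparse_rate p \<Delta> / n) \<le> max (min S F / 400) (min K F / 800)"
    using t nn K0 by (auto simp: max_def)
  then have "ereal (1 / 6400 * min (S + K) (sparse_rate p \<Delta> / n)) \<le> ereal (max (min S F / 400) (min K F / 800))" by (simp only: ereal_less_eq)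
  also have "\<dots> \<le> ?sep" using A B by (auto simp: max_def)
  finally show ?thesis by (simp add: S_def K_def)
qed

lemma lower_bound_ultra_high_dim:
  fixes n p k0 \<Delta> :: nat
  assumes p: "p \<ge> 64" and k0: "1 \<le> k0" "real k0 \<le> sqrt p" and n: "n \<ge> 1" and \<Delta>: "\<Delta> \<ge> 1"
    and \<sigma>: "\<sigma> > 0" and \<gamma>: "\<gamma> \<le> 0.06"
  shows "(minimax_sep n p \<sigma> \<gamma> k0 \<Delta>)\<^sup>2 \<ge> ereal (1 / 1600 * real (min \<Delta> k0) / real n * ln (max 2 (sqrt (real p) / real k0)) *
          exp (1 / 800 * real k0 / real n * ln (1 + sqrt (real p) / real k0)))"
proof -
  define d where "d = min \<Delta> k0"
  define l where "l = ln (1 + sqrt p / k0)"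
  define T where "T = k0 * l / (400 * n)"
  have d: "1 \<le> d" "d \<le> k0" "d \<le> \<Delta>" using k0 \<Delta> by (auto simp: d_def)
  have sp: "sqrt p / k0 \<ge> 1" using k0 by simp
  have l0: "l \<ge> 0" using sp unfolding l_def by (intro ln_ge_zero) auto
  have T0: "T \<ge> 0" using l0 by (simp add: T_def)
  \<comment> \<open>Bounding one factor of exp T - 1 from below by T/2 and the other by exp (T/2)
    keeps a linear and an exponential factor at once, at the price of halving the exponent: hence
    1/800 against 1/400.\<close>
  have "exp (T / 2) * exp (T / 2) = exp T" by (simp flip: exp_add)
  then have e: "exp T - 1 = (exp (T / 2) - 1) * (exp (T / 2) + 1)" by (simp add: algebra_simps)
  have "T / 2 * exp (T / 2) \<le> (exp (T / 2) - 1) * (exp (T / 2) + 1)"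
  proof (intro mult_mono)
    show "T / 2 \<le> exp (T / 2) - 1" using exp_ge_add_one_self[of "T / 2"] by linarith
  qed (use T0 in auto)
  then have eT: "T / 2 * exp (T / 2) \<le> exp T - 1" unfolding e .
  have "ln (max 2 (sqrt p / k0)) \<le> l"
    unfolding l_def using sp by (subst ln_le_cancel_iff) auto
  then have "1 / 1600 * d / n * ln (max 2 (sqrt p / k0)) * exp (1 / 800 * k0 / n * l)
    \<le> 1 / 1600 * d / n * l * exp (1 / 800 * k0 / n * l)"
    by (intro mult_right_mono mult_left_mono) auto
  also have "\<dots> = d / (2 * k0) * (T / 2 * exp (T / 2))"
    using k0 n by (simp add: T_def field_simps)
  also have "\<dots> \<le> d / (2 * k0) * (exp T - 1)"
    using eT by (intro mult_left_mono) auto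
  also have "\<dots> \<le> d * (exp T - 1) / (k0 + d)"
  proof -
    have "0 \<le> exp T - 1" using T0 by simp
    then have "d * (exp T - 1) / (2 * k0) \<le> d * (exp T - 1) / (k0 + d)"
      using d k0 by (intro divide_left_mono mult_nonneg_nonneg mult_pos_pos) auto
    then show ?thesis by simp
  qed
  finally have "ereal (1 / 1600 * d / n * ln (max 2 (sqrt p / k0)) * exp (1 / 800 * k0 / n * l)) \<le> ereal (d * (exp T - 1) / (k0 + d))" by simp
  also have "\<dots> \<le> (minimax_sep n p \<sigma> \<gamma> k0 \<Delta>)\<^sup>2"
    using minimax_sep_ge_equal_norm[OF p k0 order_refl d _ n \<sigma> \<gamma>] by (simp add: T_def l_def sparse_rate_def)
  finally show ?thesis by (simp add: d_def l_def)
qed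

text \<open>For \<Delta> below p^(1/4) the claimed rate is at most \<Delta> ln p / n, its logarithm
  being at most ln p, while ln (1 + sqrt p / \<Delta>) is at least ln p / 4. A block prior with q =
  \<Delta> therefore suffices although k0 exceeds sqrt p.\<close>

lemma lower_bound_high_sparsity_small_gap:
  fixes n p k0 \<Delta> :: nat
  assumes p: "p \<ge> 64" and np: "2 * n \<le> p" and k0: "k0 < n" "real k0 > sqrt p" and \<Delta>: "\<Delta> \<ge> 1" "\<Delta> ^ 4 < p"
    and \<sigma>: "\<sigma> > 0" and \<gamma>: "\<gamma> \<le> 0.06"
  shows "(minimax_sep n p \<sigma> \<gamma> k0 \<Delta>)\<^sup>2 \<ge> ereal (1 / 3200 * (\<Delta> / n * (ln (1 + sqrt (k0 / \<Delta>)))\<^sup>2 / ln p))"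
proof -
  let ?W = "ln (1 + sqrt (k0 / \<Delta>))"
  have n: "n \<ge> 1" "real n > 0" using k0 by auto
  have lp: "ln (real p) > 0" using p by simp
  have "(real \<Delta>) ^ 4 < p" using \<Delta>(2) by (metis of_nat_less_iff of_nat_power)
  then have "((real \<Delta>)\<^sup>2)\<^sup>2 < p" by (simp flip: power_mult)
  then have D2: "(real \<Delta>)\<^sup>2 < sqrt p" by (rule real_less_rsqrt)
  have "real \<Delta> * 1 \<le> real \<Delta> * real \<Delta>" using \<Delta> by (intro mult_left_mono) auto
  then have D1: "real \<Delta> \<le> sqrt p" using D2 by (simp add: power2_eq_square)
  have r: "(minimax_sep n p \<sigma> \<gamma> k0 \<Delta>)\<^sup>2 \<ge> ereal (sparse_rate p \<Delta> / (800 * n))"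
    by (rule minimax_sep_ge_rate[OF p _ D1 _ _ _ n(1) \<sigma> \<gamma>]) (use D1 k0 \<Delta> np in auto)
  have "ln (real p) / 4 \<le> ln (1 + sqrt p / \<Delta>)"
  proof -
    have "(sqrt (sqrt p)) \<le> sqrt p / \<Delta>"
    proof -
      have "real \<Delta> \<le> sqrt (sqrt p)" by (rule real_le_rsqrt[OF less_imp_le[OF D2]])
      then have "real \<Delta> * sqrt (sqrt p) \<le> sqrt (sqrt p) * sqrt (sqrt p)" by (intro mult_right_mono) auto
      then show ?thesis using \<Delta> by (simp add: field_simps)
    qed
    then have "ln (sqrt (sqrt p)) \<le> ln (1 + sqrt p / \<Delta>)" using p by (subst ln_le_cancel_iff) (auto simp: add_pos_nonneg)
    then show ?thesis using p by (simp add: ln_sqrt)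
  qed
  then have f: "\<Delta> * (ln p / 4) \<le> sparse_rate p \<Delta>" unfolding sparse_rate_def by (intro mult_left_mono) auto
  have "?W \<le> ln p"
  proof -
    have "real k0 / \<Delta> \<le> k0 / 1" using \<Delta> by (intro divide_left_mono) auto
    also have "\<dots> = k0" by simp
    also have "\<dots> \<le> (real k0)\<^sup>2"
    proof -
      have "1 \<le> real k0" using k0 by (cases "k0 = 0") auto
      then show ?thesis using mult_right_mono[of 1 "real k0" "real k0"] by (simp add: power2_eq_square)
    qed
    finally have "sqrt (k0 / \<Delta>) \<le> k0" by (intro real_le_lsqrt) auto
    then have "1 + sqrt (k0 / \<Delta>) \<le> p" using k0 np by linarith
    then show ?thesis using p by (subst ln_le_cancel_iff) (auto simp: add_pos_nonneg)
  qed
  then have "(?W)\<^sup>2 \<le> (ln p)\<^sup>2" by (intro power_mono ln_ge_zero) auto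
  then have "(?W)\<^sup>2 / ln p \<le> (ln p)\<^sup>2 / ln p" using lp by (intro divide_right_mono) auto
  also have "\<dots> = ln p" by (simp add: power2_eq_square)
  finally have "\<Delta> / n * ((?W)\<^sup>2 / ln p) \<le> \<Delta> / n * ln p" by (intro mult_left_mono) auto
  also have "\<dots> \<le> 4 * (sparse_rate p \<Delta> / n)" using f n by (simp add: field_simps)
  finally have "1 / 3200 * (\<Delta> / n * ((?W)\<^sup>2 / ln p)) \<le> 1 / 3200 * (4 * (sparse_rate p \<Delta> / n))"
    by (intro mult_left_mono) auto
  also have "\<dots> = sparse_rate p \<Delta> / (800 * n)" by simp
  finally have "1 / 3200 * (\<Delta> / n * (?W)\<^sup>2 / ln p) \<le> sparse_rate p \<Delta> / (800 * n)" by simp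
  then have "ereal (1 / 3200 * (\<Delta> / n * (?W)\<^sup>2 / ln p)) \<le> ereal (sparse_rate p \<Delta> / (800 * n))" by simp
  also note r
  finally show ?thesis .
qed

section \<open>Parameters of the moment-matching prior\<close>

lemma total_variation_numeric:
  fixes N m n p :: nat and M :: real
  assumes N: "N \<le> p" and p: "p \<ge> 1" and m: "ln p \<le> m" and M: "20 * real n * M\<^sup>2 \<le> ln p"
  shows "N * sqrt (4 / 10 ^ (2 * m + 2) * exp (20 * real n * M\<^sup>2)) \<le> 0.3"
proof -
  \<comment> \<open>As e^2 \<le> 10 and m \<ge> ln p, 10^m is at least p^2. This pays for the
    exponential, which is at most p, and for up to p exchanges, each of which then costs at most
    0.2/p.\<close>
  have "exp (2 * ln p) \<le> exp (2 * real m)" using m by simp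
  also have "\<dots> = exp 2 ^ m" by (simp add: exp_of_nat_mult[symmetric] mult.commute)
  also have "\<dots> \<le> 10 ^ m"
  proof (rule power_mono)
    have "exp 2 = exp 1 * exp (1::real)" by (simp flip: exp_add)
    also have "\<dots> \<le> 3 * 3" by (intro mult_mono exp_le) auto
    finally show "exp 2 \<le> (10 :: real)" by simp
  qed simp
  finally have p2: "(real p)\<^sup>2 \<le> 10 ^ m" using p by (simp add: exp_double)
  have "exp (20 * real n * M\<^sup>2) \<le> p" using M p by (metis exp_le_cancel_iff exp_ln of_nat_0_less_iff less_le_trans zero_less_one)
  then have "4 / 10 ^ (2 * m + 2) * exp (20 * real n * M\<^sup>2) \<le> 4 / 10 ^ (2 * m + 2) * p" by (intro mult_left_mono) auto
  also have "\<dots> \<le> (0.2 / p)\<^sup>2"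
  proof -
    have "real p * real p ^ 2 \<le> (real p)\<^sup>2 * (real p)\<^sup>2" using p by (intro mult_right_mono) (auto simp: power2_eq_square)
    also have "\<dots> \<le> 10 ^ m * 10 ^ m" using p2 by (intro mult_mono) auto
    also have "\<dots> = 10 ^ (2 * m)" by (simp flip: power_add add: mult_2)
    finally show ?thesis using p by (simp add: power_divide field_simps power_add)
  qed
  finally have "sqrt (4 / 10 ^ (2 * m + 2) * exp (20 * real n * M\<^sup>2)) \<le> 0.2 / p"
    using p by (intro real_le_lsqrt) auto
  then have "N * sqrt (4 / 10 ^ (2 * m + 2) * exp (20 * real n * M\<^sup>2)) \<le> p * (0.2 / p)"
    using N by (intro mult_mono) auto
  then show ?thesis using p by simp
qed

text \<open>Chooses the lower end a = M b of the amplitudes. As (1 + b)/(1 - b) \<le> exp (4 b) for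
  b \<le> 1/4, the m-th power of the extrapolation ratio is at most exp (4 m b), and b is chosen to
  make this equal to 1 + y.\<close>

lemma growth_numeric:
  fixes M b y :: real and m :: nat
  assumes M: "M > 0" and m: "m \<ge> 1" and y: "y > 0" "ln (1 + y) \<le> m" and b: "b = ln (1 + y) / (4 * m)"
  shows "0 < M * b" "M * b < M" "((M + M * b) / (M - M * b)) ^ m \<le> 1 + y"
proof -
  have b0: "b > 0" unfolding b using m y by (intro divide_pos_pos ln_gt_zero) auto
  have b1: "b \<le> 1 / 4" unfolding b using m y by (simp add: field_simps)
  show "0 < M * b" using M b0 by simp
  have "M * b < M * 1" using M b1 by (intro mult_strict_left_mono) auto
  then show "M * b < M" by simp
  have "(M + M * b) / (M - M * b) = (M * (1 + b)) / (M * (1 - b))" by (simp add: algebra_simps)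
  also have "\<dots> = (1 + b) / (1 - b)" using M by simp
  also have "\<dots> \<le> 1 + 4 * b"
    using b0 b1 mult_left_mono[of "4 * b" 1 b] by (simp add: field_simps power2_eq_square)
  also have "\<dots> \<le> exp (4 * b)" by (rule exp_ge_add_one_self)
  finally have "((M + M * b) / (M - M * b)) ^ m \<le> exp (4 * b) ^ m"
    using M \<open>M * b < M\<close> b0 by (intro power_mono divide_nonneg_pos) auto
  also have "\<dots> = exp (m * (4 * b))" by (simp add: exp_of_nat_mult)
  also have "m * (4 * b) = ln (1 + y)" unfolding b using m by simp
  finally show "((M + M * b) / (M - M * b)) ^ m \<le> 1 + y" using y by simp
qed

text \<open>Compares the logarithm L that the prior attains with the claimed one. If D/160 is the
  smaller term, p \<le> D^4 gives ln p \<le> 4 ln D \<le> 16 L, which explains 256 = 16^2. For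
  \<Delta> > k0 the left side is at most k0, by ln (1 + x) \<le> x, and L \<ge> 1.\<close>

lemma log_ratio_numeric:
  fixes D k0 \<Delta> p :: nat and L :: real
  assumes D: "D = min \<Delta> k0" "1024 \<le> D" "p \<le> D ^ 4" and kp: "2 * k0 \<le> p"
    and L: "L = ln (1 + min (2 * (k0 / D)) (D / 160))"
  shows "\<Delta> * (ln (1 + sqrt (k0 / \<Delta>)))\<^sup>2 \<le> 256 * (D * L\<^sup>2)"
proof -
  let ?W = "ln (1 + sqrt (k0 / \<Delta>))"
  have D0: "real D > 0" "D \<le> k0" "D \<le> \<Delta>" using D by auto
  have kD: "real k0 / D \<ge> 1" using D0 by simp
  have min2: "min (2 * (k0 / D)) (D / 160) \<ge> 2"
  proof -
    have "2 * (real k0 / D) \<ge> 2" using kD by linarith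
    moreover have "real D / 160 \<ge> 2" using D(2) by simp
    ultimately show ?thesis by simp
  qed
  have L1: "1 \<le> L"
  proof -
    have "exp 1 \<le> 1 + min (2 * (k0 / D)) (D / 160)" using exp_le min2 by linarith
    then show ?thesis unfolding L using min2 by (subst ln_ge_iff) auto
  qed
  show ?thesis
  proof (cases "\<Delta> \<le> k0")
    case False
    then have Dk: "D = k0" using D by simp
    have "0 \<le> ?W" by (intro ln_ge_zero) auto
    moreover have "?W \<le> sqrt (k0 / \<Delta>)" by (rule ln_add_one_self_le_self) auto
    ultimately have "(?W)\<^sup>2 \<le> (sqrt (k0 / \<Delta>))\<^sup>2" by (intro power_mono)
    also have "\<dots> = k0 / \<Delta>" by simp
    finally have "\<Delta> * (?W)\<^sup>2 \<le> \<Delta> * (k0 / \<Delta>)" by (intro mult_left_mono) auto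
    also have "\<dots> \<le> D * 1" using Dk by (cases "\<Delta> = 0") auto
    also have "\<dots> \<le> 256 * (D * L\<^sup>2)"
    proof -
      have "1 \<le> L\<^sup>2" using L1 by (rule one_le_power)
      then have "real D * 1 \<le> real D * L\<^sup>2" using D0 by (intro mult_left_mono) auto
      then show ?thesis by simp
    qed
    finally show ?thesis .
  next
    case True
    then have D\<Delta>: "D = \<Delta>" using D by simp
    have "?W \<le> 16 * L"
    proof (cases "2 * (real k0 / D) \<le> D / 160")
      case True
      have "x \<le> x\<^sup>2" if "1 \<le> x" for x :: real
        using mult_right_mono[of 1 x x] that by (simp add: power2_eq_square)
      from this[OF kD] have "sqrt (k0 / D) \<le> k0 / D" using kD by (intro real_le_lsqrt) auto
      then have "ln (1 + sqrt (k0 / D)) \<le> ln (1 + 2 * (k0 / D))"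
        using kD by (subst ln_le_cancel_iff) (auto simp: add_pos_nonneg)
      also have "\<dots> = L" using True by (simp add: L min_def)
      also have "\<dots> \<le> 16 * L" using L1 by simp
      finally show ?thesis by (simp add: D\<Delta>)
    next
      case False
      then have Le: "L = ln (1 + D / 160)" by (simp add: L min_def)
      \<comment> \<open>1024^3 exceeds 160^4, so D \<ge> 1024 suffices.\<close>
      have "real D \<le> (1 + D / 160) ^ 4"
      proof -
        have "(1024 :: real) ^ 3 \<le> real D ^ 3" using D by (intro power_mono) auto
        then have "160 ^ 4 \<le> real D ^ 3" by simp
        then have "160 ^ 4 * real D \<le> real D ^ 3 * real D" using D0 by (intro mult_right_mono) auto
        then have "real D \<le> (D / 160) ^ 4" by (simp add: power_divide power4_eq_xxxx power3_eq_cube)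
        also have "\<dots> \<le> (1 + D / 160) ^ 4" by (intro power_mono) auto
        finally show ?thesis .
      qed
      then have "ln (real D) \<le> ln ((1 + D / 160) ^ 4)" using D0 by (subst ln_le_cancel_iff) auto
      also have "\<dots> = 4 * L" unfolding Le by (subst ln_realpow) (auto simp: add_pos_nonneg)
      finally have lD: "ln (real D) \<le> 4 * L" .
      have "ln (real p) \<le> ln (real D ^ 4)"
      proof (subst ln_le_cancel_iff)
        show "0 < real p" using kp D0 by auto
        show "0 < real D ^ 4" using D0 by simp
        show "real p \<le> real D ^ 4" using D(3) by (metis of_nat_le_iff of_nat_power)
      qed
      also have "\<dots> = 4 * ln D" using D0 by (simp add: ln_realpow)
      finally have lp: "ln (real p) \<le> 16 * L" using lD by linarith
      have "sqrt (k0 / D) \<le> k0"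
      proof (intro real_le_lsqrt)
        have "real k0 / D \<le> k0 / 1" using D by (intro divide_left_mono) auto
        also have "\<dots> \<le> (real k0)\<^sup>2" using D0 D(2) by (simp add: power2_eq_square)
        finally show "real k0 / D \<le> (real k0)\<^sup>2" .
      qed auto
      then have "ln (1 + sqrt (k0 / D)) \<le> ln p"
        using kp D0 D(2) by (subst ln_le_cancel_iff) (auto simp: add_pos_nonneg)
      then show ?thesis using lp by (simp add: D\<Delta>)
    qed
    then have "(?W)\<^sup>2 \<le> (16 * L)\<^sup>2"
      by (intro power_mono ln_ge_zero) auto
    then have "\<Delta> * (?W)\<^sup>2 \<le> \<Delta> * (16 * L)\<^sup>2" by (intro mult_left_mono) auto
    then show ?thesis by (simp add: D\<Delta> power_mult_distrib)
  qed
qed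

lemma lower_bound_high_sparsity_large_gap:
  fixes n p k0 \<Delta> :: nat
  assumes p: "p \<ge> 2 ^ 40" and np: "2 * n \<le> p" and k0: "k0 < n" "real k0 > sqrt p" and \<Delta>: "\<Delta> ^ 4 \<ge> p"
    and \<sigma>: "\<sigma> > 0" and \<gamma>: "\<gamma> \<le> 0.06"
  shows "(minimax_sep n p \<sigma> \<gamma> k0 \<Delta>)\<^sup>2 \<ge> ereal (1 / 26214400 * (\<Delta> / n * (ln (1 + sqrt (k0 / \<Delta>)))\<^sup>2 / ln p))"
proof -
  let ?W = "ln (1 + sqrt (k0 / \<Delta>))"
  have n: "n \<ge> 1" "real n > 0" using k0 by auto
  define D where "D = min \<Delta> k0"
  have k04: "p \<le> k0 ^ 4"
  proof -
    have "real p = (sqrt p)\<^sup>2" by simp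
    also have "\<dots> \<le> (real k0)\<^sup>2" using k0 by (intro power_mono) auto
    also have "\<dots> \<le> (real k0) ^ 4" using k0 n p by (intro power_increasing) (auto simp: Suc_le_eq intro: ccontr)
    finally show ?thesis by (metis of_nat_le_iff of_nat_power)
  qed
  have D4: "p \<le> D ^ 4" using k04 \<Delta> by (simp add: D_def min_def)
  have D: "1024 \<le> D"
  proof (rule ccontr)
    assume "\<not> 1024 \<le> D"
    then have "D ^ 4 < 1024 ^ 4" by (intro power_strict_mono) auto
    then show False using D4 p by simp
  qed
  have Dk: "D \<le> k0" "D \<le> \<Delta>" by (auto simp: D_def)
  \<comment> \<open>With this \<delta>, \<kappa> \<le> k0/2 respects the sparsity budget, and
    \<kappa> \<le> D^2/640 bounds 16 \<kappa>/\<delta>^2 by 1/10, keeping the fluctuation of the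
    sparsity below the gap. The ratio 2 \<kappa>/\<delta> is \<open>y\<close>.\<close>
  define \<delta> where "\<delta> = real D / 2"
  define \<kappa> where "\<kappa> = min (real k0 / 2) ((real D)\<^sup>2 / 640)"
  define m where "m = nat \<lceil>ln p\<rceil>"
  \<comment> \<open>Amplitudes of order sqrt (ln p / n) make 20 n M^2 equal to ln p / 10, so that
    the exponential loss stays below p and the matched moments can pay for it.\<close>
  define M where "M = sqrt (ln p / (200 * n))"
  define y where "y = min (2 * (real k0 / D)) (D / 160)"
  define b where "b = ln (1 + y) / (4 * m)"
  define N where "N = nat \<lceil>\<kappa> + \<delta>\<rceil>"
  have lp: "ln (real p) \<ge> 1"
  proof -
    have "(3 :: nat) \<le> p" using p by simp
    then have "exp 1 \<le> real p" using exp_le by linarith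
    then show ?thesis using p by (subst ln_ge_iff) auto
  qed
  have m: "m \<ge> 1" "ln p \<le> m" "m \<le> 2 * ln p" using lp unfolding m_def by linarith+
  have M: "M > 0" "M\<^sup>2 = ln p / (200 * n)" using lp n by (auto simp: M_def)
  have y: "y > 0" "y = 2 * \<kappa> / \<delta>"
  proof -
    show "y > 0" using D Dk by (simp add: y_def)
    show "y = 2 * \<kappa> / \<delta>"
      using D by (auto simp: y_def \<kappa>_def \<delta>_def min_def field_simps power2_eq_square)
  qed
  have ly: "ln (1 + y) \<le> m"
  proof -
    have "1 + y \<le> p" using D Dk k0 np unfolding y_def by linarith
    then have "ln (1 + y) \<le> ln p" using y by (subst ln_le_cancel_iff) auto
    then show ?thesis using m by linarith
  qed
  note g = growth_numeric[OF M(1) m(1) y(1) ly b_def]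
  have \<kappa>: "0 \<le> \<kappa>" "\<kappa> \<le> k0 / 2" "\<kappa> \<le> (real D)\<^sup>2 / 640" by (auto simp: \<kappa>_def)
  have N: "\<kappa> + \<delta> \<le> N" "N \<le> \<kappa> + \<delta> + 1" using \<kappa> unfolding N_def \<delta>_def by linarith+
  \<comment> \<open>Rounding up in N costs one coordinate, which k0 < n absorbs; the N random
    coordinates and at most k0 spikes then fit into 2 n \<le> p.\<close>
  have "real N \<le> real k0 + 1" using N(2) \<kappa>(2) Dk(1) unfolding \<delta>_def by linarith
  then have Nn: "N \<le> n" using k0 by linarith
  have np2: "ln (real p) \<le> 2 * n"
  proof -
    have "ln (real p) = 2 * ln (sqrt p)" using p by (simp add: ln_sqrt)
    also have "\<dots> \<le> 2 * sqrt p" using ln_le_minus_one[of "sqrt p"] p by auto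
    also have "\<dots> \<le> 2 * n" using k0 by linarith
    finally show ?thesis .
  qed
  have main: "(minimax_sep n p \<sigma> \<gamma> k0 \<Delta>)\<^sup>2 \<ge> ereal (\<delta> / 4 * (M * b)\<^sup>2)"
  proof (rule minimax_sep_ge_moment_prior[OF \<sigma> \<gamma> g(1,2) m(1), where \<kappa>=\<kappa> and N=N])
    show "4 \<le> \<delta>" using D by (simp add: \<delta>_def)
    show "\<delta> \<le> real \<Delta>" using Dk by (simp add: \<delta>_def)
    show "\<kappa> + \<delta> \<le> real N" by (rule N)
    show "N + k0 \<le> p" using Nn k0 np by linarith
    show "\<kappa> + \<delta> / 4 + 1 \<le> real k0" using \<kappa>(2) D Dk(1) unfolding \<delta>_def by linarith
    show "((M + M * b) / (M - M * b)) ^ m \<le> 1 + 2 * \<kappa> / \<delta>" using g(3) y(2) by simp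
    show "40 * M\<^sup>2 \<le> 1" unfolding M(2) using np2 n by (simp add: field_simps)
    show "real N * sqrt (4 / 10 ^ (2 * m + 2) * exp (20 * real n * M\<^sup>2)) \<le> 0.3"
    proof (rule total_variation_numeric[OF _ _ m(2)])
      show "N \<le> p" "1 \<le> p" using Nn np n by linarith+
      show "20 * real n * M\<^sup>2 \<le> ln p" unfolding M(2) using n lp by simp
    qed
    have "16 * (\<kappa> + \<delta>) / \<delta>\<^sup>2 \<le> 16 * ((real D)\<^sup>2 / 640 + D / 2) / (D / 2)\<^sup>2"
      unfolding \<delta>_def using \<kappa>(3) by (intro divide_right_mono) auto
    also have "\<dots> = 1 / 10 + 32 / D" using D by (simp add: field_simps power2_eq_square)
    also have "32 / D \<le> 1 / (32 :: real)" using D by (simp add: field_simps)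
    finally show "16 * (\<kappa> + \<delta>) / \<delta>\<^sup>2 \<le> 0.2" by linarith
  qed
  define L where "L = ln (1 + y)"
  have ratio: "\<Delta> * (?W)\<^sup>2 \<le> 256 * (D * L\<^sup>2)"
    by (rule log_ratio_numeric[OF D_def D D4]) (use k0 np in \<open>auto simp: L_def y_def\<close>)
  have "1 / 26214400 * (\<Delta> / n * (?W)\<^sup>2 / ln p) = \<Delta> * (?W)\<^sup>2 / (26214400 * n * ln p)"
    by simp
  also have "\<dots> \<le> 256 * (D * L\<^sup>2) / (26214400 * n * ln p)"
    using ratio lp n by (intro divide_right_mono) auto
  \<comment> \<open>26214400 = 256 * 8 * 200 * 16 * 4, from \<open>ratio\<close>, \<delta>/4 = D/8,
    M^2, the square of 4 m in b, and m \<le> 2 ln p.\<close>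
  also have "\<dots> = D / 8 * (ln p / (200 * n) * (L\<^sup>2 / (16 * (2 * ln p)\<^sup>2)))"
    using lp n by (simp add: field_simps power2_eq_square)
  also have "\<dots> \<le> D / 8 * (ln p / (200 * n) * (L\<^sup>2 / (16 * (real m)\<^sup>2)))"
    using lp n m by (intro mult_left_mono divide_left_mono power_mono mult_pos_pos) auto
  also have "\<dots> = \<delta> / 4 * (M * b)\<^sup>2"
    by (simp add: \<delta>_def power_mult_distrib M(2) b_def L_def power_divide)
  finally have "ereal (1 / 26214400 * (\<Delta> / n * (?W)\<^sup>2 / ln p)) \<le> ereal (\<delta> / 4 * (M * b)\<^sup>2)" by simp
  also note main
  finally show ?thesis .
qed

theorem theorem1:
  shows "\<exists>c0 c1 c2 c3 c4 c5 :: real.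
    c0 > 0 \<and> c1 > 0 \<and> c2 > 0 \<and> c3 > 0 \<and> c4 > 0 \<and> c5 > 0 \<and>
    (\<forall>n p :: nat. \<forall>\<sigma> \<gamma> :: real. \<forall>k0 \<Delta> :: nat.
       p \<ge> 2 * n \<and> real p \<ge> c0 \<and> \<sigma> > 0 \<and> \<gamma> \<le> 0.06 \<and>
       k0 < n \<and> k0 < p \<and> 1 \<le> \<Delta> \<and> \<Delta> \<le> p - k0 \<longrightarrow>
       (minimax_sep n p \<sigma> \<gamma> k0 \<Delta>)\<^sup>2 \<ge> ereal (c1 *
         (if real k0 \<le> sqrt (real p) \<and> k0 \<le> n then
            min (1 / sqrt (real n) +
                   (if k0 = 0 then 0 else real k0 / real n * ln (1 + sqrt (real p) / real k0)))
                (real \<Delta> / real n * ln (1 + sqrt (real p) / real \<Delta>))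
          else
            real \<Delta> / real n * (ln (1 + sqrt (real k0 / real \<Delta>)))\<^sup>2 / ln (real p)))) \<and>
    (\<forall>n p :: nat. \<forall>\<sigma> \<gamma> :: real. \<forall>k0 \<Delta> :: nat.
       p \<ge> 2 * n \<and> real p \<ge> c0 \<and> \<sigma> > 0 \<and> \<gamma> \<le> 0.06 \<and>
       real p \<ge> c2 * (real n)\<^sup>2 \<and>
       real k0 \<ge> c3 * real n / ln (sqrt (real p) / real n) \<and>
       k0 < n \<and> k0 < p \<and> 1 \<le> \<Delta> \<and> \<Delta> \<le> p - k0 \<longrightarrow>
       (minimax_sep n p \<sigma> \<gamma> k0 \<Delta>)\<^sup>2 \<ge> ereal (c4 *
          real (min \<Delta> k0) / real n * ln (max 2 (sqrt (real p) / real k0)) *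
          exp (c5 * real k0 / real n * ln (1 + sqrt (real p) / real k0))))"
\<comment> \<open>2^40 = 1024^4 turns p \<le> D^4 into D \<ge> 1024, and 1/26214400 is the smallest
  constant among the cases of the first claim. c2 = 4 yields 2 n \<le> sqrt p, so the logarithm in
  the lower bound on k0 is positive, and with c3 = 1 this bound forces k0 \<ge> 1.\<close>
proof (rule exI[of _ "2 ^ 40"], rule exI[of _ "1 / 26214400"], rule exI[of _ 4], rule exI[of _ 1],
    rule exI[of _ "1 / 1600"], rule exI[of _ "1 / 800"], intro conjI allI impI, goal_cases)
  case H: (7 n p \<sigma> \<gamma> k0 \<Delta>)
  have "real (2 ^ 40) \<le> real p" using H by simp
  then have p40: "2 ^ 40 \<le> p" by (simp only: of_nat_le_iff)
  have p: "64 \<le> p" by (rule order_trans[OF _ p40]) simp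
  have weaken: "ereal (1 / 26214400 * x) \<le> v" if "ereal (c * x) \<le> v" "1 / 26214400 \<le> c" "0 \<le> x" for x c :: real and v
  proof -
    have "1 / 26214400 * x \<le> c * x" using that by (intro mult_right_mono)
    then have "ereal (1 / 26214400 * x) \<le> ereal (c * x)" by (simp only: ereal_less_eq)
    then show ?thesis using that(1) by (rule order_trans)
  qed
  show ?case
  proof (cases "real k0 \<le> sqrt p")
    case True
    have r: "sparse_rate p k0 / n = (if k0 = 0 then 0 else real k0 / n * ln (1 + sqrt p / k0))"
      "sparse_rate p \<Delta> / n = real \<Delta> / n * ln (1 + sqrt p / \<Delta>)"
      by (simp_all add: sparse_rate_def)
    have nn: "0 \<le> min (1 / sqrt n + sparse_rate p k0 / n) (sparse_rate p \<Delta> / n)"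
      by (auto simp: sparse_rate_def intro!: add_nonneg_nonneg divide_nonneg_nonneg mult_nonneg_nonneg ln_ge_zero)
    have "ereal (1 / 6400 * min (1 / sqrt n + sparse_rate p k0 / n) (sparse_rate p \<Delta> / n)) \<le> (minimax_sep n p \<sigma> \<gamma> k0 \<Delta>)\<^sup>2"
      by (rule lower_bound_low_sparsity[OF p]) (use H True in auto)
    from weaken[OF this _ nn] show ?thesis using True H unfolding r by simp
  next
    case False
    have nn: "0 \<le> \<Delta> / n * (ln (1 + sqrt (k0 / \<Delta>)))\<^sup>2 / ln p"
      using p by (intro divide_nonneg_nonneg mult_nonneg_nonneg) auto
    have "ereal (1 / 26214400 * (\<Delta> / n * (ln (1 + sqrt (k0 / \<Delta>)))\<^sup>2 / ln p)) \<le> (minimax_sep n p \<sigma> \<gamma> k0 \<Delta>)\<^sup>2"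
    proof (cases "\<Delta> ^ 4 < p")
      case True
      show ?thesis
        by (rule weaken[OF lower_bound_high_sparsity_small_gap[OF p] _ nn]) (use H False True in auto)
    next
      case large: False
      show ?thesis
        by (rule lower_bound_high_sparsity_large_gap[OF p40]) (use H False large in auto)
    qed
    then show ?thesis using False by (simp only: if_False simp_thms)
  qed
next
  case H: (8 n p \<sigma> \<gamma> k0 \<Delta>)
  have "real 64 \<le> real p" using H by simp
  then have p: "64 \<le> p" by (simp only: of_nat_le_iff)
  have n: "real n > 0" "1 \<le> n" using H by auto
  have sp: "2 * real n \<le> sqrt p" using H by (intro real_le_rsqrt) (simp add: power_mult_distrib)
  have "1 < sqrt p / n" using sp n by (simp add: field_simps)
  then have "0 < real n / ln (sqrt p / n)" using n by (intro divide_pos_pos ln_gt_zero) auto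
  then have "0 < real k0" using H by simp
  then have k: "1 \<le> k0" by simp
  have "real k0 \<le> sqrt p" using sp H by linarith
  then show ?case
    by (rule lower_bound_ultra_high_dim[OF p k]) (use H n in auto)
qed simp_all

end
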